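(* Let $n\ge 1$ and let $X^{sp}_{\overline\tau_{2n}}\subset Sp_{4n}/P$ be the Schubert variety of the element $\overline\tau_{2n}$ of the Weyl group of $Sp_{4n}$, with its natural action of the torus $T_{2n}$. The torus fixed points $\big(X^{sp}_{\overline\tau_{2n}}\big)^{T_{2n}}$ are parametrized by the symplectic Dellac configurations: there is a bijection between $\mathrm{SpDC}_{2n}$ and $\big(X^{sp}_{\overline\tau_{2n}}\big)^{T_{2n}}$.
   Context: $W$ is the Weyl group of $Sp_{4n}$ (type $C_{2n}$) with simple reflections $r_1,\dots,r_{2n}$, where $r_{2n}$ corresponds to the long simple root. It embeds in $\mathfrak S_{4n}$ (with $s_i=(i,i+1)$) via $r_i\mapsto s_is_{4n-i}$ for $1\le i\le 2n-1$ and $r_{2n}\mapsto s_{2n}$. Set $$\overline\tau_{2n}=(r_{2n}\cdots r_{n+1})\cdots(r_{2n}r_{2n-1}r_{2n-2})(r_{2n}r_{2n-1})r_{2n}\,(r_n\cdots r_{2n-2})\cdots(r_4r_5r_6)(r_3r_4)r_2\in W,$$ i.e. the product of the factors $(r_{2n}r_{2n-1}\cdots r_m)$ for $m=n+1,n+2,\dots,2n$ in this order, followed by the factors $(r_kr_{k+1}\cdots r_{2k-2})$ for $k=n,n-1,\dots,2$ in this order (for $n=1$, $\overline\tau_2=r_2$). Its image in $\mathfrak S_{4n}$ is the permutation $\tau_{2n}$ with $\tau_{2n}(2k-1)=k$, $\tau_{2n}(2k)=2n+k$ for $1\le k\le 2n$. $P\subset Sp_{4n}$ is the standard parabolic subgroup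 (containing a fixed Borel subgroup $B$) whose Weyl group is generated by $J=\{r_1,r_3,\dots,r_{2n-1}\}$; so $Sp_{4n}/P$ is the variety of isotropic flags in $\mathbb C^{4n}$ of dimensions $2,4,\dots,2n$. $X^{sp}_{\overline\tau_{2n}}=\overline{B\overline\tau_{2n}P/P}$, and $T_{2n}\subset B$ is the maximal torus of $Sp_{4n}$. A symplectic Dellac configuration in $\mathrm{SpDC}_{2n}$ is a board with $4n$ columns and $2n$ rows with $4n$ marked cells such that: (1) each column contains exactly one marked cell; (2) each row contains exactly two marked cells; (3) if the cell $(i,j)$ (row $i$, column $j$) is marked, then $i\le j\le 2n+i$; (4) for $1\le i,j\le 2n$, the cell $(i,j)$ is marked if and only if the cell $(2n-i+1,4n-j+1)$ is marked. *)

theory Defs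
  imports
    "Jordan_Normal_Form.Matrix"
    "HOL-Algebra.Left_Coset"
    "HOL-Algebra.Group_Action"
    "HOL-Algebra.Generated_Groups"
    "HOL-Analysis.Abstract_Topology"
    "HOL-Combinatorics.Transposition"
begin

text \<open>
  The group \<open>Sp m\<close> is the rank \<open>m\<close> (size \<open>2m\<close>) complex symplectic group, so that the
  group written $Sp_{4n}$ in the literature is \<open>Sp (2 * n)\<close>. The form pairs the
  \<open>i\<close>-th and the \<open>(2m + 1 - i)\<close>-th basis vector; with this choice the upper triangular
  matrices form a Borel subgroup and the diagonal ones a maximal torus.
  Matrices are indexed from 0, permutations act on \<open>{1..2m}\<close>.
\<close>

definition symp_form :: "nat \<Rightarrow> complex mat" where
  "symp_form m = mat (2 * m) (2 * m)
     (\<lambda>(i, j). if i + j + 1 = 2 * m then (if i < m then 1 else - 1) else 0)"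

definition Sp :: "nat \<Rightarrow> complex mat monoid" where
  "Sp m = \<lparr>carrier = {A \<in> carrier_mat (2 * m) (2 * m).
                       transpose_mat A * symp_form m * A = symp_form m},
           mult = (*), one = 1\<^sub>m (2 * m)\<rparr>"

definition borel_subgroup :: "nat \<Rightarrow> complex mat set" where
  "borel_subgroup m = {A \<in> carrier (Sp m). upper_triangular A}"

definition torus :: "nat \<Rightarrow> complex mat set" where
  "torus m = {A \<in> carrier (Sp m). diagonal_mat A}"

text \<open>The Weyl group is $N(T)/T$; its elements are cosets of \<open>T\<close>, i.e. sets of matrices.\<close>

definition weyl_group :: "nat \<Rightarrow> complex mat set monoid" where
  "weyl_group m = (Sp m)\<lparr>carrier := normalizer (Sp m) (torus m)\<rparr> Mod torus m"

text \<open>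
  The coset of \<open>T\<close> that maps to \<open>\<sigma>\<close> in the symmetric group on \<open>{1..2m}\<close>: all symplectic
  matrices that send each basis vector \<open>e\<^sub>b\<close> to a nonzero multiple of \<open>e\<close> with index \<open>\<sigma> b\<close>.
\<close>

definition perm_coset :: "nat \<Rightarrow> (nat \<Rightarrow> nat) \<Rightarrow> complex mat set" where
  "perm_coset m \<sigma> = {A \<in> carrier (Sp m).
     \<forall>a\<in>{1..2 * m}. \<forall>b\<in>{1..2 * m}. A $$ (a - 1, b - 1) \<noteq> 0 \<longleftrightarrow> a = \<sigma> b}"

definition simple_refl_perm :: "nat \<Rightarrow> nat \<Rightarrow> nat \<Rightarrow> nat" where
  "simple_refl_perm m i =
     (if i = m then transpose m (m + 1)
      else transpose i (i + 1) \<circ> transpose (2 * m - i) (2 * m - i + 1))"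

definition simple_refl :: "nat \<Rightarrow> nat \<Rightarrow> complex mat set" where
  "simple_refl m i = perm_coset m (simple_refl_perm m i)"

definition tau_word :: "nat \<Rightarrow> nat list" where
  "tau_word n =
     concat (map (\<lambda>m. rev [m..<2 * n + 1]) [n + 1..<2 * n + 1]) @
     concat (map (\<lambda>k. [k..<2 * k - 1]) (rev [2..<n + 1]))"

definition tau_bar :: "nat \<Rightarrow> complex mat set" where
  "tau_bar n = foldr (\<lambda>i w. simple_refl (2 * n) i \<otimes>\<^bsub>weyl_group (2 * n)\<^esub> w)
                 (tau_word n) \<one>\<^bsub>weyl_group (2 * n)\<^esub>"

text \<open>
  The standard parabolic subgroup $P_J = B W_J B$ for $J = \{r_1, r_3, \dots, r_{2n-1}\}$.
  Since each \<open>w\<close> is a coset of \<open>T \<subseteq> B\<close>, the double coset $BwB$ is literally the product of sets.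
\<close>

definition parabolic :: "nat \<Rightarrow> complex mat set" where
  "parabolic n =
     (\<Union>w \<in> generate (weyl_group (2 * n)) (simple_refl (2 * n) ` {i \<in> {1..2 * n}. odd i}).
        borel_subgroup (2 * n) <#>\<^bsub>Sp (2 * n)\<^esub> w <#>\<^bsub>Sp (2 * n)\<^esub> borel_subgroup (2 * n))"

definition flag_variety :: "nat \<Rightarrow> complex mat set set" where
  "flag_variety n = lcosets\<^bsub>Sp (2 * n)\<^esub> (parabolic n)"

text \<open>
  Zariski topologies. As \<open>Sp m\<close> is closed in the space of all matrices, its closed sets are the
  zero loci of polynomials in the entries. The quotient map from an algebraic group to its
  quotient by a closed subgroup is open, so the homogeneous space carries the quotient topology.
\<close>

inductive_set entry_polys :: "nat \<Rightarrow> (complex mat \<Rightarrow> complex) set" for d :: nat where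
  const: "(\<lambda>_. c) \<in> entry_polys d"
| entry: "i < d \<Longrightarrow> j < d \<Longrightarrow> (\<lambda>A. A $$ (i, j)) \<in> entry_polys d"
| add: "f \<in> entry_polys d \<Longrightarrow> g \<in> entry_polys d \<Longrightarrow> (\<lambda>A. f A + g A) \<in> entry_polys d"
| mult: "f \<in> entry_polys d \<Longrightarrow> g \<in> entry_polys d \<Longrightarrow> (\<lambda>A. f A * g A) \<in> entry_polys d"

definition zariski_open_Sp :: "nat \<Rightarrow> complex mat set \<Rightarrow> bool" where
  "zariski_open_Sp m U \<longleftrightarrow>
     (\<exists>F \<subseteq> entry_polys (2 * m). U = carrier (Sp m) - {A. \<forall>f\<in>F. f A = 0})"

definition zariski_Sp :: "nat \<Rightarrow> complex mat topology" where
  "zariski_Sp m = topology (zariski_open_Sp m)"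

lemma istopology_zariski_open_Sp: "istopology (zariski_open_Sp m)"
  unfolding istopology_def
proof (intro conjI allI impI)
  fix S T assume "zariski_open_Sp m S" "zariski_open_Sp m T"
  then obtain F G where F: "F \<subseteq> entry_polys (2 * m)" "S = carrier (Sp m) - {A. \<forall>f\<in>F. f A = 0}"
    and G: "G \<subseteq> entry_polys (2 * m)" "T = carrier (Sp m) - {A. \<forall>f\<in>G. f A = 0}"
    unfolding zariski_open_Sp_def by blast
  let ?H = "(\<lambda>(f, g). \<lambda>A. f A * g A) ` (F \<times> G)"
  have "?H \<subseteq> entry_polys (2 * m)"
    using F(1) G(1) by (auto intro!: entry_polys.mult)
  moreover have "S \<inter> T = carrier (Sp m) - {A. \<forall>f\<in>?H. f A = 0}"
    unfolding F(2) G(2) by auto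
  ultimately show "zariski_open_Sp m (S \<inter> T)"
    unfolding zariski_open_Sp_def by blast
next
  fix \<K> assume K: "\<forall>K\<in>\<K>. zariski_open_Sp m K"
  let ?F = "\<Union>{F. F \<subseteq> entry_polys (2 * m) \<and> carrier (Sp m) - {A. \<forall>f\<in>F. f A = 0} \<in> \<K>}"
  have "\<Union>\<K> = carrier (Sp m) - {A. \<forall>f\<in>?F. f A = 0}"
  proof (intro subset_antisym subsetI)
    fix A assume "A \<in> \<Union>\<K>"
    then obtain K where AK: "A \<in> K" "K \<in> \<K>" by (rule UnionE)
    with K obtain F where F: "F \<subseteq> entry_polys (2 * m)"
        and KF: "K = carrier (Sp m) - {A. \<forall>f\<in>F. f A = 0}"
      unfolding zariski_open_Sp_def by blast
    from F AK(2) have "F \<subseteq> ?F" unfolding KF by (intro Union_upper CollectI conjI)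
    with AK(1) show "A \<in> carrier (Sp m) - {A. \<forall>f\<in>?F. f A = 0}" unfolding KF by blast
  next
    fix A assume "A \<in> carrier (Sp m) - {A. \<forall>f\<in>?F. f A = 0}"
    then show "A \<in> \<Union>\<K>" by blast
  qed
  moreover have "?F \<subseteq> entry_polys (2 * m)" by blast
  ultimately show "zariski_open_Sp m (\<Union>\<K>)"
    unfolding zariski_open_Sp_def by (intro exI[of _ ?F] conjI)
qed

lemma openin_zariski_Sp: "openin (zariski_Sp m) = zariski_open_Sp m"
  unfolding zariski_Sp_def by (simp add: istopology_zariski_open_Sp topology_inverse')

definition zariski_open_flag :: "nat \<Rightarrow> complex mat set set \<Rightarrow> bool" where
  "zariski_open_flag n V \<longleftrightarrow> V \<subseteq> flag_variety n \<and>
     openin (zariski_Sp (2 * n))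
       {A \<in> carrier (Sp (2 * n)). A <#\<^bsub>Sp (2 * n)\<^esub> parabolic n \<in> V}"

definition zariski_flag :: "nat \<Rightarrow> complex mat set topology" where
  "zariski_flag n = topology (zariski_open_flag n)"

lemma istopology_zariski_open_flag: "istopology (zariski_open_flag n)"
  unfolding istopology_def
proof (intro conjI allI impI)
  let ?pre = "\<lambda>V. {A \<in> carrier (Sp (2 * n)). A <#\<^bsub>Sp (2 * n)\<^esub> parabolic n \<in> V}"
  fix S T assume ST: "zariski_open_flag n S" "zariski_open_flag n T"
  have "?pre (S \<inter> T) = ?pre S \<inter> ?pre T" by blast
  moreover have "openin (zariski_Sp (2 * n)) (?pre S \<inter> ?pre T)"
    using ST unfolding zariski_open_flag_def by (blast intro: openin_Int)
  ultimately show "zariski_open_flag n (S \<inter> T)"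
    using ST unfolding zariski_open_flag_def by (metis le_infI1)
next
  let ?pre = "\<lambda>V. {A \<in> carrier (Sp (2 * n)). A <#\<^bsub>Sp (2 * n)\<^esub> parabolic n \<in> V}"
  fix \<K> assume K: "\<forall>K\<in>\<K>. zariski_open_flag n K"
  have "?pre (\<Union>\<K>) = (\<Union>K\<in>\<K>. ?pre K)" by blast
  moreover have "openin (zariski_Sp (2 * n)) (\<Union>K\<in>\<K>. ?pre K)"
    using K unfolding zariski_open_flag_def by (intro openin_Union) blast
  ultimately show "zariski_open_flag n (\<Union>\<K>)"
    using K unfolding zariski_open_flag_def by (metis Union_least)
qed

lemma openin_zariski_flag: "openin (zariski_flag n) = zariski_open_flag n"
  unfolding zariski_flag_def by (simp add: istopology_zariski_open_flag topology_inverse')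

definition schubert_cell :: "nat \<Rightarrow> complex mat set set" where
  "schubert_cell n = {A <#\<^bsub>Sp (2 * n)\<^esub> parabolic n | A.
     A \<in> borel_subgroup (2 * n) <#>\<^bsub>Sp (2 * n)\<^esub> tau_bar n}"

definition schubert_variety :: "nat \<Rightarrow> complex mat set set" where
  "schubert_variety n = zariski_flag n closure_of schubert_cell n"

definition schubert_fixed_points :: "nat \<Rightarrow> complex mat set set" where
  "schubert_fixed_points n =
     {x \<in> schubert_variety n. \<forall>t \<in> torus (2 * n). t <#\<^bsub>Sp (2 * n)\<^esub> x = x}"

text \<open>A configuration is its set of marked cells \<open>(row, column)\<close>.\<close>

definition SpDC :: "nat \<Rightarrow> (nat \<times> nat) set set" where
  "SpDC n = {D. D \<subseteq> {1..2 * n} \<times> {1..4 * n} \<and> card D = 4 * n \<and>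
     (\<forall>j\<in>{1..4 * n}. \<exists>!i. (i, j) \<in> D) \<and>
     (\<forall>i\<in>{1..2 * n}. card {j. (i, j) \<in> D} = 2) \<and>
     (\<forall>(i, j)\<in>D. i \<le> j \<and> j \<le> 2 * n + i) \<and>
     (\<forall>i\<in>{1..2 * n}. \<forall>j\<in>{1..2 * n}.
        (i, j) \<in> D \<longleftrightarrow> (2 * n - i + 1, 4 * n - j + 1) \<in> D)}"

end

theory Submission
  imports Defs "HOL-Algebra.Zassenhaus" "Jordan_Normal_Form.Determinant"
begin

text \<open>
  The parabolic subgroup consists of the symplectic matrices that are upper triangular in
  $2 \times 2$ blocks. If the coset of \<open>A\<close> is fixed by the torus, then $A^{-1} E_{aa} A$ is block
  upper triangular for every \<open>a\<close>; it is idempotent of trace 1, so exactly one of its diagonal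
  blocks has trace 1. Calling the index of this block the row of the column \<open>a\<close>, one finds that
  the fixed points of the flag variety correspond to the fillings in which each row has two marks
  and which satisfy the symmetry condition.

  For $\overline\tau_{2n}$ the Schubert conditions say that $A_{aq} = 0$ for $a > 2n + k$ and \<open>q\<close> in
  the \<open>k\<close>-th block. These are closed conditions, and on fixed points they amount to the bounds
  $i \le j \le 2n + i$. Conversely, as long as a configuration differs from the one of
  $\overline\tau_{2n}$, two of its columns and their mirror images can be exchanged so that the
  result is a configuration that is larger in the Bruhat order. A one-parameter unipotent
  subgroup degenerates the cell of the larger configuration to the smaller fixed point, and by
  induction all configurations give points of the Schubert variety.
\<close>


text \<open>Rows of a matrix correspond to columns of a configuration; blocks of two matrix columns,
  the steps of the flag, correspond to its rows. Everything is phrased through supports: a fixed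
  coset is recognized by inequalities \<open>r a \<le> q div 2\<close> on the nonzero entries of any
  representative, and the support of an inverse is the antidiagonal reflection of the support. The
  Schubert variety is a closure in a quotient topology, so it is accessed through its preimage in
  the group, a zero set of polynomials in the entries. This serves both directions: vanishing
  entries bound the fixed points, and continuity of polynomials in the complex topology lets limits
  of curves stay inside. The Borel element that carries a point of the degenerating curve into the
  larger cell depends on the parameter and has no limit; the induction therefore has to carry the
  whole Borel orbit of a fixed point and not just the point. The two bounds on a configuration are
  exchanged by the mirror symmetry, so one family of equations controls both.\<close>

section \<open>The symplectic group with an explicit inverse\<close>

definition sgn_half :: "nat \<Rightarrow> nat \<Rightarrow> complex" where
  "sgn_half m i = (if i < m then 1 else - 1)"

text \<open>The adjoint of \<open>A\<close> with respect to the form. It is written entrywise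
  because an entry of it is nonzero exactly when the reflected entry of \<open>A\<close> is; all
  support arguments for inverses rest on this.\<close>

definition sp_inv :: "nat \<Rightarrow> complex mat \<Rightarrow> complex mat" where
  "sp_inv m A = mat (2 * m) (2 * m)
     (\<lambda>(p, a). sgn_half m p * sgn_half m a * A $$ (2 * m - 1 - a, 2 * m - 1 - p))"

lemma sgn_half_sq [simp]: "sgn_half m i * sgn_half m i = 1" "sgn_half m i * (sgn_half m i * x) = x"
  by (auto simp: sgn_half_def)

lemma sgn_half_nz [simp]: "sgn_half m i \<noteq> 0"
  by (simp add: sgn_half_def)

lemma sgn_half_flip [simp]: "i < 2 * m \<Longrightarrow> sgn_half m (2 * m - Suc i) = - sgn_half m i"
  by (auto simp: sgn_half_def)

lemma symp_form_carrier [simp]: "symp_form m \<in> carrier_mat (2 * m) (2 * m)"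
  by (simp add: symp_form_def)

lemma sum_delta_flip:
  assumes "i < 2 * m"
  shows "(\<Sum>k<2*m. if k + i + 1 = 2 * m then f k else (0::complex)) = f (2 * m - Suc i)"
proof -
  have "(\<Sum>k<2*m. if k + i + 1 = 2 * m then f k else 0)
      = (\<Sum>k<2*m. if k = 2 * m - Suc i then f k else 0)"
    using assms by (intro sum.cong) auto
  then show ?thesis using assms by simp
qed

lemma sum_flip: "(\<Sum>k<d. f (d - Suc k)) = (\<Sum>k<d. f k :: complex)"
  by (rule sum.nat_diff_reindex)

lemma mat_mult_entry:
  assumes "A \<in> carrier_mat d d" "B \<in> carrier_mat d d" "i < d" "j < d"
  shows "(A * B) $$ (i, j) = (\<Sum>k<d. A $$ (i, k) * B $$ (k, j))"
  using assms by (simp add: scalar_prod_def lessThan_atLeast0)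

lemma form_entry:
  assumes A: "A \<in> carrier_mat (2*m) (2*m)" and ij: "i < 2*m" "j < 2*m"
  shows "(transpose_mat A * symp_form m * A) $$ (i, j)
       = (\<Sum>k<2*m. sgn_half m k * A $$ (k, i) * A $$ (2*m - Suc k, j))"
proof -
  have 1: "(transpose_mat A * symp_form m) $$ (i, l)
      = sgn_half m (2*m - Suc l) * A $$ (2*m - Suc l, i)" if "l < 2*m" for l
  proof -
    have "(transpose_mat A * symp_form m) $$ (i, l)
      = (\<Sum>k<2*m. if k + l + 1 = 2 * m then sgn_half m k * A $$ (k, i) else 0)"
      using A ij that
      by (subst mat_mult_entry[of _ "2*m"])
         (auto intro!: sum.cong simp: symp_form_def sgn_half_def)
    also have "\<dots> = sgn_half m (2*m - Suc l) * A $$ (2*m - Suc l, i)"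
      using that by (rule sum_delta_flip)
    finally show ?thesis .
  qed
  have "(transpose_mat A * symp_form m * A) $$ (i, j)
      = (\<Sum>l<2*m. sgn_half m (2*m - Suc l) * A $$ (2*m - Suc l, i) * A $$ (l, j))"
    using A ij by (subst mat_mult_entry[of _ "2*m"]) (auto intro!: sum.cong simp del: index_mult_mat simp: 1)
  also have "\<dots> = (\<Sum>l<2*m. sgn_half m (2*m - Suc l) * A $$ (2*m - Suc l, i)
                       * A $$ (2*m - Suc (2*m - Suc l), j))"
    by (intro sum.cong) auto
  also have "\<dots> = (\<Sum>k<2*m. sgn_half m k * A $$ (k, i) * A $$ (2*m - Suc k, j))"
    by (rule sum_flip[where f="\<lambda>k. sgn_half m k * A $$ (k, i) * A $$ (2*m - Suc k, j)"])
  finally show ?thesis .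
qed

lemma sp_inv_carrier [simp]: "sp_inv m A \<in> carrier_mat (2*m) (2*m)"
  by (simp add: sp_inv_def)

lemma sp_inv_index:
  "p < 2*m \<Longrightarrow> a < 2*m \<Longrightarrow>
   sp_inv m A $$ (p, a) = sgn_half m p * sgn_half m a * A $$ (2*m - Suc a, 2*m - Suc p)"
  by (simp add: sp_inv_def)

lemma sp_inv_mult_entry:
  assumes A: "A \<in> carrier_mat (2*m) (2*m)" and ij: "i < 2*m" "j < 2*m"
  shows "(sp_inv m A * A) $$ (i, j)
       = sgn_half m i * (transpose_mat A * symp_form m * A) $$ (j, 2*m - Suc i)"
proof -
  have "(sp_inv m A * A) $$ (i, j) = (\<Sum>k<2*m. sp_inv m A $$ (i, k) * A $$ (k, j))"
    using A ij by (intro mat_mult_entry) auto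
  also have "\<dots> = (\<Sum>k<2*m. sgn_half m i * (sgn_half m k * A $$ (k, j) * A $$ (2*m - Suc k, 2*m - Suc i)))"
  proof (rule sum.cong[OF refl])
    fix k assume "k \<in> {..<2*m}"
    then have "sp_inv m A $$ (i, k) = sgn_half m i * sgn_half m k * A $$ (2*m - Suc k, 2*m - Suc i)"
      using ij by (simp add: sp_inv_index)
    then show "sp_inv m A $$ (i, k) * A $$ (k, j)
       = sgn_half m i * (sgn_half m k * A $$ (k, j) * A $$ (2*m - Suc k, 2*m - Suc i))"
      by (simp only: mult_ac)
  qed
  also have "\<dots> = sgn_half m i * (transpose_mat A * symp_form m * A) $$ (j, 2*m - Suc i)"
    using ij by (subst form_entry[OF A]) (auto simp: sum_distrib_left)
  finally show ?thesis .
qed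

text \<open>The isometry equation and the equation for a left inverse are the same scalar equations,
  up to signs and the reindexing of \<open>i\<close> by \<open>2*m - Suc i\<close>.\<close>

lemma carrier_Sp: "A \<in> carrier (Sp m) \<longleftrightarrow>
   A \<in> carrier_mat (2*m) (2*m) \<and> sp_inv m A * A = 1\<^sub>m (2*m)"
proof (cases "A \<in> carrier_mat (2*m) (2*m)")
  case A: True
  let ?L = "transpose_mat A * symp_form m * A"
  have "?L = symp_form m \<longleftrightarrow> (\<forall>i<2*m. \<forall>j<2*m. ?L $$ (i,j) = symp_form m $$ (i,j))"
  proof
    assume *: "\<forall>i<2*m. \<forall>j<2*m. ?L $$ (i,j) = symp_form m $$ (i,j)"
    show "?L = symp_form m"
    proof (rule eq_matI)
      show "\<And>i j. i < dim_row (symp_form m) \<Longrightarrow> j < dim_col (symp_form m) \<Longrightarrow>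
        ?L $$ (i,j) = symp_form m $$ (i,j)"
        using * by (simp add: symp_form_def)
    qed (use A in \<open>auto simp: symp_form_def\<close>)
  qed simp
  also have "\<dots> \<longleftrightarrow> (\<forall>i<2*m. \<forall>j<2*m.
      (sp_inv m A * A) $$ (i, j) = sgn_half m i * symp_form m $$ (j, 2*m - Suc i))"
  proof (intro iffI allI impI)
    fix i j assume *: "\<forall>i<2*m. \<forall>j<2*m. ?L $$ (i,j) = symp_form m $$ (i,j)" and "i < 2*m" "j < 2*m"
    then show "(sp_inv m A * A) $$ (i, j) = sgn_half m i * symp_form m $$ (j, 2*m - Suc i)"
      using A by (subst sp_inv_mult_entry) (auto simp del: index_mult_mat)
  next
    fix i j assume *: "\<forall>i<2*m. \<forall>j<2*m.
      (sp_inv m A * A) $$ (i, j) = sgn_half m i * symp_form m $$ (j, 2*m - Suc i)"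
      and ij: "i < 2*m" "j < 2*m"
    define k where "k = 2*m - Suc j"
    have k: "k < 2*m" "j = 2*m - Suc k" using ij by (auto simp: k_def)
    have "sgn_half m k * ?L $$ (i, j) = sgn_half m k * symp_form m $$ (i, j)"
      using *[rule_format, OF k(1) ij(1)] sp_inv_mult_entry[OF A k(1) ij(1)] k(2) by simp
    then show "?L $$ (i,j) = symp_form m $$ (i,j)" by simp
  qed
  also have "\<dots> \<longleftrightarrow> (\<forall>i<2*m. \<forall>j<2*m. (sp_inv m A * A) $$ (i, j) = 1\<^sub>m (2*m) $$ (i, j))"
  proof -
    have "sgn_half m i * symp_form m $$ (j, 2*m - Suc i) = 1\<^sub>m (2*m) $$ (i, j)"
      if "i < 2*m" "j < 2*m" for i j
      using that by (auto simp: symp_form_def sgn_half_def)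
    then show ?thesis by (simp del: index_mult_mat)
  qed
  also have "\<dots> \<longleftrightarrow> sp_inv m A * A = 1\<^sub>m (2*m)"
  proof
    assume *: "\<forall>i<2*m. \<forall>j<2*m. (sp_inv m A * A) $$ (i, j) = 1\<^sub>m (2*m) $$ (i, j)"
    show "sp_inv m A * A = 1\<^sub>m (2*m)"
    proof (rule eq_matI)
      show "\<And>i j. i < dim_row (1\<^sub>m (2*m)) \<Longrightarrow> j < dim_col (1\<^sub>m (2*m)) \<Longrightarrow>
        (sp_inv m A * A) $$ (i,j) = 1\<^sub>m (2*m) $$ (i,j)"
        using * by simp
    qed (use A in \<open>auto simp: sp_inv_def\<close>)
  qed simp
  finally show ?thesis using A by (simp add: Sp_def)
qed (simp add: Sp_def)

lemma Sp_dims: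
  assumes "A \<in> carrier (Sp m)"
  shows "A \<in> carrier_mat (2*m) (2*m)" "dim_row A = 2*m" "dim_col A = 2*m"
  using assms by (auto simp: carrier_Sp)

lemma Sp_simps [simp]: "mult (Sp m) = (*)" "one (Sp m) = 1\<^sub>m (2*m)"
  by (simp_all add: Sp_def)

lemma sp_inv_left: "A \<in> carrier (Sp m) \<Longrightarrow> sp_inv m A * A = 1\<^sub>m (2*m)"
  by (simp add: carrier_Sp)

lemma sp_inv_right: "A \<in> carrier (Sp m) \<Longrightarrow> A * sp_inv m A = 1\<^sub>m (2*m)"
  using mat_mult_left_right_inverse[of "sp_inv m A" "2*m" A] by (simp add: carrier_Sp)

lemma sp_inv_sp_inv: "A \<in> carrier_mat (2*m) (2*m) \<Longrightarrow> sp_inv m (sp_inv m A) = A"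
proof (rule eq_matI)
  fix i j assume "A \<in> carrier_mat (2*m) (2*m)" "i < dim_row A" "j < dim_col A"
  then show "sp_inv m (sp_inv m A) $$ (i, j) = A $$ (i, j)"
    by (simp add: sp_inv_index)
qed (auto simp: sp_inv_def)

lemma sp_inv_closed: "A \<in> carrier (Sp m) \<Longrightarrow> sp_inv m A \<in> carrier (Sp m)"
  using sp_inv_right[of A m] sp_inv_sp_inv[of A m] by (simp add: carrier_Sp)

lemma sp_inv_mult:
  assumes A: "A \<in> carrier_mat (2*m) (2*m)" and B: "B \<in> carrier_mat (2*m) (2*m)"
  shows "sp_inv m (A * B) = sp_inv m B * sp_inv m A"
proof (rule eq_matI)
  fix i j assume "i < dim_row (sp_inv m B * sp_inv m A)" "j < dim_col (sp_inv m B * sp_inv m A)"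
  then have ij: "i < 2*m" "j < 2*m" by (auto simp: sp_inv_def)
  have "(sp_inv m B * sp_inv m A) $$ (i, j) = (\<Sum>k<2*m. sgn_half m i * sgn_half m j *
      (A $$ (2*m - Suc j, 2*m - Suc k) * B $$ (2*m - Suc k, 2*m - Suc i)))"
    using ij by (subst mat_mult_entry[of _ "2*m"]) (auto intro!: sum.cong simp: sp_inv_index)
  also have "\<dots> = (\<Sum>k<2*m. sgn_half m i * sgn_half m j *
      (A $$ (2*m - Suc j, k) * B $$ (k, 2*m - Suc i)))"
    by (rule sum_flip[where f="\<lambda>k. sgn_half m i * sgn_half m j *
      (A $$ (2*m - Suc j, k) * B $$ (k, 2*m - Suc i))"])
  also have "\<dots> = sp_inv m (A * B) $$ (i, j)"
    using ij A B by (simp del: index_mult_mat add: sp_inv_index mat_mult_entry[of _ "2*m"] sum_distrib_left)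
  finally show "sp_inv m (A * B) $$ (i, j) = (sp_inv m B * sp_inv m A) $$ (i, j)" by simp
qed (auto simp: sp_inv_def)

lemma one_mat_Sp: "1\<^sub>m (2*m) \<in> carrier (Sp m)"
proof -
  have "sp_inv m (1\<^sub>m (2*m)) = 1\<^sub>m (2*m)"
    by (rule eq_matI) (auto simp: sp_inv_def)
  then show ?thesis by (simp add: carrier_Sp)
qed

lemma mult_mat_Sp:
  assumes "A \<in> carrier (Sp m)" "B \<in> carrier (Sp m)"
  shows "A * B \<in> carrier (Sp m)"
proof -
  have c: "A \<in> carrier_mat (2*m) (2*m)" "B \<in> carrier_mat (2*m) (2*m)"
    using assms by (auto dest: Sp_dims)
  have "sp_inv m (A * B) * (A * B) = sp_inv m B * (sp_inv m A * (A * B))"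
    using c by (simp add: sp_inv_mult assoc_mult_mat[of _ "2*m" "2*m" _ "2*m" _ "2*m"])
  also have "sp_inv m A * (A * B) = (sp_inv m A * A) * B"
    using c by (simp add: assoc_mult_mat[of _ "2*m" "2*m" _ "2*m" _ "2*m"])
  finally show ?thesis using c assms by (simp add: carrier_Sp)
qed

lemma group_Sp: "group (Sp m)"
proof (rule groupI)
  fix x y z assume "x \<in> carrier (Sp m)" "y \<in> carrier (Sp m)" "z \<in> carrier (Sp m)"
  then have "x \<in> carrier_mat (2*m) (2*m)" "y \<in> carrier_mat (2*m) (2*m)" "z \<in> carrier_mat (2*m) (2*m)"
    by (auto dest: Sp_dims)
  then show "x \<otimes>\<^bsub>Sp m\<^esub> y \<otimes>\<^bsub>Sp m\<^esub> z = x \<otimes>\<^bsub>Sp m\<^esub> (y \<otimes>\<^bsub>Sp m\<^esub> z)" by simp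
next
  fix x assume "x \<in> carrier (Sp m)"
  then show "\<exists>y\<in>carrier (Sp m). y \<otimes>\<^bsub>Sp m\<^esub> x = \<one>\<^bsub>Sp m\<^esub>"
    by (intro bexI[of _ "sp_inv m x"]) (simp_all add: sp_inv_closed sp_inv_left)
qed (auto simp: mult_mat_Sp one_mat_Sp dest: Sp_dims)

lemma m_inv_Sp: "A \<in> carrier (Sp m) \<Longrightarrow> inv\<^bsub>Sp m\<^esub> A = sp_inv m A"
  by (rule group.inv_equality[OF group_Sp]) (simp_all add: sp_inv_left sp_inv_closed)

lemma Sp_assoc:
  assumes "A \<in> carrier (Sp m)" "B \<in> carrier (Sp m)" "C \<in> carrier (Sp m)"
  shows "A * B * C = A * (B * C)"
  using group.is_monoid[OF group_Sp[of m], THEN monoid.m_assoc, OF assms] by simp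

lemma Sp_cancel:
  assumes "A \<in> carrier (Sp m)" "B \<in> carrier (Sp m)"
  shows "sp_inv m A * (A * B) = B" "A * (sp_inv m A * B) = B"
    "B * A * sp_inv m A = B" "B * sp_inv m A * A = B"
  using assms by (auto simp: Sp_assoc sp_inv_closed sp_inv_left sp_inv_right mult_mat_Sp
     Sp_assoc[symmetric, of "sp_inv m A" m A B] Sp_assoc[symmetric, of A m "sp_inv m A" B] dest: Sp_dims)

lemma Sp_mult_entry:
  assumes "A \<in> carrier (Sp m)" "B \<in> carrier (Sp m)" "i < 2*m" "j < 2*m"
  shows "(A * B) $$ (i, j) = (\<Sum>k<2*m. A $$ (i, k) * B $$ (k, j))"
  using assms by (intro mat_mult_entry) (auto dest: Sp_dims)

subsection \<open>Subgroups given by supports\<close>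

text \<open>With \<open>f = id\<close> this is the Borel subgroup, with \<open>f q = q div 2\<close> the parabolic one.\<close>

definition supp_group :: "nat \<Rightarrow> (nat \<Rightarrow> nat) \<Rightarrow> complex mat set" where
  "supp_group m f = {A \<in> carrier (Sp m). \<forall>a<2*m. \<forall>q<2*m. A $$ (a, q) \<noteq> 0 \<longrightarrow> f a \<le> f q}"

lemma supp_groupD:
  "A \<in> supp_group m f \<Longrightarrow> A \<in> carrier (Sp m)"
  "A \<in> supp_group m f \<Longrightarrow> a < 2*m \<Longrightarrow> q < 2*m \<Longrightarrow> A $$ (a, q) \<noteq> 0 \<Longrightarrow> f a \<le> f q"
  by (auto simp: supp_group_def)

lemma sum_nonzero_term:
  "(\<Sum>k<(d::nat). g k) \<noteq> (0::complex) \<Longrightarrow> \<exists>k<d. g k \<noteq> 0"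
  by (meson lessThan_iff sum.neutral)

lemma Sp_mult_nonzero:
  assumes "A \<in> carrier (Sp m)" "B \<in> carrier (Sp m)" "i < 2*m" "j < 2*m" "(A * B) $$ (i, j) \<noteq> 0"
  obtains k where "k < 2*m" "A $$ (i, k) \<noteq> 0" "B $$ (k, j) \<noteq> 0"
  using sum_nonzero_term[of "\<lambda>k. A $$ (i, k) * B $$ (k, j)" "2*m"] assms Sp_mult_entry[OF assms(1-4)]
  by auto

lemma supp_group_one: "1\<^sub>m (2*m) \<in> supp_group m f"
  by (auto simp: supp_group_def one_mat_Sp split: if_splits)

lemma supp_group_mult:
  assumes "A \<in> supp_group m f" "B \<in> supp_group m f"
  shows "A * B \<in> supp_group m f"
  unfolding supp_group_def
proof (intro CollectI conjI allI impI)
  fix a q assume aq: "a < 2*m" "q < 2*m" "(A * B) $$ (a, q) \<noteq> 0"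
  from Sp_mult_nonzero[OF supp_groupD(1)[OF assms(1)] supp_groupD(1)[OF assms(2)] aq]
  obtain k where "k < 2*m" "A $$ (a, k) \<noteq> 0" "B $$ (k, q) \<noteq> 0" .
  then show "f a \<le> f q" using supp_groupD(2)[OF assms(1)] supp_groupD(2)[OF assms(2)] aq
    by (meson order_trans)
qed (use assms in \<open>auto simp: supp_group_def mult_mat_Sp\<close>)

text \<open>\<open>sp_inv\<close> reflects the support in the antidiagonal, so the pattern is
  preserved as soon as the mirror reverses the preorder given by \<open>f\<close>.\<close>

lemma supp_group_inv:
  assumes "A \<in> supp_group m f"
    and flip: "\<And>a b. a < 2*m \<Longrightarrow> b < 2*m \<Longrightarrow> f a \<le> f b \<Longrightarrow> f (2*m - Suc b) \<le> f (2*m - Suc a)"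
  shows "sp_inv m A \<in> supp_group m f"
  unfolding supp_group_def
proof (intro CollectI conjI allI impI)
  fix a q assume aq: "a < 2*m" "q < 2*m" "sp_inv m A $$ (a, q) \<noteq> 0"
  then have "A $$ (2*m - Suc q, 2*m - Suc a) \<noteq> 0" by (simp add: sp_inv_index)
  then have "f (2*m - Suc q) \<le> f (2*m - Suc a)" using assms(1) aq by (simp add: supp_group_def)
  with flip[of "2*m - Suc q" "2*m - Suc a"] aq show "f a \<le> f q" by simp
qed (use assms in \<open>auto simp: supp_group_def sp_inv_closed\<close>)

lemma borel_subgroup_eq: "borel_subgroup m = supp_group m id"
proof -
  have "(\<forall>i<2*m. \<forall>j<i. A $$ (i, j) = 0) \<longleftrightarrow> (\<forall>a<2*m. \<forall>q<2*m. A $$ (a, q) \<noteq> 0 \<longrightarrow> a \<le> q)" for A :: "complex mat"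
    by (meson less_trans not_le)
  then show ?thesis
    unfolding borel_subgroup_def supp_group_def upper_triangular_def id_apply
    by (intro Collect_cong conj_cong refl) (simp add: Sp_dims)
qed

lemma torus_iff: "A \<in> torus m \<longleftrightarrow> A \<in> carrier (Sp m) \<and> (\<forall>i<2*m. \<forall>j<2*m. i \<noteq> j \<longrightarrow> A $$ (i,j) = 0)"
  unfolding torus_def diagonal_mat_def by (auto dest: Sp_dims)

lemma torus_subset_borel: "torus m \<subseteq> borel_subgroup m"
proof
  fix A assume "A \<in> torus m"
  then have "A \<in> carrier (Sp m)" "\<And>i j. i < 2*m \<Longrightarrow> j < 2*m \<Longrightarrow> i \<noteq> j \<Longrightarrow> A $$ (i,j) = 0"
    by (auto simp: torus_iff)
  then show "A \<in> borel_subgroup m"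
    unfolding borel_subgroup_eq supp_group_def by (auto intro: eq_refl)
qed

definition blk_group :: "nat \<Rightarrow> complex mat set" where
  "blk_group m = supp_group m (\<lambda>q. q div 2)"

lemma borel_subset_blk: "borel_subgroup m \<subseteq> blk_group m"
  unfolding borel_subgroup_eq blk_group_def supp_group_def by (auto intro: div_le_mono)

lemma borel_mult: "A \<in> borel_subgroup m \<Longrightarrow> B \<in> borel_subgroup m \<Longrightarrow> A * B \<in> borel_subgroup m"
  by (simp add: borel_subgroup_eq supp_group_mult)

lemma borel_inv: "A \<in> borel_subgroup m \<Longrightarrow> sp_inv m A \<in> borel_subgroup m"
  unfolding borel_subgroup_eq by (rule supp_group_inv) auto

lemma borel_one: "1\<^sub>m (2*m) \<in> borel_subgroup m"
  by (simp add: borel_subgroup_eq supp_group_one)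

lemma blk_mult: "A \<in> blk_group m \<Longrightarrow> B \<in> blk_group m \<Longrightarrow> A * B \<in> blk_group m"
  by (simp add: blk_group_def supp_group_mult)

lemma div2_flip: "a < 2 * m \<Longrightarrow> (2 * m - Suc a) div 2 = m - Suc (a div 2)"
  by presburger

lemma blk_inv: "A \<in> blk_group m \<Longrightarrow> sp_inv m A \<in> blk_group m"
  unfolding blk_group_def
proof (rule supp_group_inv)
  fix a b assume "a < 2*m" "b < 2*m" "a div 2 \<le> b div 2"
  then show "(2*m - Suc b) div 2 \<le> (2*m - Suc a) div 2" by (simp add: div2_flip)
qed auto

lemma blk_one: "1\<^sub>m (2*m) \<in> blk_group m"
  by (simp add: blk_group_def supp_group_one)

lemma blk_Sp: "A \<in> blk_group m \<Longrightarrow> A \<in> carrier (Sp m)"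
  by (simp add: blk_group_def supp_group_def)

lemma borel_Sp: "A \<in> borel_subgroup m \<Longrightarrow> A \<in> carrier (Sp m)"
  by (simp add: borel_subgroup_def)


subsection \<open>Monomial matrices and the Weyl group\<close>

text \<open>The form requires the entries of row \<open>a\<close> and of its mirror row to have
  product \<open>sgn_half m a * sgn_half m (\<pi> a)\<close>; the upper half gets entries 1 and the
  lower half absorbs the sign.\<close>

definition mono_mat :: "nat \<Rightarrow> (nat \<Rightarrow> nat) \<Rightarrow> complex mat" where
  "mono_mat m \<pi> = mat (2*m) (2*m)
     (\<lambda>(a, b). if b = \<pi> a then (if a < m then 1 else sgn_half m a * sgn_half m (\<pi> a)) else 0)"

lemma mono_mat_nonzero:
  "a < 2*m \<Longrightarrow> b < 2*m \<Longrightarrow> mono_mat m \<pi> $$ (a, b) \<noteq> 0 \<longleftrightarrow> b = \<pi> a"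
  by (auto simp: mono_mat_def)

lemma mono_mat_Sp:
  assumes \<pi>: "\<And>a. a < 2*m \<Longrightarrow> \<pi> a < 2*m" "inj_on \<pi> {..<2*m}"
    and flip: "\<And>a. a < 2*m \<Longrightarrow> \<pi> (2*m - Suc a) = 2*m - Suc (\<pi> a)"
  shows "mono_mat m \<pi> \<in> carrier (Sp m)"
proof -
  let ?M = "mono_mat m \<pi>"
  have c: "?M \<in> carrier_mat (2*m) (2*m)" by (simp add: mono_mat_def)
  have "\<pi> ` {..<2*m} = {..<2*m}"
    using \<pi> by (intro endo_inj_surj) auto
  have "(sp_inv m ?M * ?M) $$ (p, q) = 1\<^sub>m (2*m) $$ (p, q)" if pq: "p < 2*m" "q < 2*m" for p q
  proof -
    obtain a0 where a0: "a0 < 2*m" "\<pi> a0 = p"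
      using \<open>\<pi> ` {..<2*m} = {..<2*m}\<close> pq by (metis imageE lessThan_iff)
    have "(sp_inv m ?M * ?M) $$ (p, q) = (\<Sum>a<2*m. sp_inv m ?M $$ (p, a) * ?M $$ (a, q))"
      using pq c by (intro mat_mult_entry) auto
    also have "\<dots> = (\<Sum>a<2*m. if a = a0 then (if p = q then 1 else 0) else 0)"
    proof (rule sum.cong[OF refl])
      fix a assume "a \<in> {..<2*m}"
      then have a: "a < 2*m" by simp
      have e: "sp_inv m ?M $$ (p, a) = sgn_half m p * sgn_half m a * ?M $$ (2*m - Suc a, 2*m - Suc p)"
        using a pq by (simp add: sp_inv_index)
      show "sp_inv m ?M $$ (p, a) * ?M $$ (a, q) = (if a = a0 then (if p = q then 1 else 0) else 0)"
      proof (cases "a = a0")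
        case True
        show ?thesis
          unfolding e using True a0 a pq flip[OF a]
          by (auto simp: mono_mat_def sgn_half_def)
      next
        case False
        then have "\<pi> a \<noteq> p" using a0 a \<pi>(2) by (auto dest: inj_onD)
        then have "2*m - Suc p \<noteq> \<pi> (2*m - Suc a)" using flip[OF a] pq \<pi>(1)[OF a] by auto
        then show ?thesis unfolding e using False a pq by (simp add: mono_mat_def)
      qed
    qed
    also have "\<dots> = 1\<^sub>m (2*m) $$ (p, q)" using a0(1) pq by simp
    finally show ?thesis .
  qed
  then have "sp_inv m ?M * ?M = 1\<^sub>m (2*m)"
    using c by (intro eq_matI) (auto simp: sp_inv_def)
  with c show ?thesis by (simp add: carrier_Sp)
qed

text \<open>Compatibility with the mirror is what makes a permutation liftable to the symplectic
  group. Being an involution puts a lift and its inverse over the same permutation.\<close>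

definition flip_invol :: "nat \<Rightarrow> (nat \<Rightarrow> nat) \<Rightarrow> bool" where
  "flip_invol m \<sigma> \<longleftrightarrow> (\<forall>b\<in>{1..2*m}. \<sigma> b \<in> {1..2*m} \<and> \<sigma> (\<sigma> b) = b \<and> \<sigma> (2*m + 1 - b) = 2*m + 1 - \<sigma> b)"

lemma flip_involD:
  assumes "flip_invol m \<sigma>" "b \<in> {1..2*m}"
  shows "\<sigma> b \<in> {1..2*m}" "\<sigma> (\<sigma> b) = b" "\<sigma> (2*m + 1 - b) = 2*m + 1 - \<sigma> b"
  using bspec[OF assms(1)[unfolded flip_invol_def] assms(2)] by simp_all

lemma perm_cosetI:
  assumes "A \<in> carrier (Sp m)"
    and "\<And>a b. a < 2*m \<Longrightarrow> b < 2*m \<Longrightarrow> A $$ (a, b) \<noteq> 0 \<longleftrightarrow> Suc a = \<sigma> (Suc b)"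
  shows "A \<in> perm_coset m \<sigma>"
  unfolding perm_coset_def
proof (intro CollectI conjI ballI)
  fix a b assume "a \<in> {1..2*m}" "b \<in> {1..2*m}"
  then show "A $$ (a - 1, b - 1) \<noteq> 0 \<longleftrightarrow> a = \<sigma> b"
    using assms(2)[of "a - 1" "b - 1"] by (cases a; cases b) auto
qed fact

lemma perm_cosetD:
  assumes "A \<in> perm_coset m \<sigma>"
  shows "A \<in> carrier (Sp m)"
    "a < 2*m \<Longrightarrow> b < 2*m \<Longrightarrow> A $$ (a, b) \<noteq> 0 \<longleftrightarrow> Suc a = \<sigma> (Suc b)"
proof -
  show "A \<in> carrier (Sp m)" using assms by (simp add: perm_coset_def)
  assume "a < 2*m" "b < 2*m"
  then have s: "Suc a \<in> {1..2*m}" "Suc b \<in> {1..2*m}" by auto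
  have "\<forall>a\<in>{1..2*m}. \<forall>b\<in>{1..2*m}. A $$ (a - 1, b - 1) \<noteq> 0 \<longleftrightarrow> a = \<sigma> b"
    using assms by (simp add: perm_coset_def)
  from bspec[OF bspec[OF this s(1)] s(2)]
  show "A $$ (a, b) \<noteq> 0 \<longleftrightarrow> Suc a = \<sigma> (Suc b)" by simp
qed

lemma perm_coset_cong:
  assumes "\<And>b. b \<in> {1..2*m} \<Longrightarrow> \<sigma> b = \<tau> b"
  shows "perm_coset m \<sigma> = perm_coset m \<tau>"
  unfolding perm_coset_def using assms by (intro Collect_cong conj_cong refl ball_cong) simp_all

text \<open>A set of matrices with prescribed support might be empty; a monomial matrix is the
  witness. \<open>mono_mat\<close> reads from row to column and \<open>perm_coset\<close> from
  column to row, which agrees for an involution.\<close>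

lemma perm_coset_nonempty:
  assumes "flip_invol m \<sigma>"
  obtains A where "A \<in> perm_coset m \<sigma>"
proof -
  let ?p = "\<lambda>a. \<sigma> (Suc a) - 1"
  have \<sigma>: "\<sigma> b \<in> {1..2*m}" "\<sigma> (\<sigma> b) = b" "\<sigma> (2*m + 1 - b) = 2*m + 1 - \<sigma> b"
    if "b \<in> {1..2*m}" for b
    using flip_involD[OF assms that] .
  have "mono_mat m ?p \<in> carrier (Sp m)"
  proof (rule mono_mat_Sp)
    fix a assume a: "a < 2*m"
    show "?p a < 2*m" using \<sigma>(1)[of "Suc a"] a by auto
    have "Suc (2*m - Suc a) = 2*m + 1 - Suc a" using a by simp
    then have "\<sigma> (Suc (2*m - Suc a)) = 2*m + 1 - \<sigma> (Suc a)"
      using \<sigma>(3)[of "Suc a"] a by (simp only:) simp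
    then show "?p (2*m - Suc a) = 2*m - Suc (?p a)" using \<sigma>(1)[of "Suc a"] a by auto
  next
    show "inj_on ?p {..<2*m}"
    proof (rule inj_onI)
      fix x y assume xy: "x \<in> {..<2*m}" "y \<in> {..<2*m}" "?p x = ?p y"
      then have "\<sigma> (Suc x) = \<sigma> (Suc y)" using \<sigma>(1)[of "Suc x"] \<sigma>(1)[of "Suc y"] by auto
      then have "\<sigma> (\<sigma> (Suc x)) = \<sigma> (\<sigma> (Suc y))" by simp
      then show "x = y" using \<sigma>(2)[of "Suc x"] \<sigma>(2)[of "Suc y"] xy by auto
    qed
  qed
  then have "mono_mat m ?p \<in> perm_coset m \<sigma>"
  proof (rule perm_cosetI)
    fix a b assume ab: "a < 2*m" "b < 2*m"
    have "b = ?p a \<longleftrightarrow> Suc a = \<sigma> (Suc b)"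
    proof
      assume "b = ?p a"
      then have "Suc b = \<sigma> (Suc a)" using \<sigma>(1)[of "Suc a"] ab by auto
      then show "Suc a = \<sigma> (Suc b)" using \<sigma>(2)[of "Suc a"] ab by simp
    next
      assume "Suc a = \<sigma> (Suc b)"
      then show "b = ?p a" using \<sigma>(2)[of "Suc b"] ab by simp
    qed
    then show "mono_mat m ?p $$ (a, b) \<noteq> 0 \<longleftrightarrow> Suc a = \<sigma> (Suc b)"
      using ab by (simp add: mono_mat_nonzero)
  qed
  then show ?thesis ..
qed

lemma perm_coset_mult:
  assumes A: "A \<in> perm_coset m \<sigma>" and B: "B \<in> perm_coset m \<tau>"
    and \<tau>: "\<And>b. b \<in> {1..2*m} \<Longrightarrow> \<tau> b \<in> {1..2*m}"
  shows "A * B \<in> perm_coset m (\<sigma> \<circ> \<tau>)"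
proof (rule perm_cosetI)
  note AB = perm_cosetD(1)[OF A] perm_cosetD(1)[OF B]
  show "A * B \<in> carrier (Sp m)" using AB by (rule mult_mat_Sp)
  fix a b assume ab: "a < 2*m" "b < 2*m"
  define k0 where "k0 = \<tau> (Suc b) - 1"
  have k0: "k0 < 2*m" "Suc k0 = \<tau> (Suc b)" using \<tau>[of "Suc b"] ab by (auto simp: k0_def)
  have "(A * B) $$ (a, b) = (\<Sum>k<2*m. A $$ (a, k) * B $$ (k, b))"
    using AB ab by (rule Sp_mult_entry)
  also have "\<dots> = (\<Sum>k<2*m. if k = k0 then A $$ (a, k) * B $$ (k, b) else 0)"
  proof (rule sum.cong[OF refl])
    fix k assume "k \<in> {..<2*m}"
    then show "A $$ (a, k) * B $$ (k, b) = (if k = k0 then A $$ (a, k) * B $$ (k, b) else 0)"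
      using perm_cosetD(2)[OF B, of k b] ab k0 by auto
  qed
  also have "\<dots> = A $$ (a, k0) * B $$ (k0, b)" using k0 by simp
  finally show "(A * B) $$ (a, b) \<noteq> 0 \<longleftrightarrow> Suc a = (\<sigma> \<circ> \<tau>) (Suc b)"
    using perm_cosetD(2)[OF B, of k0 b] perm_cosetD(2)[OF A, of a k0] ab k0 by simp
qed

lemma perm_coset_inv:
  assumes A: "A \<in> perm_coset m \<sigma>" and \<sigma>: "flip_invol m \<sigma>"
  shows "sp_inv m A \<in> perm_coset m \<sigma>"
proof (rule perm_cosetI)
  show "sp_inv m A \<in> carrier (Sp m)" using perm_cosetD(1)[OF A] by (rule sp_inv_closed)
  fix a b assume ab: "a < 2*m" "b < 2*m"
  have *: "\<sigma> (Suc a) \<in> {1..2*m}" "\<sigma> (\<sigma> (Suc a)) = Suc a" "\<sigma> (2*m + 1 - Suc a) = 2*m + 1 - \<sigma> (Suc a)"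
    "\<sigma> (\<sigma> (Suc b)) = Suc b"
    using bspec[OF \<sigma>[unfolded flip_invol_def], of "Suc a"]
      bspec[OF \<sigma>[unfolded flip_invol_def], of "Suc b"] ab by auto
  have "sp_inv m A $$ (a, b) \<noteq> 0 \<longleftrightarrow> A $$ (2*m - Suc b, 2*m - Suc a) \<noteq> 0"
    using ab by (simp add: sp_inv_index)
  also have "\<dots> \<longleftrightarrow> 2*m + 1 - Suc b = \<sigma> (2*m + 1 - Suc a)"
    using ab perm_cosetD(2)[OF A, of "2*m - Suc b" "2*m - Suc a"] by (simp add: Suc_diff_Suc)
  also have "\<dots> \<longleftrightarrow> Suc b = \<sigma> (Suc a)"
    using * ab by auto
  also have "\<dots> \<longleftrightarrow> Suc a = \<sigma> (Suc b)" using * by metis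
  finally show "sp_inv m A $$ (a, b) \<noteq> 0 \<longleftrightarrow> Suc a = \<sigma> (Suc b)" .
qed

text \<open>Invertibility makes the diagonal entries nonzero. Thus the unit of the Weyl group is a
  \<open>perm_coset\<close> too and obeys the same multiplication rules.\<close>

lemma torus_eq_perm_coset: "torus m = perm_coset m id"
proof (intro equalityI subsetI)
  fix A assume A: "A \<in> torus m"
  then have AS: "A \<in> carrier (Sp m)" by (simp add: torus_iff)
  show "A \<in> perm_coset m id"
  proof (rule perm_cosetI[OF AS])
    fix a b assume ab: "a < 2*m" "b < 2*m"
    have "A $$ (a, a) \<noteq> 0"
    proof -
      have "(A * sp_inv m A) $$ (a, a) \<noteq> 0" using AS ab by (simp add: sp_inv_right)
      then obtain k where "k < 2*m" "A $$ (a, k) \<noteq> 0"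
        using Sp_mult_nonzero[OF AS sp_inv_closed[OF AS] ab(1) ab(1)] by metis
      then show ?thesis using A ab by (metis torus_iff)
    qed
    then show "A $$ (a, b) \<noteq> 0 \<longleftrightarrow> Suc a = id (Suc b)" using A ab by (auto simp: torus_iff)
  qed
next
  fix A assume A: "A \<in> perm_coset m id"
  show "A \<in> torus m"
    unfolding torus_iff using perm_cosetD[OF A] by (metis id_apply old.nat.inject)
qed

lemma l_coset_Sp: "A <#\<^bsub>Sp m\<^esub> H = (\<lambda>h. A * h) ` H"
  by (auto simp: l_coset_def)

lemma weyl_mult: "H \<otimes>\<^bsub>weyl_group m\<^esub> K = {h * k | h k. h \<in> H \<and> k \<in> K}"
  by (auto simp: weyl_group_def set_mult_def)

lemma weyl_one: "\<one>\<^bsub>weyl_group m\<^esub> = torus m"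
  by (simp add: weyl_group_def)

lemma torus_subgroup: "subgroup (torus m) (Sp m)"
proof (rule group.subgroupI[OF group_Sp])
  have id: "flip_invol m id" by (simp add: flip_invol_def)
  show "torus m \<subseteq> carrier (Sp m)" by (auto simp: torus_iff)
  show "torus m \<noteq> {}" using perm_coset_nonempty[OF id] by (auto simp: torus_eq_perm_coset)
  fix A assume A: "A \<in> torus m"
  then show "inv\<^bsub>Sp m\<^esub> A \<in> torus m"
    using perm_coset_inv[of A m id] id by (simp add: torus_eq_perm_coset m_inv_Sp perm_cosetD(1))
  fix B assume "B \<in> torus m"
  with A show "A \<otimes>\<^bsub>Sp m\<^esub> B \<in> torus m"
    using perm_coset_mult[of A m id B id] by (simp add: torus_eq_perm_coset)
qed

lemma group_weyl: "group (weyl_group m)"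
  unfolding weyl_group_def
  by (rule normal.factorgroup_is_group, rule group.subgroup_in_normalizer[OF group_Sp torus_subgroup])

text \<open>For the harder inclusion a matrix of the product coset is divided by one representative
  of the left factor; as \<open>\<sigma>\<close> is an involution, the quotient lies over
  \<open>\<tau>\<close>. The right factor may be any self-map of the index range, since permutations
  of longer words need not be involutions.\<close>

lemma perm_coset_set_mult:
  assumes \<sigma>: "flip_invol m \<sigma>" and \<tau>: "\<And>b. b \<in> {1..2*m} \<Longrightarrow> \<tau> b \<in> {1..2*m}"
  shows "perm_coset m \<sigma> \<otimes>\<^bsub>weyl_group m\<^esub> perm_coset m \<tau> = perm_coset m (\<sigma> \<circ> \<tau>)"
proof (intro equalityI subsetI)
  fix A assume "A \<in> perm_coset m \<sigma> \<otimes>\<^bsub>weyl_group m\<^esub> perm_coset m \<tau>"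
  then show "A \<in> perm_coset m (\<sigma> \<circ> \<tau>)"
    using perm_coset_mult[OF _ _ \<tau>] by (auto simp: weyl_mult)
next
  fix A assume A: "A \<in> perm_coset m (\<sigma> \<circ> \<tau>)"
  obtain N where N: "N \<in> perm_coset m \<sigma>" using perm_coset_nonempty[OF \<sigma>] .
  have "sp_inv m N * A \<in> perm_coset m (\<sigma> \<circ> (\<sigma> \<circ> \<tau>))"
    using perm_coset_inv[OF N \<sigma>] A
    by (rule perm_coset_mult) (use flip_involD(1)[OF \<sigma> \<tau>] in \<open>simp del: atLeastAtMost_iff\<close>)
  also have "perm_coset m (\<sigma> \<circ> (\<sigma> \<circ> \<tau>)) = perm_coset m \<tau>"
    by (intro perm_coset_cong) (simp add: flip_involD(2)[OF \<sigma> \<tau>])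
  finally have "sp_inv m N * A \<in> perm_coset m \<tau>" .
  moreover have "A = N * (sp_inv m N * A)"
    using Sp_cancel(2) perm_cosetD(1)[OF N] perm_cosetD(1)[OF A] by simp
  ultimately show "A \<in> perm_coset m \<sigma> \<otimes>\<^bsub>weyl_group m\<^esub> perm_coset m \<tau>"
    using N unfolding weyl_mult
    by (intro CollectI exI[of _ N] exI[of _ "sp_inv m N * A"] conjI)
qed

lemma perm_coset_sq:
  assumes "flip_invol m \<sigma>"
  shows "perm_coset m \<sigma> \<otimes>\<^bsub>weyl_group m\<^esub> perm_coset m \<sigma> = \<one>\<^bsub>weyl_group m\<^esub>"
proof -
  have "perm_coset m \<sigma> \<otimes>\<^bsub>weyl_group m\<^esub> perm_coset m \<sigma> = perm_coset m (\<sigma> \<circ> \<sigma>)"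
    by (rule perm_coset_set_mult[OF assms flip_involD(1)[OF assms]])
  also have "\<dots> = perm_coset m id"
    by (intro perm_coset_cong) (simp add: flip_involD(2)[OF assms])
  finally show ?thesis by (simp add: weyl_one torus_eq_perm_coset)
qed

lemma perm_coset_normalizer:
  assumes \<sigma>: "flip_invol m \<sigma>" and N: "N \<in> perm_coset m \<sigma>"
  shows "N \<in> normalizer (Sp m) (torus m)"
proof -
  \<comment> \<open>Stated for every \<open>M\<close> over \<open>\<sigma>\<close>, so that it
    applies to \<open>N\<close> and to its inverse and yields both inclusions.\<close>
  have conj: "M * t * sp_inv m M \<in> torus m" if "M \<in> perm_coset m \<sigma>" "t \<in> torus m" for M t
  proof -
    have "M * t \<in> perm_coset m (\<sigma> \<circ> id)"
      using that by (intro perm_coset_mult) (auto simp: torus_eq_perm_coset)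
    then have "M * t * sp_inv m M \<in> perm_coset m (\<sigma> \<circ> id \<circ> \<sigma>)"
      using perm_coset_inv[OF that(1) \<sigma>] by (rule perm_coset_mult) (rule flip_involD(1)[OF \<sigma>])
    also have "perm_coset m (\<sigma> \<circ> id \<circ> \<sigma>) = perm_coset m id"
      by (intro perm_coset_cong) (simp add: flip_involD(2)[OF \<sigma>])
    finally show ?thesis by (simp add: torus_eq_perm_coset)
  qed
  have NS: "N \<in> carrier (Sp m)" using N by (rule perm_cosetD)
  have TS: "torus m \<subseteq> carrier (Sp m)" by (auto simp: torus_iff)
  have "N <#\<^bsub>Sp m\<^esub> torus m #>\<^bsub>Sp m\<^esub> inv\<^bsub>Sp m\<^esub> N = torus m"
  proof (intro equalityI subsetI)
    fix A assume "A \<in> N <#\<^bsub>Sp m\<^esub> torus m #>\<^bsub>Sp m\<^esub> inv\<^bsub>Sp m\<^esub> N"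
    then show "A \<in> torus m" using conj[OF N] NS by (auto simp: r_coset_def l_coset_def m_inv_Sp)
  next
    fix t assume t: "t \<in> torus m"
    let ?u = "sp_inv m N * t * N"
    have "?u \<in> torus m"
      using conj[OF perm_coset_inv[OF N \<sigma>] t] NS by (simp add: sp_inv_sp_inv Sp_dims)
    moreover have "t = N * ?u * sp_inv m N"
    proof -
      have tS: "t \<in> carrier (Sp m)" using t TS by blast
      have "N * ?u = N * (sp_inv m N * (t * N))"
        by (simp only: Sp_assoc[OF sp_inv_closed[OF NS] tS NS])
      also have "\<dots> = t * N" by (rule Sp_cancel(2)[OF NS mult_mat_Sp[OF tS NS]])
      finally show ?thesis by (simp only: Sp_cancel(3)[OF NS tS])
    qed
    ultimately show "t \<in> N <#\<^bsub>Sp m\<^esub> torus m #>\<^bsub>Sp m\<^esub> inv\<^bsub>Sp m\<^esub> N"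
      unfolding r_coset_def l_coset_Sp m_inv_Sp[OF NS] by auto
  qed
  then show ?thesis using NS TS by (simp add: normalizer_def stabilizer_def)
qed

text \<open>Membership in the carrier allows inverses in the Weyl group to be computed, as the
  inverse clause of \<open>generate\<close> demands.\<close>

lemma perm_coset_weyl:
  assumes \<sigma>: "flip_invol m \<sigma>"
  shows "perm_coset m \<sigma> \<in> carrier (weyl_group m)"
proof -
  obtain N where N: "N \<in> perm_coset m \<sigma>" using perm_coset_nonempty[OF \<sigma>] .
  have NS: "N \<in> carrier (Sp m)" using N by (rule perm_cosetD)
  have "perm_coset m \<sigma> = torus m #>\<^bsub>Sp m\<^esub> N"
  proof (intro equalityI subsetI)
    fix A assume A: "A \<in> perm_coset m \<sigma>"
    have "A * sp_inv m N \<in> perm_coset m (\<sigma> \<circ> \<sigma>)"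
      using A perm_coset_inv[OF N \<sigma>] by (rule perm_coset_mult) (rule flip_involD(1)[OF \<sigma>])
    also have "perm_coset m (\<sigma> \<circ> \<sigma>) = torus m"
      unfolding torus_eq_perm_coset by (intro perm_coset_cong) (simp add: flip_involD(2)[OF \<sigma>])
    finally have "A * sp_inv m N \<in> torus m" .
    moreover have "A = A * sp_inv m N * N" using NS perm_cosetD(1)[OF A] by (simp add: Sp_cancel)
    ultimately show "A \<in> torus m #>\<^bsub>Sp m\<^esub> N" by (auto simp: r_coset_def)
  next
    fix A assume "A \<in> torus m #>\<^bsub>Sp m\<^esub> N"
    then obtain t where "t \<in> perm_coset m id" "A = t * N"
      by (auto simp: r_coset_def torus_eq_perm_coset)
    then show "A \<in> perm_coset m \<sigma>"
      using perm_coset_mult[OF _ N, of t id] flip_involD(1)[OF \<sigma>] by auto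
  qed
  moreover have "torus m #>\<^bsub>Sp m\<lparr>carrier := normalizer (Sp m) (torus m)\<rparr>\<^esub> N = torus m #>\<^bsub>Sp m\<^esub> N"
    by (simp add: r_coset_def)
  ultimately show ?thesis
    unfolding weyl_group_def carrier_FactGroup using perm_coset_normalizer[OF \<sigma> N]
    by (intro image_eqI[of _ _ N]) simp_all
qed

lemma flip_invol_simple_refl_perm:
  assumes "1 \<le> i" "i \<le> m"
  shows "flip_invol m (simple_refl_perm m i)"
proof (cases "i = m")
  case True
  show ?thesis unfolding flip_invol_def
  proof (intro ballI)
    fix b assume b: "b \<in> {1..2*m}"
    have ne: "2*m + 1 - b \<noteq> m" "2*m + 1 - b \<noteq> m + 1" if "b \<noteq> m" "b \<noteq> m + 1"
      using b that by auto
    consider "b = m" | "b = m + 1" | "b \<noteq> m" "b \<noteq> m + 1" "2*m + 1 - b \<noteq> m" "2*m + 1 - b \<noteq> m + 1"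
      using ne by blast
    then show "simple_refl_perm m i b \<in> {1..2*m} \<and>
        simple_refl_perm m i (simple_refl_perm m i b) = b \<and>
        simple_refl_perm m i (2*m + 1 - b) = 2*m + 1 - simple_refl_perm m i b"
      by cases (use True b assms in \<open>simp_all add: simple_refl_perm_def transpose_def\<close>)
  qed
next
  case False
  \<comment> \<open>The two transpositions of the reflection are now disjoint, and the mirror
    exchanges \<open>i\<close> with \<open>q + 1\<close> and \<open>i + 1\<close> with
    \<open>q\<close>.\<close>
  define q where "q = 2*m - i"
  have q: "q + i = 2*m" "i + 1 < q" "2*m - i = q" using assms False by (auto simp: q_def)
  have e: "simple_refl_perm m i b = (if b = i then i + 1 else if b = i + 1 then i
      else if b = q then q + 1 else if b = q + 1 then q else b)" for b
    unfolding simple_refl_perm_def q(3) using q(2) False by (simp add: transpose_def)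
  show ?thesis unfolding flip_invol_def
  proof (intro ballI)
    fix b assume b: "b \<in> {1..2*m}"
    define b' where "b' = 2*m + 1 - b"
    have b': "b' + b = 2*m + 1" using b by (simp add: b'_def)
    consider "b = i" "b' = q + 1" | "b = i + 1" "b' = q" | "b = q" "b' = i + 1" | "b = q + 1" "b' = i"
      | "b \<notin> {i, i + 1, q, q + 1}" "b' \<notin> {i, i + 1, q, q + 1}"
    proof -
      have "b' = q + 1 \<longleftrightarrow> b = i" "b' = q \<longleftrightarrow> b = i + 1" "b' = i + 1 \<longleftrightarrow> b = q" "b' = i \<longleftrightarrow> b = q + 1"
        using b' q by linarith+
      then show thesis using that by blast
    qed
    then have "simple_refl_perm m i b \<in> {1..2*m} \<and>
        simple_refl_perm m i (simple_refl_perm m i b) = b \<and>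
        simple_refl_perm m i b' + simple_refl_perm m i b = 2*m + 1"
      unfolding e
      by cases (use b b' q assms in simp_all)
    then show "simple_refl_perm m i b \<in> {1..2*m} \<and>
        simple_refl_perm m i (simple_refl_perm m i b) = b \<and>
        simple_refl_perm m i (2*m + 1 - b) = 2*m + 1 - simple_refl_perm m i b"
      unfolding b'_def by linarith
  qed
qed

lemma simple_refl_weyl:
  assumes "1 \<le> i" "i \<le> m"
  shows "simple_refl m i \<in> carrier (weyl_group m)"
    "inv\<^bsub>weyl_group m\<^esub> simple_refl m i = simple_refl m i"
proof -
  note s = flip_invol_simple_refl_perm[OF assms]
  show c: "simple_refl m i \<in> carrier (weyl_group m)"
    unfolding simple_refl_def by (rule perm_coset_weyl[OF s])
  show "inv\<^bsub>weyl_group m\<^esub> simple_refl m i = simple_refl m i"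
    using c perm_coset_sq[OF s] by (intro group.inv_equality[OF group_weyl]) (simp_all add: simple_refl_def)
qed


subsection \<open>The parabolic subgroup is block upper triangular\<close>

text \<open>The second transposition begins at \<open>2*(2*n) - (2*k+1) = 2*(2*n-1-k) + 1\<close>,
  the first position of the mirror block. The condition \<open>k < n\<close> keeps the two blocks
  distinct.\<close>

lemma simple_refl_perm_odd:
  assumes "k < n" "b \<in> {1..4*n}"
  shows "simple_refl_perm (2*n) (2*k+1) b =
    (if (b - 1) div 2 \<in> {k, 2*n - 1 - k} then (if odd b then b + 1 else b - 1) else b)"
proof -
  have e: "2*(2*n) - (2*k+1) = 2*(2*n-1-k) + 1" using assms by simp
  have b: "b = 2 * ((b - 1) div 2) + (if odd b then 1 else 2)"
    using assms(2) by (cases b) (auto elim!: oddE evenE)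
  have ne: "2*k+1 \<noteq> 2*n" "2*k+1 \<noteq> 2*(2*n-1-k)+1" "2*k+1+1 \<noteq> 2*(2*n-1-k)+1+1"
    "2*k+1+1 \<noteq> 2*(2*n-1-k)+1" "2*k+1 \<noteq> 2*(2*n-1-k)+1+1" using assms by presburger+
  define c where "c = (b - 1) div 2"
  define l where "l = 2*n - 1 - k"
  have kl: "k \<noteq> l" using assms by (auto simp: l_def)
  consider "b = 2*c+1" "odd b" | "b = 2*c+2" "even b" using b unfolding c_def by (cases "odd b") auto
  then show ?thesis
    unfolding simple_refl_perm_def e c_def[symmetric] l_def[symmetric]
    using ne(1) kl by cases (auto simp: transpose_def)
qed

lemma simple_refl_blk:
  assumes "k < n"
  shows "simple_refl (2*n) (2*k+1) \<subseteq> blk_group (2*n)"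
proof
  fix A assume "A \<in> simple_refl (2*n) (2*k+1)"
  then have A: "A \<in> perm_coset (2*n) (simple_refl_perm (2*n) (2*k+1))" by (simp add: simple_refl_def)
  show "A \<in> blk_group (2*n)"
    unfolding blk_group_def supp_group_def
  proof (intro CollectI conjI allI impI)
    show "A \<in> carrier (Sp (2*n))" using A by (rule perm_cosetD)
    fix a q assume aq: "a < 2*(2*n)" "q < 2*(2*n)" "A $$ (a, q) \<noteq> 0"
    then have "Suc a = simple_refl_perm (2*n) (2*k+1) (Suc q)" using perm_cosetD(2)[OF A] by simp
    also have "\<dots> = (if q div 2 \<in> {k, 2*n - 1 - k} then (if even q then q + 2 else q) else Suc q)"
      using simple_refl_perm_odd[OF assms, of "Suc q"] aq by simp
    finally show "a div 2 \<le> q div 2" by (auto split: if_splits elim!: oddE evenE)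
  qed
qed

lemma odd_refl_cases:
  assumes "h \<in> simple_refl (2*n) ` {i \<in> {1..2*n}. odd i}"
  obtains k where "k < n" "h = simple_refl (2*n) (2*k+1)"
proof -
  obtain i where i: "i \<in> {1..2*n}" "odd i" "h = simple_refl (2*n) i" using assms by auto
  then have "i div 2 < n" "i = 2 * (i div 2) + 1" by (auto elim!: oddE)
  with i that[of "i div 2"] show ?thesis by simp
qed

text \<open>Block triangular matrices are closed under products and contain the Borel subgroup and
  the odd reflections. The inverse clause of \<open>generate\<close> adds nothing new because these
  reflections are their own inverses.\<close>

lemma parabolic_subset_blk: "parabolic n \<subseteq> blk_group (2*n)"
proof -
  have "w \<subseteq> blk_group (2*n)"
    if "w \<in> generate (weyl_group (2*n)) (simple_refl (2*n) ` {i \<in> {1..2*n}. odd i})" for w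
    using that
  proof induction
    case one
    then show ?case using torus_subset_borel borel_subset_blk by (auto simp: weyl_one)
  next
    case (incl h)
    then obtain k where "k < n" "h = simple_refl (2*n) (2*k+1)" by (rule odd_refl_cases)
    then show ?case using simple_refl_blk by simp
  next
    case (inv h)
    then obtain k where k: "k < n" "h = simple_refl (2*n) (2*k+1)" by (rule odd_refl_cases)
    then have "inv\<^bsub>weyl_group (2*n)\<^esub> h = h" using simple_refl_weyl(2)[of "2*k+1" "2*n"] by simp
    with k show ?case using simple_refl_blk by simp
  next
    case (eng h1 h2)
    then show ?case by (auto simp: weyl_mult intro!: blk_mult)
  qed
  then show ?thesis
    using borel_subset_blk by (auto simp: parabolic_def set_mult_def intro!: blk_mult)
qed

section \<open>Bruhat decomposition inside the diagonal blocks\<close>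

definition block_unip :: "nat \<Rightarrow> (nat \<Rightarrow> complex) \<Rightarrow> complex mat" where
  "block_unip m s = mat (2*m) (2*m)
     (\<lambda>(i, j). if i = j then 1 else if odd j \<and> Suc i = j then s (j div 2) else 0)"

lemma mult_block_unip:
  assumes "A \<in> carrier_mat (2*m) (2*m)" "i < 2*m" "j < 2*m"
  shows "(A * block_unip m s) $$ (i, j) = A $$ (i, j) + (if odd j then s (j div 2) * A $$ (i, j - 1) else 0)"
proof -
  have "(A * block_unip m s) $$ (i, j) = (\<Sum>k<2*m. A $$ (i, k) * block_unip m s $$ (k, j))"
    using assms by (intro mat_mult_entry) (auto simp: block_unip_def)
  also have "\<dots> = (\<Sum>k<2*m. (if k = j then A $$ (i, k) else 0)
      + (if k = j - 1 then (if odd j then s (j div 2) * A $$ (i, k) else 0) else 0))"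
    using assms by (intro sum.cong) (auto simp: block_unip_def elim: oddE)
  also have "\<dots> = A $$ (i, j) + (if odd j then s (j div 2) * A $$ (i, j - 1) else 0)"
    using assms by (auto simp: sum.distrib)
  finally show ?thesis .
qed

text \<open>Both indices of a block lie in the same half, so reflection in the antidiagonal moves
  the parameter of a block to its mirror block without a sign. The inverse has parameters
  \<open>- s k\<close>; hence the antisymmetry of \<open>s\<close>.\<close>

lemma block_unip_borel:
  assumes s: "\<And>k. k < 2*n \<Longrightarrow> s (2*n - Suc k) = - s k"
  shows "block_unip (2*n) s \<in> borel_subgroup (2*n)"
proof -
  let ?u = "block_unip (2*n) s"
  have c: "?u \<in> carrier_mat (2*(2*n)) (2*(2*n))" by (simp add: block_unip_def)
  have "sp_inv (2*n) ?u = block_unip (2*n) (\<lambda>k. - s k)"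
  proof (rule eq_matI)
    fix i j assume "i < dim_row (block_unip (2*n) (\<lambda>k. - s k))" "j < dim_col (block_unip (2*n) (\<lambda>k. - s k))"
    then have ij: "i < 4*n" "j < 4*n" by (auto simp: block_unip_def)
    have flip: "4*n - Suc j = 4*n - Suc i \<longleftrightarrow> i = j"
      "odd (4*n - Suc i) \<and> Suc (4*n - Suc j) = 4*n - Suc i \<longleftrightarrow> odd j \<and> Suc i = j"
      using ij by (auto, presburger+)
    have "(4*n - Suc i) div 2 = 2*n - Suc (i div 2)" using div2_flip[of i "2*n"] ij by simp
    moreover have "i div 2 = j div 2" if "odd j" "Suc i = j" using that by presburger
    ultimately have "s ((4*n - Suc i) div 2) = - s (j div 2)" if "odd j" "Suc i = j"
      using that s[of "i div 2"] ij by simp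
    moreover have "sgn_half (2*n) i = sgn_half (2*n) j" if "odd j" "Suc i = j"
      using that unfolding sgn_half_def by (auto, presburger)
    ultimately show "sp_inv (2*n) ?u $$ (i, j) = block_unip (2*n) (\<lambda>k. - s k) $$ (i, j)"
      using ij flip by (simp add: sp_inv_index block_unip_def)
  qed (auto simp: block_unip_def sp_inv_def)
  moreover have "block_unip (2*n) (\<lambda>k. - s k) * ?u = 1\<^sub>m (2*(2*n))"
  proof (rule eq_matI)
    fix i j assume "i < dim_row (1\<^sub>m (2*(2*n)) :: complex mat)" "j < dim_col (1\<^sub>m (2*(2*n)) :: complex mat)"
    then show "(block_unip (2*n) (\<lambda>k. - s k) * ?u) $$ (i, j) = 1\<^sub>m (2*(2*n)) $$ (i, j)"
      by (subst mult_block_unip) (auto simp: block_unip_def)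
  qed (auto simp: block_unip_def)
  ultimately have "?u \<in> carrier (Sp (2*n))" using c by (simp add: carrier_Sp)
  then show ?thesis
    by (auto simp: borel_subgroup_eq supp_group_def block_unip_def split: if_splits)
qed

text \<open>In a product of block triangular matrices a diagonal block sees only diagonal blocks, so
  this is the statement that an upper triangular 2 by 2 matrix has an upper triangular inverse. Read
  through the antidiagonal reflection, it moves the vanishing from a block to its mirror
  block.\<close>

lemma blk_diag_inv:
  assumes X: "X \<in> blk_group m" and l: "l < m" and z: "X $$ (2*l+1, 2*l) = 0"
  shows "sp_inv m X $$ (2*l+1, 2*l) = 0"
proof -
  have XS: "X \<in> carrier (Sp m)" "sp_inv m X \<in> carrier (Sp m)"
    using X by (auto intro: blk_Sp sp_inv_closed)
  have e: "(sp_inv m X * X) $$ (i, 2*l) = sp_inv m X $$ (i, 2*l) * X $$ (2*l, 2*l)"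
    if i: "i < 2*m" "i div 2 = l" for i
  proof -
    have "(sp_inv m X * X) $$ (i, 2*l) = (\<Sum>k<2*m. sp_inv m X $$ (i, k) * X $$ (k, 2*l))"
      using XS i l by (intro Sp_mult_entry) auto
    also have "\<dots> = (\<Sum>k<2*m. if k = 2*l then sp_inv m X $$ (i, k) * X $$ (k, 2*l) else 0)"
    proof (rule sum.cong[OF refl])
      fix k assume k: "k \<in> {..<2*m}"
      have "sp_inv m X $$ (i, k) \<noteq> 0 \<Longrightarrow> l \<le> k div 2"
        using blk_inv[OF X] k i by (auto simp: blk_group_def supp_group_def)
      moreover have "X $$ (k, 2*l) \<noteq> 0 \<Longrightarrow> k div 2 \<le> l"
        using supp_groupD(2)[OF X[unfolded blk_group_def], of k "2*l"] k l by simp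
      moreover have "k = 2*l \<or> k = 2*l+1" if "k div 2 = l" using that by presburger
      ultimately show "sp_inv m X $$ (i, k) * X $$ (k, 2*l)
          = (if k = 2*l then sp_inv m X $$ (i, k) * X $$ (k, 2*l) else 0)"
        using z by (cases "sp_inv m X $$ (i, k) = 0 \<or> X $$ (k, 2*l) = 0") auto
    qed
    also have "\<dots> = sp_inv m X $$ (i, 2*l) * X $$ (2*l, 2*l)" using l by simp
    finally show ?thesis .
  qed
  have "X $$ (2*l, 2*l) \<noteq> 0" using e[of "2*l"] l XS(1) by (auto simp: sp_inv_left)
  moreover have "sp_inv m X $$ (2*l+1, 2*l) * X $$ (2*l, 2*l) = 0"
    using e[of "2*l+1"] l XS(1) by (simp add: sp_inv_left)
  ultimately show ?thesis by simp
qed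

lemma blk_borelI:
  assumes X: "X \<in> blk_group (2*n)" and z: "\<And>l. l < n \<Longrightarrow> X $$ (2*l+1, 2*l) = 0"
  shows "X \<in> borel_subgroup (2*n)"
proof -
  have z': "X $$ (2*l+1, 2*l) = 0" if l: "l < 2*n" for l
  proof (cases "l < n")
    case False
    define k where "k = 2*n - Suc l"
    have k: "k < n" "2*(2*n) - Suc (2*k) = 2*l+1" "2*(2*n) - Suc (2*k+1) = 2*l" using False l by (auto simp: k_def)
    have "sp_inv (2*n) X $$ (2*k+1, 2*k) = 0" using blk_diag_inv[OF X _ z[OF k(1)]] k(1) by simp
    then show ?thesis using k sp_inv_index[of "2*k+1" "2*n" "2*k" X] by simp
  qed (use z in simp)
  show ?thesis
    unfolding borel_subgroup_eq supp_group_def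
  proof (intro CollectI conjI allI impI)
    show "X \<in> carrier (Sp (2*n))" using X by (rule blk_Sp)
    fix a q assume aq: "a < 2*(2*n)" "q < 2*(2*n)" "X $$ (a, q) \<noteq> 0"
    then have "a div 2 \<le> q div 2" using X by (simp add: blk_group_def supp_group_def)
    moreover have "\<not> (a = 2*(q div 2)+1 \<and> q = 2*(q div 2))"
      using z'[of "q div 2"] aq by (metis less_mult_imp_div_less mult.commute)
    ultimately show "id a \<le> id q" unfolding id_apply by presburger
  qed
qed

text \<open>For \<open>I \<subseteq> {..<n}\<close> this is the product of the odd reflections of
  the blocks in \<open>I\<close>; the second test covers the mirror blocks. Positions are counted
  from 1 and blocks from 0.\<close>

definition block_swap :: "nat \<Rightarrow> nat set \<Rightarrow> nat \<Rightarrow> nat" where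
  "block_swap n I b = (if (b - 1) div 2 \<in> I \<or> 2*n - 1 - (b - 1) div 2 \<in> I
     then (if odd b then b + 1 else b - 1) else b)"

lemma block_swap_div:
  assumes "b \<in> {1..4*n}"
  shows "(block_swap n I b - 1) div 2 = (b - 1) div 2" "block_swap n I b \<in> {1..4*n}"
    "block_swap n I (block_swap n I b) = b"
    "block_swap n I (4*n + 1 - b) = 4*n + 1 - block_swap n I b"
proof -
  define c where "c = (b - 1) div 2"
  have c: "c < 2*n" using assms by (auto simp: c_def)
  have b: "b = 2*c+1 \<or> b = 2*c+2" unfolding c_def using assms by auto
  define l where "l = 2*n - 1 - c"
  have l: "l < 2*n" "c + l + 1 = 2*n" using c by (auto simp: l_def)
  have sw: "block_swap n I (2*c+1) = (if c \<in> I \<or> l \<in> I then 2*c+2 else 2*c+1)"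
    "block_swap n I (2*c+2) = (if c \<in> I \<or> l \<in> I then 2*c+1 else 2*c+2)"
    by (simp_all add: block_swap_def l_def)
  have lc: "2*n - 1 - l = c" using l by simp
  have sw': "block_swap n I (2*l+1) = (if c \<in> I \<or> l \<in> I then 2*l+2 else 2*l+1)"
    "block_swap n I (2*l+2) = (if c \<in> I \<or> l \<in> I then 2*l+1 else 2*l+2)"
    using lc by (auto simp add: block_swap_def)
  show "(block_swap n I b - 1) div 2 = (b - 1) div 2" "block_swap n I b \<in> {1..4*n}"
    "block_swap n I (block_swap n I b) = b"
    using b sw c by auto
  have e: "4*n + 1 - (2*c+1) = 2*l+2" "4*n+1 - (2*c+2) = 2*l+1" "4*n + 1 - (2*l+1) = 2*c+2" "4*n+1 - (2*l+2) = 2*c+1"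
    using l by auto
  from b show "block_swap n I (4*n + 1 - b) = 4*n + 1 - block_swap n I b"
  proof (elim disjE)
    assume "b = 2*c+1"
    then show ?thesis
      by (cases "c \<in> I \<or> l \<in> I") (simp_all only: sw sw' e if_True if_False)
  next
    assume "b = 2*c+2"
    then show ?thesis
      by (cases "c \<in> I \<or> l \<in> I") (simp_all only: sw sw' e if_True if_False)
  qed
qed

lemma flip_invol_block_swap: "flip_invol (2*n) (block_swap n I)"
  unfolding flip_invol_def using block_swap_div[of _ n I] by simp

lemma block_swap_generate:
  assumes "I \<subseteq> {..<n}"
  shows "perm_coset (2*n) (block_swap n I)
    \<in> generate (weyl_group (2*n)) (simple_refl (2*n) ` {i \<in> {1..2*n}. odd i})"
proof -
  have "finite I" using assms finite_subset by blast
  then show ?thesis using assms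
  proof (induction I)
    case empty
    have "perm_coset (2*n) (block_swap n {}) = perm_coset (2*n) id"
      by (rule perm_coset_cong) (simp add: block_swap_def)
    then show ?case using generate.one[of "weyl_group (2*n)"] by (simp add: weyl_one torus_eq_perm_coset)
  next
    case (insert k I)
    then have k: "k < n" by simp
    let ?s = "simple_refl_perm (2*n) (2*k+1)"
    have "simple_refl (2*n) (2*k+1) \<otimes>\<^bsub>weyl_group (2*n)\<^esub> perm_coset (2*n) (block_swap n I)
        \<in> generate (weyl_group (2*n)) (simple_refl (2*n) ` {i \<in> {1..2*n}. odd i})"
      using insert k by (intro generate.eng[OF generate.incl]) auto
    also have "simple_refl (2*n) (2*k+1) \<otimes>\<^bsub>weyl_group (2*n)\<^esub> perm_coset (2*n) (block_swap n I)
        = perm_coset (2*n) (?s \<circ> block_swap n I)"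
      unfolding simple_refl_def
      using k flip_involD(1)[OF flip_invol_block_swap] by (intro perm_coset_set_mult flip_invol_simple_refl_perm) simp_all
    also have "\<dots> = perm_coset (2*n) (block_swap n (insert k I))"
    proof (rule perm_coset_cong)
      fix b assume "b \<in> {1..2*(2*n)}"
      then have b: "b \<in> {1..4*n}" by simp
      define c where "c = (b - 1) div 2"
      have c: "c < 2*n" using b by (auto simp: c_def)
      have k': "c = k \<longrightarrow> c \<notin> I \<and> 2*n - 1 - c \<notin> I" "2*n - 1 - c = k \<longrightarrow> c \<notin> I \<and> 2*n - 1 - c \<notin> I"
        using insert.hyps insert.prems k c by auto
      have ck: "c = 2*n - 1 - k \<longleftrightarrow> 2*n - 1 - c = k" using c k by auto
      have "?s (block_swap n I b) = (if c \<in> {k, 2*n - 1 - k} then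
          (if odd (block_swap n I b) then block_swap n I b + 1 else block_swap n I b - 1) else block_swap n I b)"
        using simple_refl_perm_odd[OF k block_swap_div(2)[OF b]] block_swap_div(1)[OF b]
        by (simp only: c_def)
      also have "\<dots> = block_swap n (insert k I) b"
        unfolding block_swap_def c_def[symmetric] using k' ck by auto
      finally show "(?s \<circ> block_swap n I) b = block_swap n (insert k I) b" by simp
    qed
    finally show ?case .
  qed
qed

text \<open>Every 2 by 2 block is either upper triangular or becomes so after a unipotent column
  operation and an exchange of its columns. Doing this simultaneously gives \<open>q * u * M\<close>
  in the Borel subgroup, and solving for \<open>q\<close> shows the double coset.\<close>

lemma blk_subset_parabolic: "blk_group (2*n) \<subseteq> parabolic n"
proof
  fix q assume q: "q \<in> blk_group (2*n)"
  have qS: "q \<in> carrier (Sp (2*n))" using q by (rule blk_Sp)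
  define I where "I = {k. k < n \<and> q $$ (2*k+1, 2*k) \<noteq> 0}"
  \<comment> \<open>For a block with lower row (c, d) and c nonzero, adding -d/c times the left
    column to the right one clears the lower right entry; the exchange of columns moves this zero to
    the lower left. Blocks with c = 0 stay as they are.\<close>
  define s0 where "s0 k = (if k \<in> I then - q $$ (2*k+1, 2*k+1) / q $$ (2*k+1, 2*k) else 0)" for k
  define s where "s k = (if k < n then s0 k else - s0 (2*n - Suc k))" for k
  define u where "u = block_unip (2*n) s"
  have u: "u \<in> borel_subgroup (2*n)"
    unfolding u_def by (rule block_unip_borel) (auto simp: s_def)
  then have uS: "u \<in> carrier (Sp (2*n))" by (rule borel_Sp)
  obtain M where M: "M \<in> perm_coset (2*n) (block_swap n I)"
    using perm_coset_nonempty[OF flip_invol_block_swap] .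
  have MS: "M \<in> carrier (Sp (2*n))" using M by (rule perm_cosetD)
  have Mb: "M \<in> blk_group (2*n)"
    unfolding blk_group_def supp_group_def
  proof (intro CollectI conjI allI impI)
    fix a b assume "a < 2*(2*n)" "b < 2*(2*n)" "M $$ (a, b) \<noteq> 0"
    then have "Suc a = block_swap n I (Suc b)" "Suc b \<in> {1..4*n}" using perm_cosetD(2)[OF M] by auto
    then show "a div 2 \<le> b div 2" using block_swap_div(1)[of "Suc b" n I] by (metis diff_Suc_1 order_refl)
  qed fact
  define X where "X = q * u * M"
  have quS: "q * u \<in> carrier (Sp (2*n))" using qS uS by (rule mult_mat_Sp)
  have "X \<in> blk_group (2*n)"
    unfolding X_def using q u Mb borel_subset_blk by (intro blk_mult) auto
  moreover have "X $$ (2*l+1, 2*l) = 0" if l: "l < n" for l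
  proof (rule ccontr)
    assume "X $$ (2*l+1, 2*l) \<noteq> 0"
    then obtain k where k: "k < 2*(2*n)" "(q * u) $$ (2*l+1, k) \<noteq> 0" "M $$ (k, 2*l) \<noteq> 0"
      using Sp_mult_nonzero[OF quS MS, of "2*l+1" "2*l"] l unfolding X_def by auto
    have "Suc k = block_swap n I (Suc (2*l))" using perm_cosetD(2)[OF M] k l by simp
    moreover have "2*n - 1 - l \<notin> I" using l by (auto simp: I_def)
    ultimately have k': "k = (if l \<in> I then 2*l+1 else 2*l)" by (auto simp: block_swap_def)
    have qu: "(q * u) $$ (2*l+1, k) = q $$ (2*l+1, k) + (if odd k then s (k div 2) * q $$ (2*l+1, k - 1) else 0)"
      unfolding u_def using k l qS by (intro mult_block_unip) (auto simp: Sp_dims)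
    show False
    proof (cases "l \<in> I")
      case True
      then have "q $$ (2*l+1, 2*l) \<noteq> 0" by (simp add: I_def)
      then show False using k(2) qu k' True l by (simp add: s_def s0_def)
    next
      case False
      then show False using k(2) qu k' l by (simp add: I_def)
    qed
  qed
  ultimately have X: "X \<in> borel_subgroup (2*n)" by (rule blk_borelI)
  have XS: "X \<in> carrier (Sp (2*n))" using X by (rule borel_Sp)
  have "q = X * sp_inv (2*n) M * sp_inv (2*n) u"
    unfolding X_def using qS uS MS quS by (simp add: Sp_cancel)
  moreover have "X * sp_inv (2*n) M * sp_inv (2*n) u \<in> borel_subgroup (2*n)
      <#>\<^bsub>Sp (2*n)\<^esub> perm_coset (2*n) (block_swap n I) <#>\<^bsub>Sp (2*n)\<^esub> borel_subgroup (2*n)"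
    unfolding set_mult_def using X perm_coset_inv[OF M flip_invol_block_swap] borel_inv[OF u] by auto
  moreover have "I \<subseteq> {..<n}" by (auto simp: I_def)
  ultimately show "q \<in> parabolic n"
    unfolding parabolic_def using block_swap_generate[of I n] by (metis (no_types, lifting) UN_I)
qed

lemma parabolic_eq: "parabolic n = blk_group (2*n)"
  using parabolic_subset_blk blk_subset_parabolic by (rule equalityI)


subsection \<open>The permutation of the word\<close>

definition word_perm :: "nat \<Rightarrow> nat list \<Rightarrow> nat \<Rightarrow> nat" where
  "word_perm m xs = foldr (\<lambda>i f. simple_refl_perm m i \<circ> f) xs id"

lemma word_perm_simps:
  "word_perm m [] = id" "word_perm m (i # xs) = simple_refl_perm m i \<circ> word_perm m xs"
  by (simp_all add: word_perm_def)

lemma word_perm_append: "word_perm m (xs @ ys) = word_perm m xs \<circ> word_perm m ys"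
  by (induction xs) (simp_all add: word_perm_simps o_assoc)

lemma word_perm_flip:
  assumes "set xs \<subseteq> {1..m}" "b \<in> {1..2*m}"
  shows "word_perm m xs b \<in> {1..2*m}"
    "word_perm m xs (2*m + 1 - b) = 2*m + 1 - word_perm m xs b"
  using assms(1)
proof (induction xs)
  case (Cons i xs)
  note s = flip_involD[OF flip_invol_simple_refl_perm[of i m]]
  { case 1
    then show ?case using Cons.IH(1) s(1)[of "word_perm m xs b"] by (simp add: word_perm_simps)
  next
    case 2
    then show ?case using Cons.IH s(3)[of "word_perm m xs b"] by (simp add: word_perm_simps) }
qed (use assms(2) in \<open>auto simp: word_perm_simps\<close>)

text \<open>An actual matrix over the word is needed later to exhibit a point of the Schubert cell,
  so nonemptiness is carried along in the induction.\<close>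

lemma word_coset:
  assumes "set xs \<subseteq> {1..m}"
  shows "foldr (\<lambda>i w. simple_refl m i \<otimes>\<^bsub>weyl_group m\<^esub> w) xs \<one>\<^bsub>weyl_group m\<^esub> = perm_coset m (word_perm m xs)"
    "perm_coset m (word_perm m xs) \<noteq> {}"
proof -
  have *: "foldr (\<lambda>i w. simple_refl m i \<otimes>\<^bsub>weyl_group m\<^esub> w) xs \<one>\<^bsub>weyl_group m\<^esub> = perm_coset m (word_perm m xs)
    \<and> perm_coset m (word_perm m xs) \<noteq> {}"
    using assms
  proof (induction xs)
    case Nil
    have "perm_coset m (word_perm m []) = torus m"
      by (simp only: word_perm_simps torus_eq_perm_coset)
    then show ?case using subgroup.one_closed[OF torus_subgroup[of m]] by (auto simp: weyl_one)
  next
    case (Cons i xs)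
    then have s: "flip_invol m (simple_refl_perm m i)" by (intro flip_invol_simple_refl_perm) auto
    have e: "simple_refl m i \<otimes>\<^bsub>weyl_group m\<^esub> perm_coset m (word_perm m xs) = perm_coset m (word_perm m (i # xs))"
      unfolding simple_refl_def word_perm_simps
      using Cons.prems by (intro perm_coset_set_mult[OF s] word_perm_flip(1)) simp_all
    obtain A where "A \<in> simple_refl m i" using perm_coset_nonempty[OF s] unfolding simple_refl_def .
    then have "simple_refl m i \<otimes>\<^bsub>weyl_group m\<^esub> perm_coset m (word_perm m xs) \<noteq> {}"
      using Cons unfolding weyl_mult by auto
    then show ?case using Cons e by simp
  qed
  from * show "foldr (\<lambda>i w. simple_refl m i \<otimes>\<^bsub>weyl_group m\<^esub> w) xs \<one>\<^bsub>weyl_group m\<^esub> = perm_coset m (word_perm m xs)"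
    "perm_coset m (word_perm m xs) \<noteq> {}" by blast+
qed

lemma simple_refl_perm_low:
  assumes "b \<le> m" "i < m"
  shows "simple_refl_perm m i b = (if b = i then i + 1 else if b = i + 1 then i else b)"
proof -
  have "b \<noteq> 2*m - i" "b \<noteq> 2*m - i + 1" "i < 2*m - i" "i + 1 < 2*m - i" using assms by auto
  then show ?thesis using assms by (auto simp: simple_refl_perm_def transpose_def)
qed

text \<open>The word acts from its right end: \<open>l\<close> is carried down to \<open>k\<close>
  and the values passed on the way move up. On \<open>b \<le> m\<close> only one transposition of
  each letter is visible.\<close>

lemma word_perm_upt:
  assumes "k \<le> l" "l \<le> m" "b \<le> m"
  shows "word_perm m [k..<l] b = (if b = l then k else if k \<le> b \<and> b < l then b + 1 else b)"
  using assms(1)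
proof (induction rule: inc_induct)
  case base
  then show ?case by (simp add: word_perm_simps)
next
  case (step k)
  have "word_perm m [k..<l] b = simple_refl_perm m k (word_perm m [Suc k..<l] b)"
    using step by (simp add: upt_conv_Cons word_perm_simps)
  also have "\<dots> = (if b = l then k else if k \<le> b \<and> b < l then b + 1 else b)"
    unfolding step.IH using step.hyps assms by (subst simple_refl_perm_low) auto
  finally show ?case .
qed

text \<open>Here the letter \<open>k\<close> acts before all others, so the induction peels it off
  at the right end and has to generalize over \<open>b\<close>. The value \<open>k\<close> climbs
  through all letters and leaves the lower half through the long reflection.\<close>

lemma word_perm_rev_upt:
  assumes "k \<le> m" "b \<le> m"
  shows "word_perm m (rev [k..<m + 1]) b = (if b = k then m + 1 else if k < b then b - 1 else b)"
  using assms
proof (induction arbitrary: b rule: inc_induct)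
  case base
  then show ?case by (simp add: word_perm_simps simple_refl_perm_def transpose_def)
next
  case (step k)
  have "word_perm m (rev [k..<m + 1]) b = word_perm m (rev [Suc k..<m + 1]) (simple_refl_perm m k b)"
    using step.hyps by (simp add: upt_conv_Cons word_perm_simps word_perm_append del: upt_Suc)
  also have "\<dots> = (if b = k then m + 1 else if k < b then b - 1 else b)"
    using step.hyps step.prems by (subst step.IH) (auto simp: simple_refl_perm_low)
  finally show ?case .
qed

text \<open>These factors perform an unshuffle: odd positions come before even ones. The factor for
  \<open>K + 1\<close> pulls the value \<open>2*K + 1\<close> down to \<open>K + 1\<close> and
  pushes the values of the even positions up by one.\<close>

lemma word_perm_left:
  assumes "1 \<le> K" "K \<le> n" "b \<in> {1..2*n}"
  shows "word_perm (2*n) (concat (map (\<lambda>k. [k..<2 * k - 1]) (rev [2..<K + 1]))) b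
    = (if b < 2 * K then (if odd b then (b + 1) div 2 else K + b div 2) else b)"
  using assms(1,2)
proof (induction rule: dec_induct)
  case base
  have "b = 1" if "b < 2" using that assms by simp
  then show ?case by (auto simp: word_perm_simps)
next
  case (step K)
  have "rev [2..<Suc K + 1] = Suc K # rev [2..<K + 1]" using step.hyps by simp
  then have "word_perm (2*n) (concat (map (\<lambda>k. [k..<2 * k - 1]) (rev [2..<Suc K + 1]))) b
    = word_perm (2*n) [Suc K..<2 * Suc K - 1]
        (if b < 2 * K then (if odd b then (b + 1) div 2 else K + b div 2) else b)"
    using step by (simp add: word_perm_append del: upt_Suc)
  also have "\<dots> = (if b < 2 * Suc K then (if odd b then (b + 1) div 2 else Suc K + b div 2) else b)"
  proof -
    have wu: "word_perm (2*n) [Suc K..<Suc (2*K)] h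
        = (if h = 2*K+1 then Suc K else if Suc K \<le> h \<and> h < 2*K+1 then h + 1 else h)" if "h \<le> 2*n" for h
      using that step(4) step(1) by (subst word_perm_upt) (auto simp del: upt_Suc)
    consider "b < 2*K" "odd b" | "b < 2*K" "even b" | "b = 2*K" | "b = 2*K+1" | "b \<ge> 2*K+2"
      by linarith
    then show ?thesis
    proof cases
      case 1
      then have "(b + 1) div 2 \<le> K" "(b + 1) div 2 \<le> 2*n" using assms(3) by auto
      then show ?thesis using 1 by (simp add: wu del: upt_Suc)
    next
      case 2
      then have "b div 2 < K" "b div 2 \<ge> 1" "K + b div 2 \<le> 2*n" using assms(3) step(4) by (auto elim!: evenE)
      then show ?thesis using 2 by (simp add: wu del: upt_Suc)
    next
      case 3
      then show ?thesis using step(1) assms(3) by (simp add: wu del: upt_Suc)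
    next
      case 4
      then show ?thesis using assms(3) by (simp add: wu del: upt_Suc)
    next
      case 5
      then show ?thesis using assms(3) by (simp add: wu del: upt_Suc)
    qed
  qed
  finally show ?case .
qed

text \<open>The factor that starts at \<open>p\<close> sends \<open>p\<close> to
  \<open>m + 1\<close> and pushes the values already in the upper half up by one.\<close>

lemma word_perm_right:
  assumes "1 \<le> p" "p \<le> m + 1" "b \<in> {1..m}"
  shows "word_perm m (concat (map (\<lambda>k. rev [k..<m + 1]) [p..<m + 1])) b
    = (if b < p then b else m + 1 + (b - p))"
  using assms(2,1)
proof (induction rule: inc_induct)
  case base
  then show ?case using assms by (simp add: word_perm_simps)
next
  case (step p)
  have "[p..<m + 1] = p # [Suc p..<m + 1]" using step.hyps by (simp add: upt_conv_Cons del: upt_Suc)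
  then have "word_perm m (concat (map (\<lambda>k. rev [k..<m + 1]) [p..<m + 1])) b
     = word_perm m (concat (map (\<lambda>k. rev [k..<m + 1]) (p # [Suc p..<m + 1]))) b" by (simp only:)
  also have "\<dots> = word_perm m (rev [p..<m + 1])
      (word_perm m (concat (map (\<lambda>k. rev [k..<m + 1]) [Suc p..<m + 1])) b)"
    by (simp add: word_perm_append del: upt_Suc)
  also have "word_perm m (concat (map (\<lambda>k. rev [k..<m + 1]) [Suc p..<m + 1])) b
      = (if b < Suc p then b else m + 1 + (b - Suc p))"
    using step by simp
  also have "word_perm m (rev [p..<m + 1]) (if b < Suc p then b else m + 1 + (b - Suc p))
     = (if b < p then b else m + 1 + (b - p))"
  proof (cases "b < Suc p")
    case True
    then show ?thesis using step assms(3) by (subst word_perm_rev_upt) auto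
  next
    case False
    \<comment> \<open>\<open>word_perm_rev_upt\<close> evaluates arguments up to \<open>m\<close>; a
      value in the upper half is handled through its mirror \<open>c\<close>.\<close>
    define c where "c = m - (b - Suc p)"
    have c: "c \<in> {1..m}" "p < c" using False assms(3) step by (auto simp: c_def)
    have "m + 1 + (b - Suc p) = 2*m + 1 - c" using False assms(3) step by (simp add: c_def)
    then have "word_perm m (rev [p..<m + 1]) (m + 1 + (b - Suc p))
       = 2*m + 1 - word_perm m (rev [p..<m + 1]) c"
      using c step by (simp only:) (rule word_perm_flip(2), auto)
    also have "word_perm m (rev [p..<m + 1]) c = c - 1"
      using c by (subst word_perm_rev_upt) auto
    also have "2*m + 1 - (c - 1) = m + 1 + (b - p)" using False c assms(3) by (simp add: c_def)
    finally show ?thesis using False by (simp del: upt_Suc)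
  qed
  finally show ?case .
qed

lemma set_tau_word: "set (tau_word n) \<subseteq> {1..2*n}"
  by (auto simp: tau_word_def)

lemma tau_word_low:
  assumes "n \<ge> 1" "b \<in> {1..2*n}"
  shows "word_perm (2*n) (tau_word n) b = (if odd b then (b + 1) div 2 else 2*n + b div 2)"
proof -
  let ?h = "if b < 2 * n then (if odd b then (b + 1) div 2 else n + b div 2) else b"
  have h: "?h \<in> {1..2*n}" using assms by (auto elim!: evenE)
  have "word_perm (2*n) (tau_word n) b
    = word_perm (2*n) (concat (map (\<lambda>k. rev [k..<2*n + 1]) [n+1..<2*n + 1])) ?h"
    unfolding tau_word_def word_perm_append o_apply using word_perm_left[OF assms(1) order_refl assms(2)] by simp
  also have "\<dots> = (if ?h < n + 1 then ?h else 2*n + 1 + (?h - (n + 1)))"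
    using h by (intro word_perm_right) auto
  also have "\<dots> = (if odd b then (b + 1) div 2 else 2*n + b div 2)"
    using assms by (auto elim!: evenE oddE; presburger)
  finally show ?thesis .
qed

text \<open>The configuration of the Schubert cell: two full diagonals. The values k and 2n + k of
  the permutation are taken at the positions 2k - 1 and 2k, which form one block.\<close>

definition id_row :: "nat \<Rightarrow> nat \<Rightarrow> nat" where
  "id_row n a = (if a < 2*n then a else a - 2*n)"

lemma tau_bar_props:
  assumes "n \<ge> 1"
  shows "tau_bar n \<noteq> {}" "A \<in> tau_bar n \<Longrightarrow> A \<in> carrier (Sp (2*n))"
    "A \<in> tau_bar n \<Longrightarrow> a < 4*n \<Longrightarrow> q < 4*n \<Longrightarrow> A $$ (a, q) \<noteq> 0 \<Longrightarrow> id_row n a = q div 2"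
proof -
  let ?w = "word_perm (2*n) (tau_word n)"
  have t: "tau_bar n = perm_coset (2*n) ?w"
    unfolding tau_bar_def using word_coset(1)[OF set_tau_word] .
  then show "tau_bar n \<noteq> {}" using word_coset(2)[OF set_tau_word] by simp
  assume A: "A \<in> tau_bar n"
  then show "A \<in> carrier (Sp (2*n))" using perm_cosetD(1) t by blast
  assume aq: "a < 4*n" "q < 4*n" "A $$ (a, q) \<noteq> 0"
  then have w: "Suc a = ?w (Suc q)" using perm_cosetD(2)[of A "2*n" ?w a q] A t by simp
  show "id_row n a = q div 2"
  proof (cases "q < 2*n")
    case True
    then have "Suc a = (if odd (Suc q) then (Suc q + 1) div 2 else 2*n + Suc q div 2)"
      using w tau_word_low[OF assms, of "Suc q"] by simp
    then show ?thesis using True by (auto simp: id_row_def elim!: evenE oddE split: if_splits)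
  next
    case False
    define b where "b = 4*n - q"
    have b: "b \<in> {1..2*n}" "Suc q = 2*(2*n) + 1 - b" using False aq by (auto simp: b_def)
    have "?w (Suc q) = 2*(2*n) + 1 - ?w b"
      unfolding b(2) using b(1) by (intro word_perm_flip(2)[OF set_tau_word]) auto
    then have "Suc a = 4*n + 1 - (if odd b then (b + 1) div 2 else 2*n + b div 2)"
      using w tau_word_low[OF assms b(1)] by simp
    then show ?thesis using False aq(2) b by (auto simp: id_row_def b_def elim!: evenE oddE split: if_splits)
  qed
qed


subsection \<open>Row functions\<close>

text \<open>A configuration is encoded by the function that sends a column to the row of its
  marked cell, both counted from 0.\<close>

definition balanced :: "nat \<Rightarrow> (nat \<Rightarrow> nat) \<Rightarrow> bool" where
  "balanced n r \<longleftrightarrow> (\<forall>a<4*n. r a < 2*n \<and> r (4*n - Suc a) = 2*n - Suc (r a)) \<and>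
     (\<forall>k<2*n. card {a. a < 4*n \<and> r a = k} = 2)"

text \<open>Records one of the two bounds of a configuration; the other one is its image under the
  mirror \<open>a\<close> to \<open>4*n - Suc a\<close>.\<close>

definition admissible :: "nat \<Rightarrow> (nat \<Rightarrow> nat) \<Rightarrow> bool" where
  "admissible n r \<longleftrightarrow> balanced n r \<and> (\<forall>a<4*n. r a \<le> a)"

lemma balancedD:
  assumes "balanced n r"
  shows "a < 4*n \<Longrightarrow> r a < 2*n" "a < 4*n \<Longrightarrow> r (4*n - Suc a) = 2*n - Suc (r a)"
    "k < 2*n \<Longrightarrow> card {a. a < 4*n \<and> r a = k} = 2"
  using assms by (auto simp: balanced_def)

lemma admissible_upper:
  assumes "admissible n r" "a < 4*n"
  shows "a \<le> 2*n + r a"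
proof -
  have b: "balanced n r" and l: "\<forall>a<4*n. r a \<le> a" using assms(1) by (auto simp: admissible_def)
  have "r (4*n - Suc a) \<le> 4*n - Suc a" using l assms(2) by simp
  then show ?thesis using balancedD(1,2)[OF b assms(2)] assms(2) by linarith
qed

text \<open>A reflection of the Weyl group acting on columns. When \<open>k\<close> is the mirror of
  \<open>j\<close> the two transpositions coincide, which is the case of a long root.\<close>

definition flip_swap :: "nat \<Rightarrow> nat \<Rightarrow> nat \<Rightarrow> nat \<Rightarrow> nat" where
  "flip_swap d j k a = (if a = j then k else if a = k then j
     else if a = d - Suc j then d - Suc k else if a = d - Suc k then d - Suc j else a)"

lemma flip_swap_props:
  assumes "even d" "j < d" "k < d" "j \<noteq> k" "a < d"
  shows "flip_swap d j k a < d" "flip_swap d j k (flip_swap d j k a) = a"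
    "flip_swap d j k (d - Suc a) = d - Suc (flip_swap d j k a)"
proof -
  define j' k' a' where "j' = d - Suc j" and "k' = d - Suc k" and "a' = d - Suc a"
  have s: "j + j' + 1 = d" "k + k' + 1 = d" "a + a' + 1 = d" using assms by (auto simp: j'_def k'_def a'_def)
  define f where "f = flip_swap d j k"
  have f: "f x = (if x = j then k else if x = k then j else if x = j' then k' else if x = k' then j' else x)" for x
    by (simp add: f_def flip_swap_def j'_def k'_def)
  have ne: "j \<noteq> j'" "k \<noteq> k'" "j' \<noteq> k'" "j' = k \<longleftrightarrow> k' = j"
    using s assms(1,4) by presburger+
  have v: "f j = k" "f k = j" "f j' = k'" "f k' = j'"
    using ne assms(4) by (auto simp: f)
  consider "a = j" "a' = j'" | "a = k" "a' = k'" | "a = j'" "a' = j" | "a = k'" "a' = k"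
    | "a \<notin> {j, k, j', k'}" "a' \<notin> {j, k, j', k'}"
  proof -
    have "a = j \<longleftrightarrow> a' = j'" "a = k \<longleftrightarrow> a' = k'" "a = j' \<longleftrightarrow> a' = j" "a = k' \<longleftrightarrow> a' = k"
      using s by presburger+
    then show thesis using that by (metis empty_iff insert_iff)
  qed
  then have "f a < d \<and> f (f a) = a \<and> f a' + f a + 1 = d"
  proof cases
    case 5
    then have "f a = a" "f a' = a'" by (simp_all add: f)
    then show ?thesis using s by simp
  qed (simp_all only: v, (use s in linarith)+)
  then show "flip_swap d j k a < d" "flip_swap d j k (flip_swap d j k a) = a"
    "flip_swap d j k (d - Suc a) = d - Suc (flip_swap d j k a)"
    unfolding f_def a'_def by linarith+
qed

lemma balanced_swap:
  assumes r: "balanced n r" and jk: "j < 4*n" "k < 4*n" "j \<noteq> k"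
  shows "balanced n (r \<circ> flip_swap (4*n) j k)"
  unfolding balanced_def o_apply
proof (intro conjI allI impI)
  let ?s = "flip_swap (4*n) j k"
  have s: "?s a < 4*n" "?s (?s a) = a" "?s (4*n - Suc a) = 4*n - Suc (?s a)" if "a < 4*n" for a
    using flip_swap_props[OF _ jk that] by auto
  fix a assume "a < 4*n"
  note sa = s[OF this]
  show "r (?s a) < 2*n" by (rule balancedD(1)[OF r sa(1)])
  show "r (?s (4*n - Suc a)) = 2*n - Suc (r (?s a))"
    unfolding sa(3) by (rule balancedD(2)[OF r sa(1)])
next
  let ?s = "flip_swap (4*n) j k"
  have s: "?s a < 4*n" "?s (?s a) = a" if "a < 4*n" for a
    using flip_swap_props[OF _ jk that] by auto
  fix i assume "i < 2*n"
  have "bij_betw ?s {a. a < 4*n \<and> r (?s a) = i} {a. a < 4*n \<and> r a = i}"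
    by (rule bij_betw_byWitness[where f' = ?s]) (simp_all add: s image_subset_iff)
  then show "card {a. a < 4*n \<and> r (?s a) = i} = 2"
    using balancedD(3)[OF r \<open>i < 2*n\<close>] by (simp only: bij_betw_same_card)
qed

text \<open>A count of marks: the rows above \<open>r j\<close> and up to \<open>j\<close> contain
  \<open>2 * (j - r j)\<close> of them. Without a suitable \<open>k\<close>, these marks sit in
  columns left of \<open>j\<close>, where column and row agree, or right of
  \<open>2*n + r j\<close>. That leaves \<open>j - r j - 1\<close> and \<open>j - r j\<close>
  places, one too few.\<close>

lemma admissible_swap_exists:
  assumes r: "admissible n r" and j: "j < 2*n" "\<And>i. i < j \<Longrightarrow> r i = i" "r j < j"
  obtains k where "j < k" "k \<le> 2*n + r j" "r j < r k" "r k \<le> j"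
proof (rule ccontr)
  assume "\<not> thesis"
  then have no: "j < k \<Longrightarrow> k \<le> 2*n + r j \<Longrightarrow> \<not> (r j < r k \<and> r k \<le> j)" for k
    using that by blast
  let ?S = "{a. a < 4*n \<and> r j < r a \<and> r a \<le> j}"
  have b: "balanced n r" using r by (simp add: admissible_def)
  have "?S = (\<Union>v\<in>{r j<..j}. {a. a < 4*n \<and> r a = v})" by auto
  also have "card \<dots> = (\<Sum>v\<in>{r j<..j}. card {a. a < 4*n \<and> r a = v})"
    by (rule card_UN_disjoint) auto
  also have "\<dots> = (\<Sum>v\<in>{r j<..j}. 2)"
    using j balancedD(3)[OF b] by (intro sum.cong) auto
  finally have card: "card ?S = 2 * (j - r j)" by simp
  have "?S \<subseteq> {Suc (r j)..<j} \<union> {2*n + r j<..2*n + j}"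
  proof
    fix a assume a: "a \<in> ?S"
    show "a \<in> {Suc (r j)..<j} \<union> {2*n + r j<..2*n + j}"
    proof (cases "a < j")
      case True
      then show ?thesis using a j(2)[of a] by auto
    next
      case False
      then have "a > j" using a by (cases "a = j") auto
      then have "\<not> a \<le> 2*n + r j" using a no[of a] by blast
      then have "a > 2*n + r j" by simp
      moreover have "a \<le> 2*n + j" using admissible_upper[OF r, of a] a by auto
      ultimately show ?thesis by auto
    qed
  qed
  then have "card ?S \<le> card ({Suc (r j)..<j} \<union> {2*n + r j<..2*n + j})"
    by (intro card_mono) auto
  also have "\<dots> \<le> (j - Suc (r j)) + (j - r j)"
    by (rule order_trans[OF card_Un_le]) simp
  finally show False using card j(3) by simp
qed

text \<open>The condition \<open>r k \<le> j\<close> is the bound for the mark moved into column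
  \<open>j\<close>. The condition \<open>k \<le> 2*n + r j\<close> is the same bound for the mirror
  of the mark moved into column \<open>k\<close>.\<close>

lemma admissible_swap:
  assumes r: "admissible n r" and j: "j < 2*n" "r j < j"
    and k: "j < k" "k \<le> 2*n + r j" "r j < r k" "r k \<le> j"
  shows "admissible n (r \<circ> flip_swap (4*n) j k)"
proof -
  have b: "balanced n r" using r by (simp add: admissible_def)
  have k4: "k < 4*n" using j k by linarith
  have "r (flip_swap (4*n) j k a) \<le> a" if a: "a < 4*n" for a
  proof -
    have "r (4*n - Suc k) = 2*n - Suc (r k)" "r (4*n - Suc j) = 2*n - Suc (r j)" "r k < 2*n"
      using balancedD[OF b] k4 j by auto
    then have "r (4*n - Suc k) \<le> 4*n - Suc j" "r (4*n - Suc j) \<le> 4*n - Suc k"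
      using j k k4 by auto
    moreover have "r a \<le> a" using r a by (simp add: admissible_def)
    ultimately show ?thesis using j k by (auto simp: flip_swap_def)
  qed
  then show ?thesis using balanced_swap[OF b, of j k] j k k4 by (simp add: admissible_def)
qed

text \<open>Columns are settled from the left. The index \<open>j\<close> marks how many already
  agree with the two diagonals; a swap raises \<open>r j\<close> towards \<open>j\<close> and leaves
  the settled columns alone. The measure is lexicographic, the factor \<open>2*n + 1\<close>
  exceeding every possible value of \<open>j - r j\<close> with \<open>j \<le> 2*n\<close>.\<close>

lemma admissible_induct [consumes 1, case_names base step]:
  assumes "admissible n r"
    and base: "\<And>r. admissible n r \<Longrightarrow> (\<And>a. a < 4*n \<Longrightarrow> r a = (if a < 2*n then a else a - 2*n)) \<Longrightarrow> P r"
    and step: "\<And>r j k. admissible n r \<Longrightarrow> j < k \<Longrightarrow> k < 4*n \<Longrightarrow> r j < r k \<Longrightarrow>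
      admissible n (r \<circ> flip_swap (4*n) j k) \<Longrightarrow> P (r \<circ> flip_swap (4*n) j k) \<Longrightarrow> P r"
  shows "P r"
proof -
  have "admissible n r \<Longrightarrow> j \<le> 2*n \<Longrightarrow> (\<And>i. i < j \<Longrightarrow> r i = i) \<Longrightarrow> P r" for j
  proof (induction "(2*n - j) * (2*n + 1) + (j - r j)" arbitrary: j r rule: less_induct)
    case less
    have b: "balanced n r" using less.prems by (simp add: admissible_def)
    consider "j = 2*n" | "j < 2*n" "r j = j" | "j < 2*n" "r j < j"
    proof -
      have "r j \<le> j" if "j < 2*n" using less.prems(1) that by (simp add: admissible_def)
      then show thesis using that less.prems(2) by (cases "j = 2*n"; cases "r j = j") auto
    qed
    then show ?case
    proof cases
      case 1
      show ?thesis
      proof (rule base[OF less.prems(1)])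
        fix a assume a: "a < 4*n"
        show "r a = (if a < 2*n then a else a - 2*n)"
        proof (cases "a < 2*n")
          case False
          then have "r (4*n - Suc a) = 4*n - Suc a" using a 1 by (intro less.prems(3)) auto
          then show ?thesis using balancedD(1,2)[OF b a] False a by auto
        qed (use 1 less.prems(3) in simp)
      qed
    next
      case 2
      obtain c where c: "2*n - j = Suc c" "2*n - Suc j = c" using 2(1) by (metis Suc_diff_Suc)
      have "(2*n - Suc j) * (2*n + 1) + (Suc j - r (Suc j)) < (2*n - j) * (2*n + 1) + (j - r j)"
        unfolding c using 2(1) by simp
      then show ?thesis
        by (rule less.hyps) (use less.prems 2 in \<open>auto simp: less_Suc_eq\<close>)
    next
      case 3
      obtain k where k: "j < k" "k \<le> 2*n + r j" "r j < r k" "r k \<le> j"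
        using admissible_swap_exists[OF less.prems(1) 3(1) less.prems(3) 3(2)] .
      have k4: "k < 4*n" using 3 k by linarith
      let ?s = "flip_swap (4*n) j k"
      have a': "admissible n (r \<circ> ?s)" using admissible_swap[OF less.prems(1) 3 k] .
      \<comment> \<open>The swap also moves the mirror columns. If the mirror of \<open>k\<close>
        were already settled, symmetry would give \<open>k = 2*n + r k\<close>, beyond the bound
        \<open>2*n + r j\<close> on \<open>k\<close>.\<close>
      have "j \<le> 4*n - Suc k"
      proof (rule ccontr)
        assume "\<not> ?thesis"
        then have "r (4*n - Suc k) = 4*n - Suc k" by (intro less.prems(3)) simp
        then show False using balancedD(1,2)[OF b k4] k k4 by linarith
      qed
      then have fix_low: "?s i = i" if "i < j" for i
        using that k 3 by (auto simp: flip_swap_def)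
      have "P (r \<circ> ?s)"
      proof (rule less.hyps[of j])
        show "(2*n - j) * (2*n + 1) + (j - (r \<circ> ?s) j) < (2*n - j) * (2*n + 1) + (j - r j)"
          using k by (simp add: flip_swap_def)
      qed (use a' less.prems fix_low in auto)
      then show ?thesis using step[OF less.prems(1) k(1) k4 k(3) a'] by blast
    qed
  qed
  from this[of 0] assms(1) show ?thesis by simp
qed


subsection \<open>Torus fixed cosets\<close>

definition repeated :: "(nat \<Rightarrow> nat) \<Rightarrow> nat \<Rightarrow> bool" where
  "repeated r a \<longleftrightarrow> (\<exists>b<a. r b = r a)"

text \<open>Lists the columns row by row, the left mark of a row before the right one. This choice
  of order is compatible with the mirror, as a symplectic representative requires.\<close>

definition fibre_pos :: "(nat \<Rightarrow> nat) \<Rightarrow> nat \<Rightarrow> nat" where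
  "fibre_pos r a = 2 * r a + (if repeated r a then 1 else 0)"

definition row_mat :: "nat \<Rightarrow> (nat \<Rightarrow> nat) \<Rightarrow> complex mat" where
  "row_mat n r = mono_mat (2*n) (fibre_pos r)"

lemma fibre_pos_div [simp]: "fibre_pos r a div 2 = r a"
  by (simp add: fibre_pos_def)

lemma balanced_no_three:
  assumes r: "balanced n r" and "a < b" "b < c" "c < 4*n" "r a = r c" "r b = r c"
  shows False
proof -
  have "{a, b, c} \<subseteq> {x. x < 4*n \<and> r x = r c}" using assms(2-) by auto
  then have "card {a, b, c} \<le> card {x. x < 4*n \<and> r x = r c}" by (intro card_mono) auto
  moreover have "card {a, b, c} = 3" using assms(2,3) by auto
  ultimately show False using balancedD(3)[OF r, of "r c"] balancedD(1)[OF r assms(4)] by simp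
qed

lemma balanced_partner:
  assumes r: "balanced n r" and a: "a < 4*n"
  obtains b where "b < 4*n" "b \<noteq> a" "r b = r a"
proof -
  have "card {x. x < 4*n \<and> r x = r a} = 2"
    using balancedD(3)[OF r balancedD(1)[OF r a]] .
  then obtain x y where xy: "{x. x < 4*n \<and> r x = r a} = {x, y}" "x \<noteq> y" by (auto simp: card_2_iff)
  have "x < 4*n \<and> r x = r a" "y < 4*n \<and> r y = r a" using xy(1) by blast+
  then show thesis using that xy(2) by metis
qed

lemma fibre_pos_less:
  assumes "balanced n r" "a < 4*n"
  shows "fibre_pos r a < 4*n"
  using balancedD(1)[OF assms] by (simp add: fibre_pos_def)

lemma fibre_pos_inj:
  assumes r: "balanced n r"
  shows "inj_on (fibre_pos r) {..<4*n}"
proof -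
  have less: "fibre_pos r a \<noteq> fibre_pos r b" if ab: "a < b" "b < 4*n" for a b
  proof
    assume e: "fibre_pos r a = fibre_pos r b"
    then have rab: "r a = r b" by (metis fibre_pos_div)
    then have "repeated r b" using ab unfolding repeated_def by blast
    then have "repeated r a" using e rab by (simp add: fibre_pos_def split: if_splits)
    then obtain c where c: "c < a" "r c = r a" unfolding repeated_def by blast
    show False using balanced_no_three[OF r c(1) ab] c(2) rab by simp
  qed
  show ?thesis
  proof (rule inj_onI)
    fix a b assume ab: "a \<in> {..<4*n}" "b \<in> {..<4*n}" "fibre_pos r a = fibre_pos r b"
    show "a = b"
      by (rule linorder_cases[of a b]) (use less[of a b] less[of b a] ab in simp_all)
  qed
qed

text \<open>The mirror reverses the order of columns, so the left mark of a row becomes the right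
  mark of the mirror row. This is the parity change of the position.\<close>

lemma fibre_pos_flip:
  assumes r: "balanced n r" and a: "a < 4*n"
  shows "fibre_pos r (4*n - Suc a) = 4*n - Suc (fibre_pos r a)"
proof -
  let ?f = "\<lambda>x. 4*n - Suc x"
  have fr: "r (?f x) = r (?f y) \<longleftrightarrow> r x = r y" if "x < 4*n" "y < 4*n" for x y
    unfolding balancedD(2)[OF r that(1)] balancedD(2)[OF r that(2)]
    using balancedD(1)[OF r that(1)] balancedD(1)[OF r that(2)] by (auto simp: Suc_diff_Suc eq_diff_iff)
  have "repeated r (?f a) \<longleftrightarrow> \<not> repeated r a"
  proof
    assume "repeated r (?f a)"
    then obtain c where c: "c < ?f a" "r c = r (?f a)" unfolding repeated_def by blast
    show "\<not> repeated r a"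
    proof
      assume "repeated r a"
      then obtain b where b: "b < a" "r b = r a" unfolding repeated_def by blast
      have c': "a < ?f c" "?f c < 4*n" "?f (?f c) = c" using c(1) a by auto
      have "r (?f (?f c)) = r (?f a)" by (rule trans[OF arg_cong[OF c'(3), of r] c(2)])
      then have e: "r (?f c) = r a" by (rule iffD1[OF fr[OF c'(2) a]])
      show False by (rule balanced_no_three[OF r b(1) c'(1,2) trans[OF b(2) e[symmetric]] e[symmetric]])
    qed
  next
    assume no: "\<not> repeated r a"
    obtain b where b: "b < 4*n" "b \<noteq> a" "r b = r a" using balanced_partner[OF r a] .
    then have "a < b" using no unfolding repeated_def by (metis linorder_neqE_nat)
    then have "?f b < ?f a" using b(1) by simp
    moreover have "r (?f b) = r (?f a)" using fr[OF b(1) a] b(3) by simp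
    ultimately show "repeated r (?f a)" unfolding repeated_def by blast
  qed
  then have "(if repeated r (?f a) then 1 else 0) + (if repeated r a then 1 else 0) = (1::nat)" by simp
  moreover have "r (?f a) + Suc (r a) = 2*n" using balancedD(1,2)[OF r a] by linarith
  ultimately have "fibre_pos r (?f a) + Suc (fibre_pos r a) = 4*n" unfolding fibre_pos_def by linarith
  then show ?thesis by linarith
qed

lemma row_mat_Sp:
  assumes "balanced n r"
  shows "row_mat n r \<in> carrier (Sp (2*n))"
  unfolding row_mat_def
proof (rule mono_mat_Sp)
  fix a assume "a < 2*(2*n)"
  then have a: "a < 4*n" by simp
  show "fibre_pos r a < 2*(2*n)" using fibre_pos_less[OF assms a] by simp
  show "fibre_pos r (2*(2*n) - Suc a) = 2*(2*n) - Suc (fibre_pos r a)"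
    using fibre_pos_flip[OF assms a] by simp
qed (use fibre_pos_inj[OF assms] in simp)

lemma row_mat_nonzero:
  "a < 4*n \<Longrightarrow> q < 4*n \<Longrightarrow> row_mat n r $$ (a, q) \<noteq> 0 \<longleftrightarrow> q = fibre_pos r a"
  unfolding row_mat_def by (rule mono_mat_nonzero) simp_all

lemma coset_eqI:
  assumes A: "A \<in> carrier (Sp (2*n))" and B: "B \<in> carrier (Sp (2*n))"
    and AB: "sp_inv (2*n) B * A \<in> blk_group (2*n)"
  shows "A <#\<^bsub>Sp (2*n)\<^esub> parabolic n = B <#\<^bsub>Sp (2*n)\<^esub> parabolic n"
proof -
  have sub: "(\<lambda>h. X * h) ` blk_group (2*n) \<subseteq> (\<lambda>h. Y * h) ` blk_group (2*n)"
    if X: "X \<in> carrier (Sp (2*n))" and Y: "Y \<in> carrier (Sp (2*n))" and XY: "sp_inv (2*n) Y * X \<in> blk_group (2*n)" for X Y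
  proof (rule image_subsetI)
    fix h assume h: "h \<in> blk_group (2*n)"
    then have hS: "h \<in> carrier (Sp (2*n))" by (rule blk_Sp)
    have "X * h = Y * (sp_inv (2*n) Y * X * h)"
      by (simp only: Sp_assoc[OF sp_inv_closed[OF Y] X hS] Sp_cancel(2)[OF Y mult_mat_Sp[OF X hS]])
    then show "X * h \<in> (\<lambda>h. Y * h) ` blk_group (2*n)" using blk_mult[OF XY h] by (rule image_eqI)
  qed
  have "sp_inv (2*n) (sp_inv (2*n) B * A) = sp_inv (2*n) A * B"
    by (simp only: sp_inv_mult[OF sp_inv_carrier Sp_dims(1)[OF A]] sp_inv_sp_inv[OF Sp_dims(1)[OF B]])
  then have BA: "sp_inv (2*n) A * B \<in> blk_group (2*n)" using blk_inv[OF AB] by (simp only:)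
  show ?thesis
    unfolding l_coset_Sp parabolic_eq by (rule equalityI[OF sub[OF A B AB] sub[OF B A BA]])
qed

lemma coset_eqD:
  assumes A: "A \<in> carrier (Sp (2*n))"
    and AB: "A <#\<^bsub>Sp (2*n)\<^esub> parabolic n = B <#\<^bsub>Sp (2*n)\<^esub> parabolic n"
  obtains h where "h \<in> blk_group (2*n)" "A = B * h"
proof -
  have "A = A * 1\<^sub>m (2*(2*n))" using A by (simp add: Sp_dims)
  then have "A \<in> A <#\<^bsub>Sp (2*n)\<^esub> parabolic n"
    unfolding l_coset_Sp parabolic_eq using blk_one[of "2*n"] by (rule image_eqI)
  then have "A \<in> (\<lambda>h. B * h) ` blk_group (2*n)"
    by (simp only: AB) (simp only: l_coset_Sp parabolic_eq)
  then obtain h where "A = B * h" "h \<in> blk_group (2*n)" by (rule imageE)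
  then show thesis by (rule that[rotated])
qed

lemma coset_mult:
  assumes "B \<in> carrier (Sp (2*n))" "A \<in> carrier (Sp (2*n))"
  shows "B <#\<^bsub>Sp (2*n)\<^esub> (A <#\<^bsub>Sp (2*n)\<^esub> parabolic n) = (B * A) <#\<^bsub>Sp (2*n)\<^esub> parabolic n"
  unfolding l_coset_Sp parabolic_eq image_image
  using assms by (intro image_cong refl) (simp add: Sp_assoc blk_Sp)

text \<open>Up to sign, row \<open>fibre_pos r a\<close> of the quotient by
  \<open>row_mat n r\<close> is row \<open>a\<close> of \<open>A\<close>. A lower bound on where the
  rows of \<open>A\<close> begin is thus exactly block triangularity of the quotient.\<close>

lemma coset_row_mat:
  assumes A: "A \<in> carrier (Sp (2*n))" and r: "balanced n r"
    and supp: "\<And>a q. a < 4*n \<Longrightarrow> q < 4*n \<Longrightarrow> A $$ (a, q) \<noteq> 0 \<Longrightarrow> r a \<le> q div 2"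
  shows "A <#\<^bsub>Sp (2*n)\<^esub> parabolic n = row_mat n r <#\<^bsub>Sp (2*n)\<^esub> parabolic n"
proof (rule coset_eqI[OF A row_mat_Sp[OF r]])
  let ?W = "row_mat n r"
  have WS: "?W \<in> carrier (Sp (2*n))" "sp_inv (2*n) ?W \<in> carrier (Sp (2*n))"
    using row_mat_Sp[OF r] sp_inv_closed by auto
  show "sp_inv (2*n) ?W * A \<in> blk_group (2*n)"
    unfolding blk_group_def supp_group_def
  proof (intro CollectI conjI allI impI)
    show "sp_inv (2*n) ?W * A \<in> carrier (Sp (2*n))" using WS(2) A by (rule mult_mat_Sp)
    fix p q assume pq: "p < 2*(2*n)" "q < 2*(2*n)" "(sp_inv (2*n) ?W * A) $$ (p, q) \<noteq> 0"
    then obtain a where a: "a < 2*(2*n)" "sp_inv (2*n) ?W $$ (p, a) \<noteq> 0" "A $$ (a, q) \<noteq> 0"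
      using Sp_mult_nonzero[OF WS(2) A] by metis
    then have "?W $$ (4*n - Suc a, 4*n - Suc p) \<noteq> 0" using pq by (simp add: sp_inv_index)
    then have "4*n - Suc p = fibre_pos r (4*n - Suc a)" using a pq by (subst (asm) row_mat_nonzero) auto
    then have "p = fibre_pos r a"
      using fibre_pos_flip[OF r, of a] fibre_pos_less[OF r, of a] a pq by simp
    then show "p div 2 \<le> q div 2" using supp[of a q] a pq by simp
  qed
qed

section \<open>The row function of a torus fixed coset\<close>

definition diag_elt :: "nat \<Rightarrow> (nat \<Rightarrow> complex) \<Rightarrow> complex mat" where
  "diag_elt m f = mat (2*m) (2*m) (\<lambda>(i, j). if i = j then f i else 0)"

lemma diag_elt_mult:
  assumes "A \<in> carrier_mat (2*m) (2*m)" "i < 2*m" "j < 2*m"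
  shows "(diag_elt m f * A) $$ (i, j) = f i * A $$ (i, j)"
proof -
  have "(diag_elt m f * A) $$ (i, j) = (\<Sum>k<2*m. diag_elt m f $$ (i, k) * A $$ (k, j))"
    using assms by (intro mat_mult_entry) (auto simp: diag_elt_def)
  also have "\<dots> = (\<Sum>k<2*m. if k = i then f i * A $$ (i, j) else 0)"
    using assms by (intro sum.cong) (auto simp: diag_elt_def)
  finally show ?thesis using assms by simp
qed

lemma diag_elt_torus:
  assumes f: "\<And>i. i < 2*m \<Longrightarrow> f i * f (2*m - Suc i) = 1"
  shows "diag_elt m f \<in> torus m"
proof -
  have c: "diag_elt m f \<in> carrier_mat (2*m) (2*m)" by (simp add: diag_elt_def)
  have "sp_inv m (diag_elt m f) = diag_elt m (\<lambda>i. f (2*m - Suc i))"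
    by (rule eq_matI) (auto simp: sp_inv_index diag_elt_def sp_inv_def)
  moreover have "diag_elt m (\<lambda>i. f (2*m - Suc i)) * diag_elt m f = 1\<^sub>m (2*m)"
  proof (rule eq_matI)
    fix i j assume "i < dim_row (1\<^sub>m (2*m) :: complex mat)" "j < dim_col (1\<^sub>m (2*m) :: complex mat)"
    then have ij: "i < 2*m" "j < 2*m" by auto
    show "(diag_elt m (\<lambda>i. f (2*m - Suc i)) * diag_elt m f) $$ (i, j) = 1\<^sub>m (2*m) $$ (i, j)"
      unfolding diag_elt_mult[OF c ij] using ij f[OF ij(1)]
      by (auto simp: diag_elt_def mult.commute[of "f (2*m - Suc _)"])
  qed (auto simp: diag_elt_def)
  ultimately show ?thesis using c by (auto simp: torus_iff carrier_Sp diag_elt_def)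
qed

text \<open>The torus spans all diagonal matrices, so each \<open>A\<^sup>-\<^sup>1 E\<^sub>a\<^sub>a A\<close> is block upper triangular.\<close>

lemma fixed_coset_products:
  assumes A: "A \<in> carrier (Sp (2*n))"
    and fixed: "\<And>t. t \<in> torus (2*n) \<Longrightarrow>
      t <#\<^bsub>Sp (2*n)\<^esub> (A <#\<^bsub>Sp (2*n)\<^esub> parabolic n) = A <#\<^bsub>Sp (2*n)\<^esub> parabolic n"
    and apq: "a < 4*n" "p < 4*n" "q < 4*n" "q div 2 < p div 2"
  shows "sp_inv (2*n) A $$ (p, a) * A $$ (a, q) = 0"
proof -
  define g where "g b = sp_inv (2*n) A $$ (p, b) * A $$ (b, q)" for b
  have sum0: "(\<Sum>b<4*n. g b * f b) = 0" if f: "\<And>i. i < 4*n \<Longrightarrow> f i * f (4*n - Suc i) = 1" for f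
  proof -
    have t: "diag_elt (2*n) f \<in> torus (2*n)" using f by (intro diag_elt_torus) simp
    then have tS: "diag_elt (2*n) f \<in> carrier (Sp (2*n))" by (simp add: torus_iff)
    obtain h where h: "h \<in> blk_group (2*n)" "diag_elt (2*n) f * A = A * h"
      using coset_eqD[OF mult_mat_Sp[OF tS A]] fixed[OF t] coset_mult[OF tS A] by metis
    have "sp_inv (2*n) A * (diag_elt (2*n) f * A) = h"
      unfolding h(2) using A h(1) by (simp add: Sp_cancel blk_Sp)
    moreover have "h $$ (p, q) = 0"
      by (rule ccontr) (use supp_groupD(2)[OF h(1)[unfolded blk_group_def], of p q] apq in simp)
    ultimately have "0 = (sp_inv (2*n) A * (diag_elt (2*n) f * A)) $$ (p, q)" by simp
    also have "\<dots> = (\<Sum>b<2*(2*n). sp_inv (2*n) A $$ (p, b) * (diag_elt (2*n) f * A) $$ (b, q))"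
      using apq A tS by (intro Sp_mult_entry sp_inv_closed mult_mat_Sp) auto
    also have "\<dots> = (\<Sum>b<4*n. g b * f b)"
      using apq A by (intro sum.cong) (auto simp: diag_elt_mult[OF Sp_dims(1)[OF A]] g_def)
    finally show ?thesis by simp
  qed
  have s1: "(\<Sum>b<4*n. g b) = 0" using sum0[of "\<lambda>_. 1"] by simp
  \<comment> \<open>Compares the identity with the torus element that has \<open>x\<close> in place
    \<open>a\<close> and \<open>1/x\<close> in the mirror place; only two summands survive.\<close>
  have sx: "(x - 1) * g a + (1/x - 1) * g (4*n - Suc a) = 0" if x: "x \<noteq> 0" for x
  proof -
    let ?a' = "4*n - Suc a"
    define f where "f b = (if b = a then x else if b = ?a' then 1/x else 1)" for b
    have ne: "a \<noteq> ?a'" using apq(1) by presburger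
    have "(\<Sum>b<4*n. g b * f b) = 0"
    proof (rule sum0)
      fix i assume "i < 4*n"
      then have "4*n - Suc i = a \<longleftrightarrow> i = ?a'" "4*n - Suc i = ?a' \<longleftrightarrow> i = a" using apq(1) by auto
      then show "f i * f (4*n - Suc i) = 1" using ne x by (simp add: f_def)
    qed
    also have "(\<Sum>b<4*n. g b * f b) = (\<Sum>b<4*n. g b + (if b = a then (x - 1) * g b else 0)
        + (if b = ?a' then (1/x - 1) * g b else 0))"
      using ne by (intro sum.cong) (auto simp: f_def algebra_simps)
    also have "\<dots> = (x - 1) * g a + (1/x - 1) * g ?a'"
      using apq(1) s1 by (simp add: sum.distrib)
    finally show ?thesis .
  qed
  \<comment> \<open>The values 2 and 3 of \<open>x\<close> give two linearly independent equations
    for \<open>g a\<close> and its mirror.\<close>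
  have "g a = 0"
    using sx[of 2] sx[of 3] by (simp add: field_simps)
  then show ?thesis by (simp add: g_def)
qed

text \<open>Since \<open>A * B\<close> is the identity, some \<open>p\<close> has both
  \<open>A $$ (a, p)\<close> and \<open>B $$ (p, a)\<close> nonzero; \<open>w a\<close> picks one.
  The vanishing products make its block a lower bound for the blocks met by row \<open>a\<close> of
  \<open>A\<close> and an upper bound for those met by column \<open>a\<close> of \<open>B\<close>,
  hence independent of the choice.\<close>

lemma fixed_coset_rows:
  assumes A: "A \<in> carrier (Sp (2*n))"
    and fixed: "\<And>t. t \<in> torus (2*n) \<Longrightarrow>
      t <#\<^bsub>Sp (2*n)\<^esub> (A <#\<^bsub>Sp (2*n)\<^esub> parabolic n) = A <#\<^bsub>Sp (2*n)\<^esub> parabolic n"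
  obtains r where "balanced n r"
    "\<And>a q. a < 4*n \<Longrightarrow> q < 4*n \<Longrightarrow> A $$ (a, q) \<noteq> 0 \<Longrightarrow> r a \<le> q div 2"
    "\<And>a. a < 4*n \<Longrightarrow> \<exists>q<4*n. A $$ (a, q) \<noteq> 0 \<and> q div 2 = r a"
proof -
  define B where "B = sp_inv (2*n) A"
  have BS: "B \<in> carrier (Sp (2*n))" using A by (simp add: B_def sp_inv_closed)
  have AB: "A * B = 1\<^sub>m (2*(2*n))" "B * A = 1\<^sub>m (2*(2*n))"
    using A by (simp_all add: B_def sp_inv_left sp_inv_right)
  have prod: "p div 2 \<le> q div 2" if "a < 4*n" "p < 4*n" "q < 4*n" "B $$ (p, a) \<noteq> 0" "A $$ (a, q) \<noteq> 0" for a p q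
    using fixed_coset_products[OF A fixed that(1-3)] that(4,5) unfolding B_def
    by (metis mult_eq_0_iff not_le)
  have "\<exists>p<4*n. A $$ (a, p) \<noteq> 0 \<and> B $$ (p, a) \<noteq> 0" if "a < 4*n" for a
  proof -
    have "(A * B) $$ (a, a) \<noteq> 0" using that by (simp add: AB)
    then show ?thesis using Sp_mult_nonzero[OF A BS, of a a] that by auto
  qed
  then obtain w where w: "\<And>a. a < 4*n \<Longrightarrow> w a < 4*n \<and> A $$ (a, w a) \<noteq> 0 \<and> B $$ (w a, a) \<noteq> 0"
    by metis
  define r where "r a = w a div 2" for a
  have low: "r a \<le> q div 2" if "a < 4*n" "q < 4*n" "A $$ (a, q) \<noteq> 0" for a q
    unfolding r_def using prod[of a "w a" q] w that by blast
  have up: "p div 2 \<le> r a" if "a < 4*n" "p < 4*n" "B $$ (p, a) \<noteq> 0" for a p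
    unfolding r_def using prod[of a p "w a"] w that by blast
  have Bflip: "B $$ (p, a) \<noteq> 0 \<longleftrightarrow> A $$ (4*n - Suc a, 4*n - Suc p) \<noteq> 0" if "p < 4*n" "a < 4*n" for p a
    using that by (simp add: B_def sp_inv_index)
  have r_less: "r a < 2*n" if "a < 4*n" for a using w[OF that] by (auto simp: r_def)
  \<comment> \<open>Reflection turns column \<open>a\<close> of \<open>B\<close> into the mirror row
    of \<open>A\<close> and thereby exchanges the upper and the lower bound.\<close>
  have flip: "r (4*n - Suc a) = 2*n - Suc (r a)" if a: "a < 4*n" for a
  proof (rule antisym)
    have wa: "w a < 4*n" "B $$ (w a, a) \<noteq> 0" using w[OF a] by auto
    have "r (4*n - Suc a) \<le> (4*n - Suc (w a)) div 2"
      using low[of "4*n - Suc a" "4*n - Suc (w a)"] Bflip[OF wa(1) a] wa a by simp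
    then show "r (4*n - Suc a) \<le> 2*n - Suc (r a)"
      using div2_flip[of "w a" "2*n"] wa by (simp add: r_def)
    let ?a' = "4*n - Suc a"
    have a': "?a' < 4*n" using a by simp
    have wa': "w ?a' < 4*n" "A $$ (?a', w ?a') \<noteq> 0" using w[OF a'] by auto
    have "4*n - Suc (4*n - Suc (w ?a')) = w ?a'" using wa' by simp
    then have "(4*n - Suc (w ?a')) div 2 \<le> r a"
      using up[OF a, of "4*n - Suc (w ?a')"] Bflip[of "4*n - Suc (w ?a')" a] wa' a by simp
    then have "2*n - Suc (r ?a') \<le> r a"
      using div2_flip[of "w ?a'" "2*n"] wa' by (simp add: r_def)
    then show "2*n - Suc (r a) \<le> r ?a'" by linarith
  qed
  have card: "card {a. a < 4*n \<and> r a = k} = 2" if k: "k < 2*n" for k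
  proof -
    have supp: "B $$ (p, a) * A $$ (a, p) = 0" if "a < 4*n" "p < 4*n" "p div 2 \<noteq> r a" for a p
      using low[of a p] up[of a p] that by (cases "B $$ (p, a) = 0") auto
    have row: "(\<Sum>p\<in>{2*k, 2*k+1}. B $$ (p, a) * A $$ (a, p)) = (if r a = k then 1 else 0)" if a: "a < 4*n" for a
    proof (cases "r a = k")
      case True
      have "(\<Sum>p\<in>{2*k, 2*k+1}. B $$ (p, a) * A $$ (a, p)) = (\<Sum>p<4*n. B $$ (p, a) * A $$ (a, p))"
      proof (rule sum.mono_neutral_left)
        show "\<forall>p\<in>{..<4*n} - {2*k, 2*k+1}. B $$ (p, a) * A $$ (a, p) = 0"
        proof
          fix p assume p: "p \<in> {..<4*n} - {2*k, 2*k+1}"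
          then have "p div 2 \<noteq> r a" using True by (cases "even p") (auto elim!: evenE oddE)
          then show "B $$ (p, a) * A $$ (a, p) = 0" using supp[OF a] p by simp
        qed
      qed (use k in auto)
      also have "\<dots> = (A * B) $$ (a, a)"
        using Sp_mult_entry[OF A BS, of a a] a by (simp add: mult.commute)
      finally show ?thesis using True a AB by simp
    next
      case False
      then have "B $$ (2*k, a) * A $$ (a, 2*k) = 0" "B $$ (2*k+1, a) * A $$ (a, 2*k+1) = 0"
        using supp[OF a] k by auto
      then show ?thesis using False by auto
    qed
    \<comment> \<open>A trace computation: after exchanging the sums, the count becomes the sum of
      the two diagonal entries of \<open>B * A\<close> in block \<open>k\<close>.\<close>
    have "of_nat (card {a. a < 4*n \<and> r a = k}) = (\<Sum>a<4*n. if r a = k then 1 else (0::complex))"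
      by (simp add: sum.If_cases Int_def)
    also have "\<dots> = (\<Sum>a<4*n. \<Sum>p\<in>{2*k, 2*k+1}. B $$ (p, a) * A $$ (a, p))"
      using row by (intro sum.cong) auto
    also have "\<dots> = (\<Sum>p\<in>{2*k, 2*k+1}. \<Sum>a<4*n. B $$ (p, a) * A $$ (a, p))"
      by (rule sum.swap)
    also have "\<dots> = (\<Sum>p\<in>{2*k, 2*k+1}. (B * A) $$ (p, p))"
      using k Sp_mult_entry[OF BS A] by (intro sum.cong) auto
    also have "\<dots> = of_nat 2" using k by (simp add: AB)
    finally show ?thesis using of_nat_eq_iff by blast
  qed
  have "balanced n r" using r_less flip card by (simp add: balanced_def)
  then show thesis
  proof (rule that)
    show "\<exists>q<4*n. A $$ (a, q) \<noteq> 0 \<and> q div 2 = r a" if "a < 4*n" for a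
      unfolding r_def
      by (intro exI[of _ "w a"] conjI refl conjunct1[OF w[OF that]]
        conjunct1[OF conjunct2[OF w[OF that]]])
  qed (rule low)
qed


subsection \<open>The Schubert variety\<close>

lemma flag_varietyI: "A \<in> carrier (Sp (2*n)) \<Longrightarrow> A <#\<^bsub>Sp (2*n)\<^esub> parabolic n \<in> flag_variety n"
  by (auto simp: flag_variety_def LCOSETS_def)

lemma topspace_zariski_flag: "topspace (zariski_flag n) = flag_variety n"
proof
  show "topspace (zariski_flag n) \<subseteq> flag_variety n"
    unfolding topspace_def openin_zariski_flag zariski_open_flag_def by blast
  have "{A \<in> carrier (Sp (2*n)). A <#\<^bsub>Sp (2*n)\<^esub> parabolic n \<in> flag_variety n} = carrier (Sp (2*n))"
    using flag_varietyI by blast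
  moreover have "zariski_open_Sp (2*n) (carrier (Sp (2*n)))"
    unfolding zariski_open_Sp_def
    by (rule exI[of _ "{\<lambda>_. 1}"]) (auto intro: entry_polys.const)
  ultimately have "openin (zariski_flag n) (flag_variety n)"
    by (simp add: openin_zariski_flag zariski_open_flag_def openin_zariski_Sp)
  then show "flag_variety n \<subseteq> topspace (zariski_flag n)" by (rule openin_subset)
qed

section \<open>Equations on the group and limits of curves\<close>

lemma schubert_variety_equations:
  obtains F where "F \<subseteq> entry_polys (4*n)"
    "\<forall>A\<in>carrier (Sp (2*n)).
      A <#\<^bsub>Sp (2*n)\<^esub> parabolic n \<in> schubert_variety n \<longleftrightarrow> (\<forall>f\<in>F. f A = 0)"
proof -
  have "closedin (zariski_flag n) (schubert_variety n)"
    by (simp add: schubert_variety_def)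
  then have "openin (zariski_flag n) (flag_variety n - schubert_variety n)"
    by (simp add: closedin_def topspace_zariski_flag)
  then have "zariski_open_Sp (2*n) {A \<in> carrier (Sp (2*n)).
      A <#\<^bsub>Sp (2*n)\<^esub> parabolic n \<in> flag_variety n - schubert_variety n}"
    by (simp add: openin_zariski_flag zariski_open_flag_def openin_zariski_Sp)
  then obtain F where F: "F \<subseteq> entry_polys (2*(2*n))"
    "{A \<in> carrier (Sp (2*n)). A <#\<^bsub>Sp (2*n)\<^esub> parabolic n \<in> flag_variety n - schubert_variety n}
      = carrier (Sp (2*n)) - {A. \<forall>f\<in>F. f A = 0}"
    unfolding zariski_open_Sp_def by blast
  show thesis
  proof (rule that[of F])
    show "F \<subseteq> entry_polys (4*n)" using F(1) by simp
    show "\<forall>A\<in>carrier (Sp (2*n)).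
      A <#\<^bsub>Sp (2*n)\<^esub> parabolic n \<in> schubert_variety n \<longleftrightarrow> (\<forall>f\<in>F. f A = 0)"
      using F(2) flag_varietyI by blast
  qed
qed

lemma entry_polys_continuous:
  assumes "f \<in> entry_polys d"
    and c: "\<And>i j. i < d \<Longrightarrow> j < d \<Longrightarrow> isCont (\<lambda>t. c t $$ (i, j)) (x::complex)"
  shows "isCont (\<lambda>t. f (c t)) x"
  using assms(1)
proof induction
  case (const z)
  show ?case by (rule continuous_const)
next
  case (entry i j)
  then show ?case by (rule c)
next
  case (add f g)
  then show ?case by (intro continuous_add)
next
  case (mult f g)
  then show ?case by (intro continuous_mult)
qed

text \<open>A polynomial that vanishes along the curve away from 0 vanishes at 0 by continuity. Only
  the entries of the curve have to be continuous.\<close>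

lemma schubert_variety_curve:
  fixes c :: "complex \<Rightarrow> complex mat"
  assumes cont: "\<And>i j. i < 4*n \<Longrightarrow> j < 4*n \<Longrightarrow> isCont (\<lambda>t. c t $$ (i, j)) 0"
    and Sp: "\<And>t. c t \<in> carrier (Sp (2*n))"
    and ne: "\<And>t. t \<noteq> 0 \<Longrightarrow> c t <#\<^bsub>Sp (2*n)\<^esub> parabolic n \<in> schubert_variety n"
  shows "c 0 <#\<^bsub>Sp (2*n)\<^esub> parabolic n \<in> schubert_variety n"
proof -
  obtain F where F: "F \<subseteq> entry_polys (4*n)"
    "\<forall>A\<in>carrier (Sp (2*n)).
      A <#\<^bsub>Sp (2*n)\<^esub> parabolic n \<in> schubert_variety n \<longleftrightarrow> (\<forall>f\<in>F. f A = 0)"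
    by (rule schubert_variety_equations[of n])
  have "f (c 0) = 0" if f: "f \<in> F" for f
  proof -
    have "isCont (\<lambda>t. f (c t)) 0"
      by (rule entry_polys_continuous[OF subsetD[OF F(1) f] cont])
    then have lim: "((\<lambda>t. f (c t)) \<longlongrightarrow> f (c 0)) (at 0)" by (simp only: isCont_def)
    have "f (c t) = 0" if "t \<noteq> 0" for t
      using iffD1[OF bspec[OF F(2) Sp] ne[OF that]] f by (rule bspec)
    then have "\<forall>\<^sub>F t in at 0. f (c t) = 0"
      by (simp add: eventually_at_filter)
    with lim have "((\<lambda>t. 0) \<longlongrightarrow> f (c 0)) (at (0::complex))"
      by (rule Lim_transform_eventually)
    from tendsto_unique[OF at_neq_bot this tendsto_const] show ?thesis .
  qed
  then show ?thesis by (intro iffD2[OF bspec[OF F(2) Sp]] ballI)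
qed

text \<open>The root subgroups; the two summands coincide for a long root, whose parameter is
  therefore doubled.\<close>

definition root_elt :: "nat \<Rightarrow> nat \<Rightarrow> nat \<Rightarrow> complex \<Rightarrow> complex mat" where
  "root_elt m a b s = mat (2*m) (2*m) (\<lambda>(i, j). (if i = j then 1 else 0)
     + (if i = a \<and> j = b then s else 0)
     + (if i = 2*m - Suc b \<and> j = 2*m - Suc a then - (s * sgn_half m a * sgn_half m b) else 0))"

lemma root_elt_carrier [simp]: "root_elt m a b s \<in> carrier_mat (2*m) (2*m)"
  by (simp add: root_elt_def)

lemma root_elt_index:
  "i < 2*m \<Longrightarrow> j < 2*m \<Longrightarrow> root_elt m a b s $$ (i, j) = (if i = j then 1 else 0)
     + (if i = a \<and> j = b then s else 0)
     + (if i = 2*m - Suc b \<and> j = 2*m - Suc a then - (s * sgn_half m a * sgn_half m b) else 0)"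
  by (simp add: root_elt_def)

lemma root_elt_mult:
  assumes A: "A \<in> carrier_mat (2*m) (2*m)" and ab: "a < 2*m" "b < 2*m" and ij: "i < 2*m" "j < 2*m"
  shows "(root_elt m a b s * A) $$ (i, j) = A $$ (i, j) + (if i = a then s * A $$ (b, j) else 0)
    + (if i = 2*m - Suc b then - (s * sgn_half m a * sgn_half m b) * A $$ (2*m - Suc a, j) else 0)"
proof -
  have "(root_elt m a b s * A) $$ (i, j) = (\<Sum>k<2*m. root_elt m a b s $$ (i, k) * A $$ (k, j))"
    using A ij by (intro mat_mult_entry) auto
  also have "\<dots> = (\<Sum>k<2*m. (if k = i then A $$ (k, j) else 0)
      + (if k = b then (if i = a then s * A $$ (k, j) else 0) else 0)
      + (if k = 2*m - Suc a then (if i = 2*m - Suc b then - (s * sgn_half m a * sgn_half m b) * A $$ (k, j) else 0) else 0))"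
    using ij by (intro sum.cong) (auto simp: root_elt_def algebra_simps)
  also have "\<dots> = A $$ (i, j) + (if i = a then s * A $$ (b, j) else 0)
    + (if i = 2*m - Suc b then - (s * sgn_half m a * sgn_half m b) * A $$ (2*m - Suc a, j) else 0)"
    using ab ij by (simp add: sum.distrib)
  finally show ?thesis .
qed

lemma root_elt_Sp:
  assumes ab: "a < 2*m" "b < 2*m" "a \<noteq> b"
  shows "root_elt m a b s \<in> carrier (Sp m)"
proof -
  have "sp_inv m (root_elt m a b s) = root_elt m a b (- s)"
  proof (rule eq_matI)
    fix i j assume "i < dim_row (root_elt m a b (- s))" "j < dim_col (root_elt m a b (- s))"
    then have ij: "i < 2*m" "j < 2*m" by (auto simp: root_elt_def)
    define i' j' where "i' = 2*m - Suc i" and "j' = 2*m - Suc j"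
    define a' b' where "a' = 2*m - Suc a" and "b' = 2*m - Suc b"
    have e: "j' = i' \<longleftrightarrow> i = j" "j' = a \<longleftrightarrow> j = a'" "i' = b \<longleftrightarrow> i = b'" "j' = b' \<longleftrightarrow> j = b" "i' = a' \<longleftrightarrow> i = a"
      using ij ab by (auto simp: i'_def j'_def a'_def b'_def)
    have sg: "sgn_half m a' = - sgn_half m a" "sgn_half m b' = - sgn_half m b"
      using ab by (simp_all add: a'_def b'_def)
    have lt: "j' < 2*m" "i' < 2*m" using ij by (auto simp: i'_def j'_def)
    have "sp_inv m (root_elt m a b s) $$ (i, j)
        = sgn_half m i * sgn_half m j * root_elt m a b s $$ (j', i')"
      unfolding i'_def j'_def by (rule sp_inv_index[OF ij])
    also have "\<dots> = sgn_half m i * sgn_half m j *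
       ((if i = j then 1 else 0) + (if j = a' \<and> i = b' then s else 0)
       + (if j = b \<and> i = a then - (s * sgn_half m a * sgn_half m b) else 0))"
      by (simp only: root_elt_index[OF lt, of a b s, folded a'_def b'_def] e)
    also have "\<dots> = (if i = j then 1 else 0) + (if i = b' \<and> j = a' then s * sgn_half m a * sgn_half m b else 0)
       + (if i = a \<and> j = b then - s else 0)"
    proof -
      have "sgn_half m b' * sgn_half m a' = sgn_half m a * sgn_half m b" by (simp only: sg) simp
      then have "sgn_half m i * sgn_half m j * (if j = a' \<and> i = b' then s else 0)
          = (if i = b' \<and> j = a' then s * sgn_half m a * sgn_half m b else 0)"
        by (cases "j = a'"; cases "i = b'") (simp_all only: simp_thms if_True if_False mult_zero_left mult_zero_right mult_ac)
      moreover have "sgn_half m i * sgn_half m j * (if j = b \<and> i = a then - (s * sgn_half m a * sgn_half m b) else 0)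
          = (if i = a \<and> j = b then - s else 0)"
        by (cases "j = b \<and> i = a") (auto simp: mult_ac)
      moreover have "sgn_half m i * sgn_half m j * (if i = j then 1 else 0) = (if i = j then 1 else 0)"
        by simp
      ultimately show ?thesis by (simp only: distrib_left)
    qed
    also have "\<dots> = root_elt m a b (- s) $$ (i, j)"
      unfolding root_elt_index[OF ij, of a b "- s", folded a'_def b'_def]
      by (simp only: minus_mult_left[symmetric] minus_minus add_ac)
    finally show "sp_inv m (root_elt m a b s) $$ (i, j) = root_elt m a b (- s) $$ (i, j)" .
  qed (auto simp: root_elt_def sp_inv_def)
  moreover have "root_elt m a b (- s) * root_elt m a b s = 1\<^sub>m (2*m)"
  proof (rule eq_matI)
    fix i j assume "i < dim_row (1\<^sub>m (2*m) :: complex mat)" "j < dim_col (1\<^sub>m (2*m) :: complex mat)"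
    then have ij: "i < 2*m" "j < 2*m" by auto
    define a' b' where "a' = 2*m - Suc a" and "b' = 2*m - Suc b"
    have ne: "a' \<noteq> a" "b' \<noteq> b" "a' \<noteq> b'" "a = b' \<longleftrightarrow> b = a'" using ab unfolding a'_def b'_def by presburger+
    have lt: "a' < 2*m" "b' < 2*m" using ab by (auto simp: a'_def b'_def)
    show "(root_elt m a b (- s) * root_elt m a b s) $$ (i, j) = 1\<^sub>m (2*m) $$ (i, j)"
    proof -
      \<comment> \<open>The index tests are kept as abstract propositions, so that the long root,
        where \<open>a = b'\<close> and \<open>b = a'\<close>, is covered by the same
        identity.\<close>
      have cancel: "D + (if P \<and> Q then s else 0) + (if R \<and> S then - u else 0)
          + (if P then - s * (if Q then 1 else 0) else 0) + (if R then u * (if S then 1 else 0) else 0) = D"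
        for D u P Q R S
        by (cases P; cases Q; cases R; cases S) simp_all
      have "root_elt m a b s $$ (b, j) = (if j = b then 1 else 0)"
        unfolding root_elt_index[OF ab(2) ij(2), of a b s, folded a'_def b'_def]
        by (simp only: ab(3)[symmetric] ne(2)[symmetric] simp_thms if_False add_0_right eq_commute[of b j])
      moreover have "root_elt m a b s $$ (a', j) = (if j = a' then 1 else 0)"
        unfolding root_elt_index[OF lt(1) ij(2), of a b s, folded a'_def b'_def]
        by (simp only: ne(1,3) simp_thms if_False add_0_right eq_commute[of a' j])
      ultimately show ?thesis
        unfolding root_elt_mult[OF root_elt_carrier ab(1,2) ij, folded a'_def b'_def]
          root_elt_index[OF ij, of a b s, folded a'_def b'_def]
        using cancel[of "if i = j then 1 else 0" "i = a" "j = b" "i = b'" "j = a'" "s * sgn_half m a * sgn_half m b"] ij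
        by (simp only: minus_mult_left[symmetric] minus_minus index_one_mat)
    qed
  qed (auto simp: root_elt_def)
  ultimately show ?thesis by (simp add: carrier_Sp)
qed

lemma root_elt_zero: "root_elt m a b 0 = 1\<^sub>m (2*m)"
  by (rule eq_matI) (auto simp: root_elt_def)

lemma root_elt_borel:
  assumes "b < 2*m" "a < b"
  shows "root_elt m a b s \<in> borel_subgroup m"
proof -
  have "root_elt m a b s \<in> carrier (Sp m)" using assms by (intro root_elt_Sp) auto
  moreover have "i \<le> j" if ij: "i < 2*m" "j < 2*m" and nz: "root_elt m a b s $$ (i, j) \<noteq> 0" for i j
  proof -
    have "i = j \<or> (i = a \<and> j = b) \<or> (i = 2*m - Suc b \<and> j = 2*m - Suc a)"
    proof (rule ccontr)
      assume *: "\<not> ?thesis"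
      then have "root_elt m a b s $$ (i, j) = 0" unfolding root_elt_index[OF ij] de_Morgan_disj
        by (simp only: if_False add_0_right simp_thms)
      with nz show False by contradiction
    qed
    then show ?thesis using assms by linarith
  qed
  ultimately show ?thesis
    unfolding borel_subgroup_eq supp_group_def by simp
qed

text \<open>In SL2, multiplying the lower unipotent with parameter t by the upper one with parameter
  -1/t gives rows (0, -1/t) and (t, 1). So row \<open>j\<close> becomes a multiple of the old row
  \<open>k\<close>, while row \<open>k\<close> mixes both and begins in the smaller block
  \<open>r j\<close>; the mirror rows behave alike. For a long root both parameters are doubled, and
  \<open>(2 * c) * (2 * t) = - 1\<close> gives the constant \<open>- 1 / (4 * t)\<close>.\<close>

lemma root_pair_rows:
  assumes r: "balanced n r" and jk: "j < k" "k < 4*n" "r j < r k" and t: "t \<noteq> 0"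
    and c: "c = (if k = 4*n - Suc j then - 1 / (4 * t) else - 1 / t)"
    and iq: "i < 4*n" "q < 4*n"
    and nz: "(root_elt (2*n) j k c * (root_elt (2*n) k j t * row_mat n r)) $$ (i, q) \<noteq> 0"
  shows "r (flip_swap (4*n) j k i) \<le> q div 2"
proof -
  let ?W = "row_mat n r"
  define j' k' where "j' = 4*n - Suc j" and "k' = 4*n - Suc k"
  have lt: "j < 4*n" "j' < 4*n" "k' < 4*n" using jk by (auto simp: j'_def k'_def)
  have ne: "j \<noteq> j'" "k \<noteq> k'" "j' \<noteq> k'" "j' = k \<longleftrightarrow> k' = j" "j \<noteq> k"
    using jk unfolding j'_def k'_def by presburger+
  have rflip: "r j' = 2*n - Suc (r j)" "r k' = 2*n - Suc (r k)"
    using balancedD(2)[OF r] jk lt by (auto simp: j'_def k'_def)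
  have r': "r k' < r j'" using rflip jk balancedD(1)[OF r, of k] by auto
  have W: "?W \<in> carrier_mat (2*(2*n)) (2*(2*n))" using row_mat_Sp[OF r] by (rule Sp_dims)
  define w where "w i = ?W $$ (i, q)" for i
  have w: "r i = q div 2" if "w i \<noteq> 0" "i < 4*n" for i
    using that row_mat_nonzero[of i n q r] iq by (auto simp: w_def)
  define e where "e = sgn_half (2*n) j * sgn_half (2*n) k"
  have e2: "e * e = 1" by (simp add: e_def mult.assoc mult.left_commute)
  \<comment> \<open>For a long root the two summands of the root element therefore add up instead of
    cancelling.\<close>
  have el: "e = - 1" if "k = j'"
    using that lt by (auto simp: e_def sgn_half_def j'_def)
  define v where "v i = w i + (if i = k then t * w j else 0) + (if i = j' then - (t * e) * w k' else 0)" for i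
  have v: "(root_elt (2*n) k j t * ?W) $$ (x, q) = v x" if "x < 4*n" for x
    using root_elt_mult[OF W, of k j x q t] jk lt that iq
    by (simp add: v_def w_def e_def j'_def k'_def mult_ac)
  have V: "root_elt (2*n) k j t * ?W \<in> carrier_mat (2*(2*n)) (2*(2*n))"
    by (rule mult_carrier_mat[OF root_elt_carrier W])
  have nz': "v i + (if i = j then c * v k else 0) + (if i = k' then - (c * e) * v j' else 0) \<noteq> 0"
  proof -
    have d: "2*(2*n) = 4*n" by simp
    have "(root_elt (2*n) j k c * (root_elt (2*n) k j t * ?W)) $$ (i, q)
        = (root_elt (2*n) k j t * ?W) $$ (i, q) + (if i = j then c * (root_elt (2*n) k j t * ?W) $$ (k, q) else 0)
        + (if i = k' then - (c * sgn_half (2*n) j * sgn_half (2*n) k) * (root_elt (2*n) k j t * ?W) $$ (j', q) else 0)"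
      using root_elt_mult[OF V, unfolded d, OF lt(1) jk(2) iq, of c] by (simp only: j'_def k'_def)
    also have "\<dots> = v i + (if i = j then c * v k else 0) + (if i = k' then - (c * e) * v j' else 0)"
      by (simp only: v[OF iq(1)] v[OF jk(2)] v[OF lt(2)] e_def mult.assoc)
    finally show ?thesis using nz by (simp only: simp_thms)
  qed
  have s: "flip_swap (4*n) j k x = (if x = j then k else if x = k then j else if x = j' then k' else if x = k' then j' else x)" for x
    by (simp add: flip_swap_def j'_def k'_def)
  show ?thesis
  proof (cases "k = j'")
    case True
    then have k': "k' = j" "j' = k" using ne by auto
    have c': "c * (4 * t) = - 1" using c True t by (simp add: j'_def)
    have vk: "v k = w k + 2 * t * w j" using True ne k' el by (simp add: v_def)
    consider "i = j" | "i = k" | "i \<noteq> j" "i \<noteq> k" by blast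
    then show ?thesis
    proof cases
      case 1
      have "v i + (if i = j then c * v k else 0) + (if i = k' then - (c * e) * v j' else 0) = w j + 2 * c * v k"
        using 1 k' ne el[OF True] by (simp add: v_def[of j])
      also have "\<dots> = w j + (c * (4 * t)) * w j + 2 * c * w k" by (simp add: vk algebra_simps)
      also have "\<dots> = 2 * c * w k" by (simp add: c')
      finally have "w k \<noteq> 0" using nz' by auto
      then show ?thesis using w[of k] jk 1 by (simp add: s)
    next
      case 2
      then have "v k \<noteq> 0" using nz' ne k' by simp
      then have "w k \<noteq> 0 \<or> w j \<noteq> 0" by (auto simp: vk)
      then show ?thesis using w[of k] w[of j] jk lt 2 by (auto simp: s)
    next
      case 3
      then have "w i \<noteq> 0" using nz' k' by (simp add: v_def)
      then show ?thesis using w[of i] iq 3 k' by (simp add: s)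
    qed
  next
    case False
    have ct: "c * t = - 1" using c False t by (simp add: j'_def)
    have vk: "v k = w k + t * w j" using False by (simp add: v_def)
    have vj': "v j' = w j' - t * e * w k'" using False by (simp add: v_def)
    have vo: "v x = w x" if "x \<noteq> k" "x \<noteq> j'" for x using that by (simp add: v_def)
    have kj: "k' \<noteq> j" using ne False by blast
    consider "i = j" | "i = k" | "i = j'" | "i = k'" | "i \<notin> {j, k, j', k'}" by blast
    then show ?thesis
    proof cases
      case 1
      have "v i + (if i = j then c * v k else 0) + (if i = k' then - (c * e) * v j' else 0) = w j + c * v k"
        using 1 kj ne vo[of j] by simp
      also have "\<dots> = w j + (c * t) * w j + c * w k" by (simp add: vk algebra_simps)
      finally have "w k \<noteq> 0" using nz' by (auto simp: ct)
      then show ?thesis using w[of k] jk 1 by (simp add: s)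
    next
      case 2
      then have "v k \<noteq> 0" using nz' ne by simp
      then have "w k \<noteq> 0 \<or> w j \<noteq> 0" by (auto simp: vk)
      then show ?thesis using w[of k] w[of j] jk lt 2 ne by (auto simp: s)
    next
      case 3
      then have "v j' \<noteq> 0" using nz' ne by simp
      then have "w j' \<noteq> 0 \<or> w k' \<noteq> 0" by (auto simp: vj')
      then show ?thesis using w[of j'] w[of k'] r' lt 3 ne False by (auto simp: s)
    next
      case 4
      have "v i + (if i = j then c * v k else 0) + (if i = k' then - (c * e) * v j' else 0) = w k' - c * e * v j'"
        using 4 kj ne vo[of k'] by simp
      also have "\<dots> = w k' + (c * t) * (e * e) * w k' - c * e * w j'" by (simp add: vj' algebra_simps)
      finally have "w j' \<noteq> 0" using nz' by (auto simp: ct e2)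
      then show ?thesis using w[of j'] lt 4 ne kj by (auto simp: s)
    next
      case 5
      then have "w i \<noteq> 0" using nz' by (simp add: v_def)
      then show ?thesis using w[of i] iq 5 by (simp add: s)
    qed
  qed
qed

text \<open>The curve is \<open>b * x t * row_mat n r\<close> with a lower unipotent
  \<open>x t\<close>. For nonzero \<open>t\<close>, an upper unipotent \<open>y\<close> brings
  \<open>x t * row_mat n r\<close> into the coset of the swapped function, so the curve lies in its
  Borel orbit, with \<open>b * sp_inv (2*n) y\<close> as the Borel element. At 0 it reaches the
  smaller orbit.\<close>

lemma degeneration_step:
  assumes r: "balanced n r" and jk: "j < k" "k < 4*n" "r j < r k"
    and IH: "\<And>b. b \<in> borel_subgroup (2*n) \<Longrightarrow>
      (b * row_mat n (r \<circ> flip_swap (4*n) j k)) <#\<^bsub>Sp (2*n)\<^esub> parabolic n \<in> schubert_variety n"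
    and b: "b \<in> borel_subgroup (2*n)"
  shows "(b * row_mat n r) <#\<^bsub>Sp (2*n)\<^esub> parabolic n \<in> schubert_variety n"
proof -
  let ?W = "row_mat n r" and ?r' = "r \<circ> flip_swap (4*n) j k"
  have r': "balanced n ?r'" using jk by (intro balanced_swap[OF r]) auto
  have WS: "?W \<in> carrier (Sp (2*n))" using r by (rule row_mat_Sp)
  have W: "?W \<in> carrier_mat (2*(2*n)) (2*(2*n))" using WS by (rule Sp_dims)
  have bS: "b \<in> carrier (Sp (2*n))" using b by (rule borel_Sp)
  define x where "x t = root_elt (2*n) k j t" for t
  have xS: "x t \<in> carrier (Sp (2*n))" for t unfolding x_def using jk by (intro root_elt_Sp) auto
  define c where "c t = b * (x t * ?W)" for t
  have xWS: "x t * ?W \<in> carrier (Sp (2*n))" for t using xS WS by (rule mult_mat_Sp)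
  have "c 0 <#\<^bsub>Sp (2*n)\<^esub> parabolic n \<in> schubert_variety n"
  proof (rule schubert_variety_curve)
    show "c t \<in> carrier (Sp (2*n))" for t unfolding c_def using bS xWS by (rule mult_mat_Sp)
    fix i q assume iq: "i < 4*n" "q < 4*n"
    have xm: "(x t * ?W) $$ (l, q) = ?W $$ (l, q) + (if l = k then t * ?W $$ (j, q) else 0)
        + (if l = 4*n - Suc j then - (t * sgn_half (2*n) k * sgn_half (2*n) j) * ?W $$ (4*n - Suc k, q) else 0)"
      if "l < 4*n" for l t
      using root_elt_mult[OF W, of k j l q t] that jk iq by (simp add: x_def)
    have "c t $$ (i, q) = (\<Sum>l<4*n. b $$ (i, l) * (?W $$ (l, q) + (if l = k then t * ?W $$ (j, q) else 0)
        + (if l = 4*n - Suc j then - (t * sgn_half (2*n) k * sgn_half (2*n) j) * ?W $$ (4*n - Suc k, q) else 0)))" for t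
      unfolding c_def using Sp_mult_entry[OF bS xWS, of i q] iq jk
      by (simp add: xm)
    moreover have "isCont (\<lambda>t. (\<Sum>l<4*n. b $$ (i, l) * (?W $$ (l, q) + (if l = k then t * ?W $$ (j, q) else 0)
        + (if l = 4*n - Suc j then - (t * sgn_half (2*n) k * sgn_half (2*n) j) * ?W $$ (4*n - Suc k, q) else 0)))) 0"
    proof -
      have isCont_if: "isCont (\<lambda>t. if P then f t else 0) (0::complex)"
        if "isCont f (0::complex)" for P and f :: "complex \<Rightarrow> complex"
        using that by (cases P) simp_all
      show ?thesis by (intro continuous_intros isCont_if)
    qed
    ultimately show "isCont (\<lambda>t. c t $$ (i, q)) 0" by simp
  next
    fix t :: complex assume t: "t \<noteq> 0"
    define d where "d = (if k = 4*n - Suc j then - 1 / (4 * t) else - 1 / t)"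
    define y where "y = root_elt (2*n) j k d"
    have y: "y \<in> borel_subgroup (2*n)" unfolding y_def using jk by (intro root_elt_borel) auto
    have yS: "y \<in> carrier (Sp (2*n))" using y by (rule borel_Sp)
    have AS: "y * (x t * ?W) \<in> carrier (Sp (2*n))" using yS xWS by (rule mult_mat_Sp)
    have bB: "b * sp_inv (2*n) y \<in> borel_subgroup (2*n)" using b y by (intro borel_mult borel_inv)
    have coset: "(y * (x t * ?W)) <#\<^bsub>Sp (2*n)\<^esub> parabolic n = row_mat n ?r' <#\<^bsub>Sp (2*n)\<^esub> parabolic n"
      by (rule coset_row_mat[OF AS r'])
        (use root_pair_rows[OF r jk t d_def] in \<open>simp add: x_def y_def\<close>)
    have "c t = b * sp_inv (2*n) y * (y * (x t * ?W))"
      unfolding c_def by (simp only: Sp_assoc[OF bS sp_inv_closed[OF yS] AS] Sp_cancel(1)[OF yS xWS])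
    then have "c t <#\<^bsub>Sp (2*n)\<^esub> parabolic n
        = (b * sp_inv (2*n) y) <#\<^bsub>Sp (2*n)\<^esub> ((y * (x t * ?W)) <#\<^bsub>Sp (2*n)\<^esub> parabolic n)"
      using coset_mult[OF borel_Sp[OF bB] AS] by simp
    also have "\<dots> = (b * sp_inv (2*n) y * row_mat n ?r') <#\<^bsub>Sp (2*n)\<^esub> parabolic n"
      unfolding coset by (rule coset_mult[OF borel_Sp[OF bB] row_mat_Sp[OF r']])
    finally show "c t <#\<^bsub>Sp (2*n)\<^esub> parabolic n \<in> schubert_variety n" using IH[OF bB] by simp
  qed
  moreover have "c 0 = b * ?W" using W by (simp add: c_def x_def root_elt_zero)
  ultimately show ?thesis by simp
qed

lemma row_mat_in_schubert:
  assumes n: "n \<ge> 1" and r: "admissible n r" and b: "b \<in> borel_subgroup (2*n)"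
  shows "(b * row_mat n r) <#\<^bsub>Sp (2*n)\<^esub> parabolic n \<in> schubert_variety n"
  using r b
proof (induction arbitrary: b rule: admissible_induct)
  case (base r)
  obtain A where A: "A \<in> tau_bar n" using tau_bar_props(1)[OF n] by blast
  have AS: "A \<in> carrier (Sp (2*n))" using tau_bar_props(2)[OF n A] .
  have rb: "balanced n r" using base(1) by (simp add: admissible_def)
  have bS: "b \<in> carrier (Sp (2*n))" using base(3) by (rule borel_Sp)
  have "A <#\<^bsub>Sp (2*n)\<^esub> parabolic n = row_mat n r <#\<^bsub>Sp (2*n)\<^esub> parabolic n"
  proof (rule coset_row_mat[OF AS rb])
    fix a q assume "a < 4*n" "q < 4*n" "A $$ (a, q) \<noteq> 0"
    then show "r a \<le> q div 2" using tau_bar_props(3)[OF n A, of a q] base(2)[of a] by (simp add: id_row_def)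
  qed
  then have "(b * row_mat n r) <#\<^bsub>Sp (2*n)\<^esub> parabolic n = (b * A) <#\<^bsub>Sp (2*n)\<^esub> parabolic n"
    by (simp only: coset_mult[OF bS AS, symmetric] coset_mult[OF bS row_mat_Sp[OF rb], symmetric])
  also have "\<dots> \<in> schubert_cell n"
    unfolding schubert_cell_def set_mult_def using base(3) A by auto
  also have "schubert_cell n \<subseteq> schubert_variety n"
    unfolding schubert_variety_def
  proof (rule closure_of_subset)
    show "schubert_cell n \<subseteq> topspace (zariski_flag n)"
      unfolding topspace_zariski_flag schubert_cell_def set_mult_def
      using tau_bar_props(2)[OF n] borel_Sp by (auto intro!: flag_varietyI mult_mat_Sp)
  qed
  finally show ?case .
next
  case (step r j k)
  then have "balanced n r" by (simp add: admissible_def)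
  then show ?case by (rule degeneration_step[OF _ step.hyps(2-4) step.IH step.prems])
qed

text \<open>The matrices violating the bound form an open set that is a union of cosets. Were a
  point of the closure in it, it would meet the cell, where the bound holds.\<close>

lemma schubert_variety_bound:
  assumes n: "n \<ge> 1" and A: "A \<in> carrier (Sp (2*n))"
    and x: "A <#\<^bsub>Sp (2*n)\<^esub> parabolic n \<in> schubert_variety n"
    and aq: "a < 4*n" "q < 4*n" "A $$ (a, q) \<noteq> 0"
  shows "a \<le> 2*n + q div 2"
proof (rule ccontr)
  let ?C = "\<lambda>A. A <#\<^bsub>Sp (2*n)\<^esub> parabolic n"
  assume "\<not> a \<le> 2*n + q div 2"
  define good where "good A \<longleftrightarrow> (\<forall>a<4*n. \<forall>q<4*n. A $$ (a, q) \<noteq> 0 \<longrightarrow> a \<le> 2*n + q div 2)" for A :: "complex mat"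
  have "\<not> good A" using aq \<open>\<not> a \<le> 2*n + q div 2\<close> by (auto simp: good_def)
  define V where "V = {?C B | B. B \<in> carrier (Sp (2*n)) \<and> \<not> good B}"
  \<comment> \<open>A block triangular factor on the right combines a column only with columns of
    the same or earlier blocks, for which the bound is at least as strong.\<close>
  have good_coset: "good B" if B: "B \<in> carrier (Sp (2*n))" "?C B = ?C B'" and B': "B' \<in> carrier (Sp (2*n))" "good B'" for B B'
  proof -
    obtain h where h: "h \<in> blk_group (2*n)" "B = B' * h" using coset_eqD[OF B] by blast
    show ?thesis unfolding good_def
    proof (intro allI impI)
      fix a q assume aq: "a < 4*n" "q < 4*n" "B $$ (a, q) \<noteq> 0"
      then obtain k where k: "k < 2*(2*n)" "B' $$ (a, k) \<noteq> 0" "h $$ (k, q) \<noteq> 0"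
        using Sp_mult_nonzero[OF B'(1) blk_Sp[OF h(1)], of a q] h(2) by auto
      have "a \<le> 2*n + k div 2" using B'(2) aq k by (auto simp: good_def)
      moreover have "k div 2 \<le> q div 2"
        using supp_groupD(2)[OF h(1)[unfolded blk_group_def], of k q] k aq by simp
      ultimately show "a \<le> 2*n + q div 2" by linarith
    qed
  qed
  have pre: "{B \<in> carrier (Sp (2*n)). ?C B \<in> V} = {B \<in> carrier (Sp (2*n)). \<not> good B}"
    unfolding V_def using good_coset by blast
  define F :: "(complex mat \<Rightarrow> complex) set" where
    "F = (\<lambda>(a, q) A. A $$ (a, q)) ` {(a, q). a < 4*n \<and> q < 4*n \<and> \<not> a \<le> 2*n + q div 2}"
  have "F \<subseteq> entry_polys (2*(2*n))" unfolding F_def by (auto intro!: entry_polys.entry)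
  moreover have "{B \<in> carrier (Sp (2*n)). \<not> good B} = carrier (Sp (2*n)) - {A. \<forall>f\<in>F. f A = 0}"
    unfolding F_def good_def by auto
  ultimately have "zariski_open_Sp (2*n) {B \<in> carrier (Sp (2*n)). \<not> good B}"
    unfolding zariski_open_Sp_def by blast
  then have "openin (zariski_flag n) V"
    using pre by (auto simp: openin_zariski_flag zariski_open_flag_def openin_zariski_Sp V_def flag_varietyI)
  moreover have "?C A \<in> V" using A \<open>\<not> good A\<close> by (auto simp: V_def)
  ultimately obtain y where y: "y \<in> schubert_cell n" "y \<in> V"
    using x unfolding schubert_variety_def in_closure_of by blast
  obtain b T where bT: "y = ?C (b * T)" "b \<in> borel_subgroup (2*n)" "T \<in> tau_bar n"
    using y(1) unfolding schubert_cell_def set_mult_def by auto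
  have S: "b \<in> carrier (Sp (2*n))" "T \<in> carrier (Sp (2*n))"
    using bT borel_Sp tau_bar_props(2)[OF n] by auto
  \<comment> \<open>In row \<open>k\<close>, \<open>T\<close> meets only block
    \<open>id_row n k\<close>, and an upper triangular \<open>b\<close> brings row \<open>k\<close>
    only to rows \<open>a \<le> k\<close>.\<close>
  have "good (b * T)" unfolding good_def
  proof (intro allI impI)
    fix a q assume aq: "a < 4*n" "q < 4*n" "(b * T) $$ (a, q) \<noteq> 0"
    then obtain k where k: "k < 2*(2*n)" "b $$ (a, k) \<noteq> 0" "T $$ (k, q) \<noteq> 0"
      using Sp_mult_nonzero[OF S, of a q] by auto
    have "a \<le> k" using supp_groupD(2)[OF bT(2)[unfolded borel_subgroup_eq], of a k] k aq by simp
    moreover have "id_row n k = q div 2" using tau_bar_props(3)[OF n bT(3), of k q] k aq by simp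
    ultimately show "a \<le> 2*n + q div 2" by (simp add: id_row_def split: if_splits)
  qed
  moreover have "b * T \<in> {B \<in> carrier (Sp (2*n)). ?C B \<in> V}"
    using y(2) bT(1) mult_mat_Sp[OF S] by simp
  ultimately show False unfolding pre by simp
qed


subsection \<open>Symplectic Dellac configurations\<close>

text \<open>The subtraction and \<open>Suc a\<close> translate between cells counted from 1 and
  functions counted from 0; the description is meaningful for columns \<open>a < 4*n\<close> of a
  configuration.\<close>

definition config_row :: "(nat \<times> nat) set \<Rightarrow> nat \<Rightarrow> nat" where
  "config_row D a = (THE i. (i, Suc a) \<in> D) - 1"

definition row_config :: "nat \<Rightarrow> (nat \<Rightarrow> nat) \<Rightarrow> (nat \<times> nat) set" where
  "row_config n r = (\<lambda>a. (Suc (r a), Suc a)) ` {..<4*n}"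

lemma SpDC_config_row:
  assumes D: "D \<in> SpDC n"
  shows "a < 4*n \<Longrightarrow> (i, Suc a) \<in> D \<longleftrightarrow> i = Suc (config_row D a)"
    "D = row_config n (config_row D)"
    "admissible n (config_row D)"
proof -
  have sub: "D \<subseteq> {1..2*n} \<times> {1..4*n}"
    and ex1: "\<And>j. j \<in> {1..4*n} \<Longrightarrow> \<exists>!i. (i, j) \<in> D"
    and card: "\<And>i. i \<in> {1..2*n} \<Longrightarrow> card {j. (i, j) \<in> D} = 2"
    and le: "\<And>i j. (i, j) \<in> D \<Longrightarrow> i \<le> j"
    and sym: "\<And>i j. i \<in> {1..2*n} \<Longrightarrow> j \<in> {1..2*n} \<Longrightarrow>
        (i, j) \<in> D \<longleftrightarrow> (2*n - i + 1, 4*n - j + 1) \<in> D"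
    using D unfolding SpDC_def by blast+
  let ?r = "config_row D"
  have mem: "(i, Suc a) \<in> D \<longleftrightarrow> i = Suc (?r a)" if a: "a < 4*n" for i a
  proof -
    have u: "\<exists>!i. (i, Suc a) \<in> D" using a by (intro ex1) simp
    then have t: "(THE i. (i, Suc a) \<in> D, Suc a) \<in> D" by (rule theI')
    then have "(THE i. (i, Suc a) \<in> D) \<in> {1..2*n}" using sub by blast
    then have "Suc (?r a) = (THE i. (i, Suc a) \<in> D)" by (simp add: config_row_def)
    then show ?thesis using u t by metis
  qed
  then show "a < 4*n \<Longrightarrow> (i, Suc a) \<in> D \<longleftrightarrow> i = Suc (?r a)" .
  show "D = row_config n ?r"
  proof (intro equalityI subsetI)
    fix x assume x: "x \<in> D"
    obtain i j where ij: "x = (i, j)" by fastforce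
    then have j: "j \<in> {1..4*n}" using x sub by blast
    define a where "a = j - 1"
    have a: "j = Suc a" "a < 4*n" using j by (auto simp: a_def)
    have "i = Suc (?r a)" using mem[OF a(2)] x ij a(1) by simp
    then show "x \<in> row_config n ?r" using ij a by (simp add: row_config_def)
  next
    fix x assume "x \<in> row_config n ?r"
    then obtain a where "a < 4*n" "x = (Suc (?r a), Suc a)" by (auto simp: row_config_def)
    then show "x \<in> D" using mem by simp
  qed
  have in_D: "(Suc (?r a), Suc a) \<in> D" if "a < 4*n" for a using mem[OF that] by simp
  have less: "?r a < 2*n" if "a < 4*n" for a using in_D[OF that] sub by auto
  have flip_low: "?r (4*n - Suc a) = 2*n - Suc (?r a)" if a: "a < 2*n" for a
  proof -
    have a4: "a < 4*n" using a by simp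
    have "(2*n - Suc (?r a) + 1, 4*n - Suc a + 1) \<in> D"
      using sym[of "Suc (?r a)" "Suc a"] in_D[OF a4] less[OF a4] a by simp
    then have "(Suc (2*n - Suc (?r a)), Suc (4*n - Suc a)) \<in> D" by (simp only: Suc_eq_plus1)
    then have "Suc (2*n - Suc (?r a)) = Suc (?r (4*n - Suc a))"
      by (rule iffD1[OF mem, rotated]) (use a in simp)
    then show ?thesis by simp
  qed
  \<comment> \<open>The symmetry of configurations is stated on the left half of the board. A column
    of the right half is the mirror of one on the left, and the relation can be solved for either
    row.\<close>
  have flip: "?r (4*n - Suc a) = 2*n - Suc (?r a)" if a: "a < 4*n" for a
  proof (cases "a < 2*n")
    case False
    define b where "b = 4*n - Suc a"
    have b: "b < 2*n" "a = 4*n - Suc b" using a False by (auto simp: b_def)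
    have "?r a = 2*n - Suc (?r b)" unfolding b(2) by (rule flip_low[OF b(1)])
    moreover have "?r b < 2*n" using b(1) by (intro less) simp
    ultimately show ?thesis unfolding b_def[symmetric] by linarith
  qed (rule flip_low)
  have "card {a. a < 4*n \<and> ?r a = k} = 2" if k: "k < 2*n" for k
  proof -
    have "{j. (Suc k, j) \<in> D} = Suc ` {a. a < 4*n \<and> ?r a = k}"
    proof (intro equalityI subsetI)
      fix j assume "j \<in> {j. (Suc k, j) \<in> D}"
      then have j: "(Suc k, j) \<in> D" by simp
      then have "j \<in> {1..4*n}" using sub by blast
      then have a: "j = Suc (j - 1)" "j - 1 < 4*n" by auto
      have "?r (j - 1) = k" using mem[OF a(2), of "Suc k"] j a(1) by simp
      then show "j \<in> Suc ` {a. a < 4*n \<and> ?r a = k}" using a by (intro image_eqI[of _ _ "j - 1"]) simp_all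
    next
      fix j assume "j \<in> Suc ` {a. a < 4*n \<and> ?r a = k}"
      then show "j \<in> {j. (Suc k, j) \<in> D}" using in_D by auto
    qed
    then have "card {a. a < 4*n \<and> ?r a = k} = card {j. (Suc k, j) \<in> D}"
      by (simp add: card_image)
    then show ?thesis using card[of "Suc k"] k by simp
  qed
  moreover have "?r a \<le> a" if "a < 4*n" for a using le[OF in_D[OF that]] by simp
  ultimately show "admissible n ?r"
    using less flip by (simp only: admissible_def balanced_def) blast
qed

lemma row_config_SpDC:
  assumes r: "admissible n r"
  shows "row_config n r \<in> SpDC n" "a < 4*n \<Longrightarrow> config_row (row_config n r) a = r a"
proof -
  have b: "balanced n r" and le: "\<And>a. a < 4*n \<Longrightarrow> r a \<le> a" using r by (auto simp: admissible_def)
  let ?D = "row_config n r"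
  have mem: "(i, j) \<in> ?D \<longleftrightarrow> 1 \<le> j \<and> j \<le> 4*n \<and> i = Suc (r (j - 1))" for i j
    unfolding row_config_def by (cases j) auto
  show "a < 4*n \<Longrightarrow> config_row ?D a = r a"
    unfolding config_row_def mem by simp
  have card: "card ?D = 4*n"
    unfolding row_config_def by (subst card_image) (auto intro: inj_onI)
  have sub: "?D \<subseteq> {1..2*n} \<times> {1..4*n}"
    using balancedD(1)[OF b] by (auto simp: row_config_def Suc_le_eq)
  have col: "\<exists>!i. (i, j) \<in> ?D" if "j \<in> {1..4*n}" for j
    using that unfolding mem by auto
  have row: "card {j. (i, j) \<in> ?D} = 2" if i: "i \<in> {1..2*n}" for i
  proof -
    have "{j. (i, j) \<in> ?D} = Suc ` {a. a < 4*n \<and> r a = i - 1}"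
    proof (intro equalityI subsetI)
      fix j assume "j \<in> {j. (i, j) \<in> ?D}"
      then have "1 \<le> j" "j \<le> 4*n" "i = Suc (r (j - 1))" by (simp_all add: mem)
      then show "j \<in> Suc ` {a. a < 4*n \<and> r a = i - 1}"
        by (intro image_eqI[of _ _ "j - 1"]) auto
    next
      fix j assume "j \<in> Suc ` {a. a < 4*n \<and> r a = i - 1}"
      then show "j \<in> {j. (i, j) \<in> ?D}" using i by (auto simp: mem)
    qed
    then have "card {j. (i, j) \<in> ?D} = card {a. a < 4*n \<and> r a = i - 1}"
      by (simp add: card_image)
    also have "\<dots> = 2" using i by (intro balancedD(3)[OF b]) auto
    finally show ?thesis .
  qed
  have bound: "i \<le> j \<and> j \<le> 2*n + i" if ij: "(i, j) \<in> ?D" for i j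
  proof -
    have j: "1 \<le> j" "j - 1 < 4*n" "i = Suc (r (j - 1))" using ij by (auto simp: mem)
    then show ?thesis using le[OF j(2)] admissible_upper[OF r j(2)] by linarith
  qed
  have sym: "(i, j) \<in> ?D \<longleftrightarrow> (2*n - i + 1, 4*n - j + 1) \<in> ?D"
    if ij: "i \<in> {1..2*n}" "j \<in> {1..2*n}" for i j
  proof -
    have j: "j - 1 < 4*n" "4*n - j + 1 - 1 = 4*n - Suc (j - 1)" using ij by auto
    have "r (4*n - j + 1 - 1) = 2*n - Suc (r (j - 1))" "r (j - 1) < 2*n"
      unfolding j(2) using balancedD(1,2)[OF b j(1)] by simp_all
    then have "2*n - i + 1 = Suc (r (4*n - j + 1 - 1)) \<longleftrightarrow> i = Suc (r (j - 1))"
      using ij by auto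
    moreover have "1 \<le> j" "j \<le> 4*n" "1 \<le> 4*n - j + 1" "4*n - j + 1 \<le> 4*n" using ij by auto
    ultimately show ?thesis unfolding mem by blast
  qed
  show "?D \<in> SpDC n" unfolding SpDC_def
  proof (intro CollectI conjI ballI)
    fix x assume "x \<in> ?D"
    then show "case x of (i, j) \<Rightarrow> i \<le> j \<and> j \<le> 2*n + i" using bound by (cases x) simp
  qed (rule sub card | (rule col row, assumption) | (rule sym, assumption, assumption))+
qed

text \<open>Block triangular factors move the beginning of a row only to later blocks. With the
  roles of the two functions exchanged this gives equality, hence injectivity.\<close>

lemma row_mat_coset_less:
  assumes r: "balanced n r" and r': "balanced n r'"
    and e: "row_mat n r <#\<^bsub>Sp (2*n)\<^esub> parabolic n = row_mat n r' <#\<^bsub>Sp (2*n)\<^esub> parabolic n"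
    and a: "a < 4*n"
  shows "r' a \<le> r a"
proof -
  obtain h where h: "h \<in> blk_group (2*n)" "row_mat n r = row_mat n r' * h"
    using coset_eqD[OF row_mat_Sp[OF r] e] .
  have p: "fibre_pos r a < 4*n" using fibre_pos_less[OF r a] .
  have "(row_mat n r' * h) $$ (a, fibre_pos r a) \<noteq> 0"
    unfolding h(2)[symmetric] using row_mat_nonzero[OF a p] by simp
  then obtain k where k: "k < 2*(2*n)" "row_mat n r' $$ (a, k) \<noteq> 0" "h $$ (k, fibre_pos r a) \<noteq> 0"
    using Sp_mult_nonzero[OF row_mat_Sp[OF r'] blk_Sp[OF h(1)], of a "fibre_pos r a"] a p by auto
  have "k = fibre_pos r' a" using row_mat_nonzero[of a n k r'] k a by simp
  moreover have "k div 2 \<le> fibre_pos r a div 2"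
    using supp_groupD(2)[OF h(1)[unfolded blk_group_def] k(1) _ k(3)] p by simp
  ultimately show ?thesis by simp
qed

lemma row_mat_fixed:
  assumes r: "balanced n r" and t: "t \<in> torus (2*n)"
  shows "t <#\<^bsub>Sp (2*n)\<^esub> (row_mat n r <#\<^bsub>Sp (2*n)\<^esub> parabolic n) = row_mat n r <#\<^bsub>Sp (2*n)\<^esub> parabolic n"
proof -
  have tS: "t \<in> carrier (Sp (2*n))" using t by (simp add: torus_iff)
  have "(t * row_mat n r) <#\<^bsub>Sp (2*n)\<^esub> parabolic n = row_mat n r <#\<^bsub>Sp (2*n)\<^esub> parabolic n"
  proof (rule coset_row_mat[OF mult_mat_Sp[OF tS row_mat_Sp[OF r]] r])
    fix a q assume aq: "a < 4*n" "q < 4*n" "(t * row_mat n r) $$ (a, q) \<noteq> 0"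
    then obtain k where k: "k < 2*(2*n)" "t $$ (a, k) \<noteq> 0" "row_mat n r $$ (k, q) \<noteq> 0"
      using Sp_mult_nonzero[OF tS row_mat_Sp[OF r], of a q] by auto
    then have "k = a" using t aq by (auto simp: torus_iff)
    then have "q = fibre_pos r a" using k row_mat_nonzero[OF aq(1,2)] by simp
    then show "r a \<le> q div 2" by simp
  qed
  then show ?thesis using coset_mult[OF tS row_mat_Sp[OF r]] by simp
qed

lemma schubert_fixed_points_eq:
  assumes n: "n \<ge> 1"
  shows "schubert_fixed_points n
    = (\<lambda>r. row_mat n r <#\<^bsub>Sp (2*n)\<^esub> parabolic n) ` {r. admissible n r}"
proof (intro equalityI subsetI)
  fix x assume x: "x \<in> schubert_fixed_points n"
  then have xS: "x \<in> schubert_variety n"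
    and fixed: "\<And>t. t \<in> torus (2*n) \<Longrightarrow> t <#\<^bsub>Sp (2*n)\<^esub> x = x"
    by (auto simp: schubert_fixed_points_def)
  have "x \<in> flag_variety n"
    using subsetD[OF closure_of_subset_topspace xS[unfolded schubert_variety_def]]
    unfolding topspace_zariski_flag .
  then obtain A where A: "A \<in> carrier (Sp (2*n))" "x = A <#\<^bsub>Sp (2*n)\<^esub> parabolic n"
    by (auto simp: flag_variety_def LCOSETS_def)
  obtain r where r: "balanced n r"
    and low: "\<And>a q. a < 4*n \<Longrightarrow> q < 4*n \<Longrightarrow> A $$ (a, q) \<noteq> 0 \<Longrightarrow> r a \<le> q div 2"
    and ex: "\<And>a. a < 4*n \<Longrightarrow> \<exists>q<4*n. A $$ (a, q) \<noteq> 0 \<and> q div 2 = r a"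
    by (rule fixed_coset_rows[OF A(1) fixed[unfolded A(2)]]) (assumption, rule that, assumption, blast, blast)
  have up: "a \<le> 2*n + r a" if a: "a < 4*n" for a
  proof -
    obtain q where q: "q < 4*n" "A $$ (a, q) \<noteq> 0" "q div 2 = r a" using ex[OF a] by blast
    show ?thesis using schubert_variety_bound[OF n A(1) xS[unfolded A(2)] a q(1,2)] q(3) by simp
  qed
  \<comment> \<open>The bound obtained from the Schubert variety, taken at the mirror
    column.\<close>
  have "r a \<le> a" if a: "a < 4*n" for a
  proof -
    have "4*n - Suc a \<le> 2*n + r (4*n - Suc a)" using a by (intro up) simp
    then show ?thesis using balancedD(1,2)[OF r a] a by linarith
  qed
  then have "admissible n r" using r by (simp add: admissible_def)
  moreover have "x = row_mat n r <#\<^bsub>Sp (2*n)\<^esub> parabolic n"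
    unfolding A(2) using coset_row_mat[OF A(1) r low] .
  ultimately show "x \<in> (\<lambda>r. row_mat n r <#\<^bsub>Sp (2*n)\<^esub> parabolic n) ` {r. admissible n r}" by simp
next
  fix x assume "x \<in> (\<lambda>r. row_mat n r <#\<^bsub>Sp (2*n)\<^esub> parabolic n) ` {r. admissible n r}"
  then obtain r where r: "admissible n r" "x = row_mat n r <#\<^bsub>Sp (2*n)\<^esub> parabolic n" by auto
  then have b: "balanced n r" by (simp add: admissible_def)
  have "x \<in> schubert_variety n"
    using row_mat_in_schubert[OF n r(1) borel_one] row_mat_Sp[OF b] r(2) by (simp add: Sp_dims)
  then show "x \<in> schubert_fixed_points n"
    using row_mat_fixed[OF b] r(2) by (simp add: schubert_fixed_points_def)
qed

theorem theoremB:
  fixes n :: nat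
  assumes "n \<ge> 1"
  shows "\<exists>\<Phi>. bij_betw \<Phi> (SpDC n) (schubert_fixed_points n)"
proof (intro exI bij_betw_imageI)
  let ?\<Phi> = "\<lambda>D. row_mat n (config_row D) <#\<^bsub>Sp (2*n)\<^esub> parabolic n"
  show "inj_on ?\<Phi> (SpDC n)"
  proof (rule inj_onI)
    fix D E assume D: "D \<in> SpDC n" and E: "E \<in> SpDC n" and e: "?\<Phi> D = ?\<Phi> E"
    have b: "balanced n (config_row D)" "balanced n (config_row E)"
      using SpDC_config_row(3)[OF D] SpDC_config_row(3)[OF E] by (simp_all add: admissible_def)
    have "config_row D a = config_row E a" if "a < 4*n" for a
      using row_mat_coset_less[OF b e that] row_mat_coset_less[OF b(2,1) e[symmetric] that] by simp
    then have "row_config n (config_row D) = row_config n (config_row E)"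
      unfolding row_config_def by (intro image_cong) auto
    then show "D = E" using SpDC_config_row(2)[OF D] SpDC_config_row(2)[OF E] by simp
  qed
  have "row_mat n r <#\<^bsub>Sp (2*n)\<^esub> parabolic n \<in> ?\<Phi> ` SpDC n" if r: "admissible n r" for r
  proof (rule image_eqI[OF _ row_config_SpDC(1)[OF r]])
    \<comment> \<open>\<open>?r\<close> is only known to agree with \<open>r\<close> on columns
      below \<open>4*n\<close>, so the comparison is made between cosets and not between
      functions.\<close>
    let ?r = "config_row (row_config n r)"
    have b: "balanced n r" "balanced n ?r"
      using r SpDC_config_row(3)[OF row_config_SpDC(1)[OF r]] by (simp_all add: admissible_def)
    show "row_mat n r <#\<^bsub>Sp (2*n)\<^esub> parabolic n = ?\<Phi> (row_config n r)"
      using row_config_SpDC(2)[OF r] row_mat_nonzero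
      by (intro coset_row_mat[OF row_mat_Sp[OF b(1)] b(2)]) auto
  qed
  then show "?\<Phi> ` SpDC n = schubert_fixed_points n"
    unfolding schubert_fixed_points_eq[OF assms] using SpDC_config_row(3) by auto
qed

end
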